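(* Let $(S,\mathfrak{m},k)$ and $(T,\mathfrak{n},k)$ be local rings with common residue field $k$, with $S\neq k\neq T$, and let $R=S\times_k T$ be their fiber product over $k$. Let $X$ and $Y$ be finitely generated $S$-modules, let $Z$ be a finitely generated $T$-module, and let $m$ be a nonnegative integer. Then: (1) If $\operatorname{Tor}^R_{2m+1}(X,Y)=0$, then $X=0$ or $Y=0$. (2) If $\operatorname{Tor}^R_{2m}(Y,Z)=0$, then $Y=0$ or $Z=0$. (3) If $\operatorname{Tor}^R_{2m}(X,Y)=0$ and $X\neq 0$, then $Y$ is a free $S$-module. (4) If $T$ is not a discrete valuation domain and $\operatorname{Tor}^R_{2m}(X,Y)=0$, then $X=0$ or $Y=0$. (5) If $\operatorname{Tor}^R_{2m+1}(Y,Z)=0$ and $Y\neq 0$, then $Z$ is a free $T$-module. (6) If $S$ is not a discrete valuation domain, $m>0$, and $\operatorname{Tor}^R_{2m+1}(Y,Z)=0$, then $Y=0$ or $Z=0$. The corresponding statements, with the roles of $S$ and $T$ interchanged throughout, hold if $X$ and $Y$ are finitely generated $T$-modules and $Z$ is a finitely generated $S$-module.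
   Context: A local ring is a commutative Noetherian ring with a unique maximal ideal. With $\pi_S:S\to k$ and $\pi_T:T\to k$ the natural surjections onto the common residue field, the fiber product is the subring $R=S\times_k T=\{(s,t)\in S\times T : \pi_S(s)=\pi_T(t)\}$ of $S\times T$; it is a local ring with maximal ideal $\mathfrak{m}\times\mathfrak{n}$. The projections $R\to S$, $(s,t)\mapsto s$, and $R\to T$, $(s,t)\mapsto t$, are surjective, and $S$-modules and $T$-modules are regarded as $R$-modules via these projections. The zero module is considered free. *)

theory Defs
  imports "HOL-Algebra.Chinese_Remainder" "HOL-Algebra.Ring_Divisibility" "HOL-Algebra.Module"
begin

section \<open>Local rings and fiber products\<close>

locale local_ring = cring R + noetherian_ring R for R (structure) +
  assumes unique_maximal: "\<exists>!I. maximalideal I R"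

definition discrete_valuation_domain :: "('a, 'm) ring_scheme \<Rightarrow> bool" where
  "discrete_valuation_domain D \<longleftrightarrow> local_ring D \<and> principal_domain D \<and> \<not> field D"

definition fiber_product :: "'s ring \<Rightarrow> 't ring \<Rightarrow> ('s \<Rightarrow> 'k) \<Rightarrow> ('t \<Rightarrow> 'k) \<Rightarrow> ('s \<times> 't) ring" where
  "fiber_product S T p q =
     (RDirProd S T)\<lparr>carrier := {(s, t). s \<in> carrier S \<and> t \<in> carrier T \<and> p s = q t}\<rparr>"

section \<open>Modules\<close>

text \<open>
  The record type of modules extends that of rings, so it has fields \<^const>\<open>monoid.mult\<close> and
  \<^const>\<open>one\<close> which play no role for modules; below they are set to \<^const>\<open>undefined\<close>.
\<close>

definition zero_module :: "('a, 'b, 'm) module_scheme \<Rightarrow> bool" where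
  "zero_module M \<longleftrightarrow> carrier M = {\<zero>\<^bsub>M\<^esub>}"

definition restrict_scalars :: "('a \<Rightarrow> 'b) \<Rightarrow> ('b, 'm) module \<Rightarrow> ('a, 'm) module" where
  "restrict_scalars h M =
     \<lparr>carrier = carrier M, monoid.mult = monoid.mult M, one = one M, ring.zero = ring.zero M, add = add M,
      smult = (\<lambda>r x. h r \<odot>\<^bsub>M\<^esub> x)\<rparr>"

definition free_module :: "('a, 'm) ring_scheme \<Rightarrow> 'b set \<Rightarrow> ('a, 'b \<Rightarrow> 'a) module" where
  "free_module R B =
     \<lparr>carrier = {f. (\<forall>b. f b \<in> carrier R) \<and> (\<forall>b. b \<notin> B \<longrightarrow> f b = \<zero>\<^bsub>R\<^esub>) \<and> finite {b. f b \<noteq> \<zero>\<^bsub>R\<^esub>}},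
      monoid.mult = undefined, one = undefined,
      ring.zero = (\<lambda>_. \<zero>\<^bsub>R\<^esub>), add = (\<lambda>f g b. f b \<oplus>\<^bsub>R\<^esub> g b),
      smult = (\<lambda>r f b. r \<otimes>\<^bsub>R\<^esub> f b)\<rparr>"

definition basis_elem :: "('a, 'm) ring_scheme \<Rightarrow> 'b \<Rightarrow> 'b \<Rightarrow> 'a" where
  "basis_elem R b = (\<lambda>c. if c = b then \<one>\<^bsub>R\<^esub> else \<zero>\<^bsub>R\<^esub>)"

text \<open>The linear map from a free module to \<open>M\<close> that sends the basis element at \<open>b\<close> to \<open>v b\<close>.\<close>

definition linear_ext ::
  "('a, 'm) ring_scheme \<Rightarrow> ('a, 'c, 'n) module_scheme \<Rightarrow> ('b \<Rightarrow> 'c) \<Rightarrow> ('b \<Rightarrow> 'a) \<Rightarrow> 'c" where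
  "linear_ext R M v f = (\<Oplus>\<^bsub>M\<^esub>b \<in> {b. f b \<noteq> \<zero>\<^bsub>R\<^esub>}. f b \<odot>\<^bsub>M\<^esub> v b)"

definition fg_module :: "('a, 'm) ring_scheme \<Rightarrow> ('a, 'b, 'n) module_scheme \<Rightarrow> bool" where
  "fg_module R M \<longleftrightarrow> module R M \<and>
     (\<exists>A\<subseteq>carrier M. finite A \<and> linear_ext R M id ` carrier (free_module R A) = carrier M)"

definition is_free_module :: "('a, 'm) ring_scheme \<Rightarrow> ('a, 'b, 'n) module_scheme \<Rightarrow> bool" where
  "is_free_module R M \<longleftrightarrow> module R M \<and>
     (\<exists>B\<subseteq>carrier M. bij_betw (linear_ext R M id) (carrier (free_module R B)) (carrier M))"

definition span_module :: "('a, 'm) ring_scheme \<Rightarrow> ('a, 'b, 'n) module_scheme \<Rightarrow> 'b set \<Rightarrow> 'b set" where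
  "span_module R M A = (\<lambda>H. submodule H R M) hull A"

definition quotient_module :: "('a, 'b, 'n) module_scheme \<Rightarrow> 'b set \<Rightarrow> ('a, 'b set) module" where
  "quotient_module M H =
     \<lparr>carrier = a_rcosets\<^bsub>M\<^esub> H, monoid.mult = undefined, one = undefined,
      ring.zero = H, add = set_add M, smult = (\<lambda>r C. \<Union>c\<in>C. H +>\<^bsub>M\<^esub> (r \<odot>\<^bsub>M\<^esub> c))\<rparr>"

section \<open>Tensor products\<close>

definition tensor_rels ::
  "('a, 'm) ring_scheme \<Rightarrow> ('a, 'b) module \<Rightarrow> ('a, 'c) module \<Rightarrow> ('b \<times> 'c \<Rightarrow> 'a) set" where
  "tensor_rels R M N =
    (let P = free_module R (carrier M \<times> carrier N); e = basis_elem R in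
     span_module R P
      ({e (x \<oplus>\<^bsub>M\<^esub> x', y) \<ominus>\<^bsub>P\<^esub> (e (x, y) \<oplus>\<^bsub>P\<^esub> e (x', y)) |x x' y.
          x \<in> carrier M \<and> x' \<in> carrier M \<and> y \<in> carrier N} \<union>
       {e (x, y \<oplus>\<^bsub>N\<^esub> y') \<ominus>\<^bsub>P\<^esub> (e (x, y) \<oplus>\<^bsub>P\<^esub> e (x, y')) |x y y'.
          x \<in> carrier M \<and> y \<in> carrier N \<and> y' \<in> carrier N} \<union>
       {e (r \<odot>\<^bsub>M\<^esub> x, y) \<ominus>\<^bsub>P\<^esub> (r \<odot>\<^bsub>P\<^esub> e (x, y)) |r x y.
          r \<in> carrier R \<and> x \<in> carrier M \<and> y \<in> carrier N} \<union>
       {e (x, r \<odot>\<^bsub>N\<^esub> y) \<ominus>\<^bsub>P\<^esub> (r \<odot>\<^bsub>P\<^esub> e (x, y)) |r x y.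
          r \<in> carrier R \<and> x \<in> carrier M \<and> y \<in> carrier N}))"

definition tensor_module ::
  "('a, 'm) ring_scheme \<Rightarrow> ('a, 'b) module \<Rightarrow> ('a, 'c) module \<Rightarrow> ('a, ('b \<times> 'c \<Rightarrow> 'a) set) module" where
  "tensor_module R M N =
     quotient_module (free_module R (carrier M \<times> carrier N)) (tensor_rels R M N)"

text \<open>
  The map \<open>f \<otimes> N\<close> from \<open>M \<otimes> N\<close> to \<open>M' \<otimes> N\<close> induced by a linear map \<open>f\<close> from \<open>M\<close> to \<open>M'\<close>.
  The image of a coset under the composition with the quotient map is a singleton.
\<close>

definition tensor_map ::
  "('a, 'm) ring_scheme \<Rightarrow> ('a, 'b) module \<Rightarrow> ('a, 'd) module \<Rightarrow> ('a, 'c) module \<Rightarrow> ('b \<Rightarrow> 'd) \<Rightarrow>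
   ('b \<times> 'c \<Rightarrow> 'a) set \<Rightarrow> ('d \<times> 'c \<Rightarrow> 'a) set" where
  "tensor_map R M M' N f C =
    (let P' = free_module R (carrier M' \<times> carrier N) in
     the_elem ((\<lambda>c. tensor_rels R M' N +>\<^bsub>P'\<^esub>
                      linear_ext R P' (\<lambda>(x, y). basis_elem R (f x, y)) c) ` C))"

section \<open>The standard free resolution\<close>

text \<open>
  For a module \<open>M\<close> let \<open>F 0\<close> be free on the set \<open>M\<close>, and let \<open>F (n + 1)\<close> be free on the set
  of all formal expressions for elements of the kernel of the map out of \<open>F n\<close>. A formal
  expression is a list of pairs (coefficient, basis element); distinct expressions of the same
  element are distinct basis elements of \<open>F (n + 1)\<close>, which does no harm. The point of using
  expressions rather than elements of the kernel is that all the \<open>F n\<close> then have the same type.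
\<close>

datatype ('a, 'b) res_gen =
    Elt (elt: 'b)
  | Expr (terms: "('a \<times> ('a, 'b) res_gen) list")

definition formal_sum :: "('a, 'm) ring_scheme \<Rightarrow> ('a \<times> 'g) list \<Rightarrow> 'g \<Rightarrow> 'a" where
  "formal_sum R xs = foldr (\<lambda>(r, g) f h. (if h = g then r else \<zero>\<^bsub>R\<^esub>) \<oplus>\<^bsub>R\<^esub> f h) xs (\<lambda>_. \<zero>\<^bsub>R\<^esub>)"

fun res_gens :: "('a, 'm) ring_scheme \<Rightarrow> ('a, 'b) module \<Rightarrow> nat \<Rightarrow> ('a, 'b) res_gen set" where
  "res_gens R M 0 = Elt ` carrier M"
| "res_gens R M (Suc 0) =
     {Expr xs |xs. set xs \<subseteq> carrier R \<times> res_gens R M 0 \<and>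
        linear_ext R M elt (formal_sum R xs) = \<zero>\<^bsub>M\<^esub>}"
| "res_gens R M (Suc (Suc n)) =
     {Expr xs |xs. set xs \<subseteq> carrier R \<times> res_gens R M (Suc n) \<and>
        linear_ext R (free_module R (res_gens R M n)) (formal_sum R \<circ> terms) (formal_sum R xs)
          = \<zero>\<^bsub>free_module R (res_gens R M n)\<^esub>}"

definition res_module ::
  "('a, 'm) ring_scheme \<Rightarrow> ('a, 'b) module \<Rightarrow> nat \<Rightarrow> ('a, ('a, 'b) res_gen \<Rightarrow> 'a) module" where
  "res_module R M n = free_module R (res_gens R M n)"

definition res_aug ::
  "('a, 'm) ring_scheme \<Rightarrow> ('a, 'b) module \<Rightarrow> (('a, 'b) res_gen \<Rightarrow> 'a) \<Rightarrow> 'b" where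
  "res_aug R M = linear_ext R M elt"

text \<open>The differential from \<open>F (n + 1)\<close> to \<open>F n\<close>.\<close>

definition res_diff ::
  "('a, 'm) ring_scheme \<Rightarrow> ('a, 'b) module \<Rightarrow> nat \<Rightarrow>
   (('a, 'b) res_gen \<Rightarrow> 'a) \<Rightarrow> (('a, 'b) res_gen \<Rightarrow> 'a)" where
  "res_diff R M n = linear_ext R (res_module R M n) (formal_sum R \<circ> terms)"

subsection \<open>Exactness\<close>

lemma free_module_is_module:
  fixes R :: "('a, 'm) ring_scheme" and B :: "'b set"
  assumes "cring R" shows "module R (free_module R B)"
proof -
  interpret cring R by fact
  have fin: "finite {b. f b \<oplus>\<^bsub>R\<^esub> g b \<noteq> \<zero>\<^bsub>R\<^esub>}"
    if "finite {b. f b \<noteq> \<zero>\<^bsub>R\<^esub>}" "finite {b. g b \<noteq> \<zero>\<^bsub>R\<^esub>}" for f g :: "'b \<Rightarrow> 'a"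
    by (rule finite_subset[of _ "{b. f b \<noteq> \<zero>\<^bsub>R\<^esub>} \<union> {b. g b \<noteq> \<zero>\<^bsub>R\<^esub>}"]) (use that in auto)
  have fin2: "finite {b. r \<otimes>\<^bsub>R\<^esub> f b \<noteq> \<zero>\<^bsub>R\<^esub>}"
    if "finite {b. f b \<noteq> \<zero>\<^bsub>R\<^esub>}" "r \<in> carrier R" for f :: "'b \<Rightarrow> 'a" and r
    by (rule finite_subset[of _ "{b. f b \<noteq> \<zero>\<^bsub>R\<^esub>}"]) (use that in auto)
  show ?thesis
  proof (rule moduleI)
    show "abelian_group (free_module R B)"
    proof (rule abelian_groupI)
      fix x assume x: "x \<in> carrier (free_module R B)"
      show "\<exists>y\<in>carrier (free_module R B). y \<oplus>\<^bsub>free_module R B\<^esub> x = \<zero>\<^bsub>free_module R B\<^esub>"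
        apply (rule bexI[of _ "\<lambda>b. \<ominus>\<^bsub>R\<^esub> x b"])
        subgoal using x by (auto simp: free_module_def l_neg)
        subgoal using x by (auto simp: free_module_def elim!: rev_finite_subset)
        done
    qed (auto simp: free_module_def fin a_ac)
  qed (auto simp: free_module_def fin2 l_distr r_distr m_assoc assms)
qed

lemma linear_ext_superset:
  assumes "module R P" "f \<in> carrier (free_module R B)" "v \<in> B \<rightarrow> carrier P"
    "finite A" "{b. f b \<noteq> \<zero>\<^bsub>R\<^esub>} \<subseteq> A" "A \<subseteq> B"
  shows "linear_ext R P v f = (\<Oplus>\<^bsub>P\<^esub>b\<in>A. f b \<odot>\<^bsub>P\<^esub> v b)"
proof -
  interpret module R P by fact
  show ?thesis unfolding linear_ext_def
    by (rule M.add.finprod_mono_neutral_cong_left)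
       (use assms in \<open>auto simp: free_module_def Pi_def\<close>)
qed

lemma linear_ext_closed:
  assumes "module R P" "f \<in> carrier (free_module R B)" "v \<in> B \<rightarrow> carrier P"
  shows "linear_ext R P v f \<in> carrier P"
proof -
  interpret module R P by fact
  show ?thesis unfolding linear_ext_def
    by (rule M.finsum_closed) (use assms in \<open>auto simp: free_module_def Pi_def\<close>)
qed

lemma linear_ext_add:
  assumes "module R P" "f \<in> carrier (free_module R B)" "g \<in> carrier (free_module R B)"
    "v \<in> B \<rightarrow> carrier P"
  shows "linear_ext R P v (f \<oplus>\<^bsub>free_module R B\<^esub> g) = linear_ext R P v f \<oplus>\<^bsub>P\<^esub> linear_ext R P v g"
proof -
  interpret module R P by fact
  interpret F: module R "free_module R B" by (rule free_module_is_module) (rule R.is_cring)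
  let ?A = "{b. f b \<noteq> \<zero>\<^bsub>R\<^esub>} \<union> {b. g b \<noteq> \<zero>\<^bsub>R\<^esub>}"
  have A: "finite ?A" "?A \<subseteq> B" using assms by (auto simp: free_module_def)
  have fg: "f b \<in> carrier R" "g b \<in> carrier R" for b using assms by (auto simp: free_module_def)
  have *: "linear_ext R P v (f \<oplus>\<^bsub>free_module R B\<^esub> g) = (\<Oplus>\<^bsub>P\<^esub>b\<in>?A. (f \<oplus>\<^bsub>free_module R B\<^esub> g) b \<odot>\<^bsub>P\<^esub> v b)"
    by (rule linear_ext_superset[OF assms(1) F.M.add.m_closed[OF assms(2,3)] assms(4) A(1) _ A(2)])
       (auto simp: free_module_def)
  also have "\<dots> = (\<Oplus>\<^bsub>P\<^esub>b\<in>?A. f b \<odot>\<^bsub>P\<^esub> v b \<oplus>\<^bsub>P\<^esub> g b \<odot>\<^bsub>P\<^esub> v b)"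
    by (rule M.finsum_cong') (use assms(4) fg A in \<open>auto simp: free_module_def smult_l_distr Pi_def\<close>)
  also have "\<dots> = (\<Oplus>\<^bsub>P\<^esub>b\<in>?A. f b \<odot>\<^bsub>P\<^esub> v b) \<oplus>\<^bsub>P\<^esub> (\<Oplus>\<^bsub>P\<^esub>b\<in>?A. g b \<odot>\<^bsub>P\<^esub> v b)"
    by (rule M.finsum_addf) (use assms(4) fg A in \<open>auto simp: Pi_def\<close>)
  also have "(\<Oplus>\<^bsub>P\<^esub>b\<in>?A. f b \<odot>\<^bsub>P\<^esub> v b) = linear_ext R P v f"
    by (rule linear_ext_superset[symmetric]) (use assms A in auto)
  also have "(\<Oplus>\<^bsub>P\<^esub>b\<in>?A. g b \<odot>\<^bsub>P\<^esub> v b) = linear_ext R P v g"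
    by (rule linear_ext_superset[symmetric]) (use assms A in auto)
  finally show ?thesis .
qed

lemma linear_ext_smult:
  assumes "module R P" "f \<in> carrier (free_module R B)" "r \<in> carrier R" "v \<in> B \<rightarrow> carrier P"
  shows "linear_ext R P v (r \<odot>\<^bsub>free_module R B\<^esub> f) = r \<odot>\<^bsub>P\<^esub> linear_ext R P v f"
proof -
  interpret module R P by fact
  interpret F: module R "free_module R B" by (rule free_module_is_module) (rule R.is_cring)
  let ?A = "{b. f b \<noteq> \<zero>\<^bsub>R\<^esub>}"
  have A: "finite ?A" "?A \<subseteq> B" using assms by (auto simp: free_module_def)
  have fg: "f b \<in> carrier R" for b using assms by (auto simp: free_module_def)
  have "linear_ext R P v (r \<odot>\<^bsub>free_module R B\<^esub> f) = (\<Oplus>\<^bsub>P\<^esub>b\<in>?A. (r \<odot>\<^bsub>free_module R B\<^esub> f) b \<odot>\<^bsub>P\<^esub> v b)"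
    by (rule linear_ext_superset[OF assms(1) F.smult_closed[OF assms(3,2)] assms(4) A(1) _ A(2)])
       (use assms in \<open>auto simp: free_module_def\<close>)
  also have "\<dots> = (\<Oplus>\<^bsub>P\<^esub>b\<in>?A. r \<odot>\<^bsub>P\<^esub> (f b \<odot>\<^bsub>P\<^esub> v b))"
    by (rule M.finsum_cong') (use assms fg A in \<open>auto simp: free_module_def smult_assoc1 Pi_def\<close>)
  also have "\<dots> = r \<odot>\<^bsub>P\<^esub> (\<Oplus>\<^bsub>P\<^esub>b\<in>?A. f b \<odot>\<^bsub>P\<^esub> v b)"
    by (rule finsum_smult_ldistr[symmetric]) (use assms fg A in \<open>auto simp: Pi_def\<close>)
  finally show ?thesis by (simp add: linear_ext_def)
qed

lemma linear_ext_zero: "module R P \<Longrightarrow> linear_ext R P v \<zero>\<^bsub>free_module R B\<^esub> = \<zero>\<^bsub>P\<^esub>"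
proof -
  assume "module R P" then interpret module R P .
  show ?thesis by (simp add: linear_ext_def free_module_def)
qed

lemma basis_elem_closed: "cring R \<Longrightarrow> b \<in> B \<Longrightarrow> basis_elem R b \<in> carrier (free_module R B)"
proof -
  assume "cring R" "b \<in> B" then interpret cring R by simp
  show ?thesis using \<open>b \<in> B\<close>
    by (auto simp: free_module_def basis_elem_def intro: finite_subset[of _ "{b}"])
qed

lemma linear_ext_basis:
  assumes "module R P" "b \<in> B" "v \<in> B \<rightarrow> carrier P"
  shows "linear_ext R P v (basis_elem R b) = v b"
proof -
  interpret module R P by fact
  have "linear_ext R P v (basis_elem R b) = (\<Oplus>\<^bsub>P\<^esub>c\<in>{b}. basis_elem R b c \<odot>\<^bsub>P\<^esub> v c)"
    by (rule linear_ext_superset[OF assms(1) basis_elem_closed[of R b B] assms(3)])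
       (use assms R.is_cring in \<open>auto simp: basis_elem_def\<close>)
  also have "\<dots> = v b" using assms by (auto simp: basis_elem_def Pi_def M.finsum_insert)
  finally show ?thesis .
qed

lemma formal_sum_Cons:
  "formal_sum R ((r, g) # xs) = (\<lambda>h. (if h = g then r else \<zero>\<^bsub>R\<^esub>) \<oplus>\<^bsub>R\<^esub> formal_sum R xs h)"
  by (simp add: formal_sum_def)

lemma formal_sum_closed:
  assumes "cring R" "set xs \<subseteq> carrier R \<times> B"
  shows "formal_sum R xs \<in> carrier (free_module R B)"
  using assms(2)
proof (induction xs)
  case Nil
  interpret cring R by fact
  show ?case by (simp add: formal_sum_def free_module_def)
next
  case (Cons x xs)
  interpret cring R by fact
  obtain r g where x: "x = (r, g)" by force
  interpret F: module R "free_module R B" by (rule free_module_is_module) (rule is_cring)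
  have "(\<lambda>h. if h = g then r else \<zero>\<^bsub>R\<^esub>) \<in> carrier (free_module R B)"
    using Cons.prems x by (auto simp: free_module_def intro: finite_subset[of _ "{g}"])
  from F.M.add.m_closed[OF this Cons.IH] Cons.prems show ?case
    by (simp add: x formal_sum_Cons free_module_def)
qed

lemma formal_sum_surj:
  assumes "cring R" "f \<in> carrier (free_module R B)"
  shows "\<exists>xs. set xs \<subseteq> carrier R \<times> B \<and> formal_sum R xs = f"
proof -
  interpret cring R by fact
  have fc: "f b \<in> carrier R" for b using assms by (auto simp: free_module_def)
  obtain ys where ys: "set ys = {b. f b \<noteq> \<zero>\<^bsub>R\<^esub>}" "distinct ys"
    using finite_distinct_list[of "{b. f b \<noteq> \<zero>\<^bsub>R\<^esub>}"] assms(2) by (auto simp: free_module_def)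
  have "formal_sum R (map (\<lambda>b. (f b, b)) zs) = (\<lambda>h. if h \<in> set zs then f h else \<zero>\<^bsub>R\<^esub>)"
    if "distinct zs" for zs using that
    by (induction zs) (auto simp: formal_sum_Cons formal_sum_def[of R "[]"] fc)
  from this[OF ys(2)] have "formal_sum R (map (\<lambda>b. (f b, b)) ys) = f" by (auto simp: ys)
  moreover have "set (map (\<lambda>b. (f b, b)) ys) \<subseteq> carrier R \<times> B"
    using assms ys by (auto simp: free_module_def)
  ultimately show ?thesis by blast
qed

lemma free_step:
  fixes R :: "('a, 'm) ring_scheme" and P :: "('a, 'c, 'n) module_scheme"
    and B :: "('a, 'b) res_gen set"
  assumes P: "module R P" and v: "v \<in> B \<rightarrow> carrier P"
  defines "F \<equiv> free_module R B"
    and "B' \<equiv> {Expr xs |xs. set xs \<subseteq> carrier R \<times> B \<and> linear_ext R P v (formal_sum R xs) = \<zero>\<^bsub>P\<^esub>}"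
  shows "linear_ext R F (formal_sum R \<circ> terms) ` carrier (free_module R B') =
         a_kernel F P (linear_ext R P v)"
proof -
  interpret P: module R P by fact
  have F: "module R F" unfolding F_def by (rule free_module_is_module) (rule P.R.is_cring)
  interpret F: module R F by fact
  let ?w = "formal_sum R \<circ> terms :: ('a, 'b) res_gen \<Rightarrow> _"
  have w: "?w \<in> B' \<rightarrow> carrier F"
    using formal_sum_closed[OF P.R.is_cring] by (auto simp: B'_def F_def)
  have w0: "linear_ext R P v (?w b) = \<zero>\<^bsub>P\<^esub>" if "b \<in> B'" for b using that by (auto simp: B'_def)
  have ker: "linear_ext R P v (\<Oplus>\<^bsub>F\<^esub>b\<in>A. c b \<odot>\<^bsub>F\<^esub> ?w b) = \<zero>\<^bsub>P\<^esub>"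
    if "finite A" "A \<subseteq> B'" "\<And>b. c b \<in> carrier R" for A c using that
  proof (induction A)
    case empty then show ?case using linear_ext_zero[OF P, of v B, folded F_def] by simp
  next
    case (insert b A)
    have b: "?w b \<in> carrier F" "c b \<in> carrier R" using w insert by auto
    have sb: "c b \<odot>\<^bsub>F\<^esub> ?w b \<in> carrier F" using b by (rule F.smult_closed[rotated])
    have Pi: "(\<lambda>b. c b \<odot>\<^bsub>F\<^esub> ?w b) \<in> A \<rightarrow> carrier F" using insert w by (auto simp: Pi_def)
    have "(\<Oplus>\<^bsub>F\<^esub>b\<in>insert b A. c b \<odot>\<^bsub>F\<^esub> ?w b) = c b \<odot>\<^bsub>F\<^esub> ?w b \<oplus>\<^bsub>F\<^esub> (\<Oplus>\<^bsub>F\<^esub>b\<in>A. c b \<odot>\<^bsub>F\<^esub> ?w b)"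
      using insert.hyps Pi sb by (rule F.M.finsum_insert)
    moreover have "linear_ext R P v (c b \<odot>\<^bsub>F\<^esub> ?w b \<oplus>\<^bsub>F\<^esub> (\<Oplus>\<^bsub>F\<^esub>b\<in>A. c b \<odot>\<^bsub>F\<^esub> ?w b)) =
      linear_ext R P v (c b \<odot>\<^bsub>F\<^esub> ?w b) \<oplus>\<^bsub>P\<^esub> linear_ext R P v (\<Oplus>\<^bsub>F\<^esub>b\<in>A. c b \<odot>\<^bsub>F\<^esub> ?w b)"
      using linear_ext_add[OF P, of _ B _ v] sb F.M.finsum_closed[OF Pi] v unfolding F_def by blast
    moreover have "linear_ext R P v (c b \<odot>\<^bsub>F\<^esub> ?w b) = c b \<odot>\<^bsub>P\<^esub> linear_ext R P v (?w b)"
      using linear_ext_smult[OF P, of "?w b" B "c b" v] b v unfolding F_def by blast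
    ultimately show ?case using insert w0[of b] b by simp
  qed
  show ?thesis
  proof (intro equalityI subsetI)
    fix y assume "y \<in> linear_ext R F ?w ` carrier (free_module R B')"
    then obtain c where c: "c \<in> carrier (free_module R B')" "y = linear_ext R F ?w c" by blast
    have "y \<in> carrier F" unfolding c by (rule linear_ext_closed[OF F c(1) w])
    moreover have "linear_ext R P v y = \<zero>\<^bsub>P\<^esub>" unfolding c linear_ext_def[of R F]
      by (rule ker) (use c in \<open>auto simp: free_module_def\<close>)
    ultimately show "y \<in> a_kernel F P (linear_ext R P v)" by (simp add: a_kernel_def kernel_def)
  next
    fix y assume "y \<in> a_kernel F P (linear_ext R P v)"
    hence y: "y \<in> carrier F" "linear_ext R P v y = \<zero>\<^bsub>P\<^esub>" by (auto simp: a_kernel_def kernel_def)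
    then obtain xs where xs: "set xs \<subseteq> carrier R \<times> B" "formal_sum R xs = y"
      using formal_sum_surj[OF P.R.is_cring] unfolding F_def by blast
    have B': "Expr xs \<in> B'" using xs y by (auto simp: B'_def)
    have "linear_ext R F ?w (basis_elem R (Expr xs)) = y"
      using linear_ext_basis[OF F B' w] xs by simp
    thus "y \<in> linear_ext R F ?w ` carrier (free_module R B')"
      using basis_elem_closed[OF P.R.is_cring B'] by blast
  qed
qed

text \<open>The standard free resolution is exact.\<close>

theorem res_exact:
  assumes M: "module R M"
  shows "res_aug R M ` carrier (res_module R M 0) = carrier M"
    and "res_diff R M 0 ` carrier (res_module R M 1) = a_kernel (res_module R M 0) M (res_aug R M)"
    and "res_diff R M (Suc n) ` carrier (res_module R M (Suc (Suc n))) =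
         a_kernel (res_module R M (Suc n)) (res_module R M n) (res_diff R M n)"
proof -
  interpret M: module R M by fact
  have e: "elt \<in> res_gens R M 0 \<rightarrow> carrier M" by auto
  show "res_aug R M ` carrier (res_module R M 0) = carrier M"
    unfolding res_aug_def res_module_def
  proof (intro equalityI subsetI)
    fix x assume "x \<in> carrier M"
    hence x: "Elt x \<in> res_gens R M 0" by simp
    show "x \<in> linear_ext R M elt ` carrier (free_module R (res_gens R M 0))"
      using linear_ext_basis[OF M x e] basis_elem_closed[OF M.R.is_cring x]
      by (metis image_eqI res_gen.sel(1))
  qed (use linear_ext_closed[OF M _ e] in blast)
  show "res_diff R M 0 ` carrier (res_module R M 1) = a_kernel (res_module R M 0) M (res_aug R M)"
    unfolding res_aug_def res_module_def res_diff_def One_nat_def res_gens.simps(2)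
    by (rule free_step[OF M e])
  have w: "formal_sum R \<circ> terms \<in> res_gens R M (Suc n) \<rightarrow> carrier (free_module R (res_gens R M n))"
    by (cases n) (auto intro!: formal_sum_closed[OF M.R.is_cring] simp del: res_gens.simps(1))
  show "res_diff R M (Suc n) ` carrier (res_module R M (Suc (Suc n))) =
         a_kernel (res_module R M (Suc n)) (res_module R M n) (res_diff R M n)"
    unfolding res_module_def res_diff_def res_gens.simps(3)
    by (rule free_step[OF free_module_is_module[OF M.R.is_cring] w])
qed

section \<open>Tor\<close>

text \<open>
  The homology in degree \<open>n\<close> of a chain complex \<open>C 0, C 1, \<dots>\<close> of modules with differentials
  \<open>d i\<close> from \<open>C (i + 1)\<close> to \<open>C i\<close>; in degree \<open>0\<close> every element is a cycle.
\<close>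

definition homology_module ::
  "(nat \<Rightarrow> ('a, 'b) module) \<Rightarrow> (nat \<Rightarrow> 'b \<Rightarrow> 'b) \<Rightarrow> nat \<Rightarrow> ('a, 'b set) module" where
  "homology_module C d n =
     quotient_module
       ((C n)\<lparr>carrier := (case n of 0 \<Rightarrow> carrier (C 0) | Suc i \<Rightarrow> a_kernel (C n) (C i) (d i))\<rparr>)
       (d n ` carrier (C (Suc n)))"

definition Tor ::
  "('a, 'm) ring_scheme \<Rightarrow> nat \<Rightarrow> ('a, 'b) module \<Rightarrow> ('a, 'c) module \<Rightarrow>
   ('a, ((('a, 'b) res_gen \<Rightarrow> 'a) \<times> 'c \<Rightarrow> 'a) set set) module" where
  "Tor R n M N =
     homology_module
       (\<lambda>i. tensor_module R (res_module R M i) N)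
       (\<lambda>i. tensor_map R (res_module R M (Suc i)) (res_module R M i) N (res_diff R M i))
       n"

end

theory Submission
  imports Defs
begin

text \<open>
  Since \<open>F \<otimes> N = N\<^bsup>(B)\<^esup>\<close> for \<open>F\<close> free on \<open>B\<close>, vanishing of Tor means that applying the matrices of
  a free resolution to families of elements of \<open>N\<close> is exact; by a homotopy argument this passes to
  resolutions of direct summands. If \<open>X \<noteq> 0\<close> is a finitely generated \<open>S\<close>-module, then \<open>0 \<times> \<nn>\<close> kills \<open>X\<close>, and therefore
  \<open>\<nn>\<close> is a direct summand of the first syzygy of \<open>X\<close> over \<open>R\<close>: it embeds by multiples of a lift of a
  minimal generator \<open>x\<close>, and a lift to \<open>T\<close> of a functional \<open>X \<rightarrow> k\<close> with value \<open>1\<close> at \<open>x\<close> is a retraction.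
  So \<open>Tor\<^sub>i\<^sub>+\<^sub>1(X, N) = 0\<close> implies \<open>Tor\<^sub>i(\<nn>, N) = 0\<close> for \<open>i \<ge> 1\<close>, and alternating between \<open>S\<close> and \<open>T\<close> reduces everything to
  degrees \<open>0\<close> and \<open>1\<close>. There, nonzero elements are exhibited by explicit bilinear pairings.
  If \<open>T\<close> is not a discrete valuation domain, then \<open>\<nn>\<close> has a nontrivial relation over \<open>T\<close>, so that
  the first syzygy of \<open>\<nn>\<close> over \<open>R\<close> also has a minimal generator killed by \<open>\<mm> \<times> 0\<close>.
\<close>

section \<open>Linear maps and free modules\<close>

definition additive :: "('b, 'm) ring_scheme \<Rightarrow> ('c, 'n) ring_scheme \<Rightarrow> ('b \<Rightarrow> 'c) \<Rightarrow> bool" where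
  "additive M N f \<longleftrightarrow> f \<in> carrier M \<rightarrow> carrier N \<and>
     (\<forall>x\<in>carrier M. \<forall>y\<in>carrier M. f (x \<oplus>\<^bsub>M\<^esub> y) = f x \<oplus>\<^bsub>N\<^esub> f y)"

definition linear ::
  "('a, 'm) ring_scheme \<Rightarrow> ('a, 'b, 'n) module_scheme \<Rightarrow> ('a, 'c, 'l) module_scheme \<Rightarrow> ('b \<Rightarrow> 'c) \<Rightarrow> bool" where
  "linear R M N f \<longleftrightarrow> additive M N f \<and>
     (\<forall>r\<in>carrier R. \<forall>x\<in>carrier M. f (r \<odot>\<^bsub>M\<^esub> x) = r \<odot>\<^bsub>N\<^esub> f x)"

lemma additiveI:
  assumes "\<And>x. x \<in> carrier M \<Longrightarrow> f x \<in> carrier N"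
    and "\<And>x y. x \<in> carrier M \<Longrightarrow> y \<in> carrier M \<Longrightarrow> f (x \<oplus>\<^bsub>M\<^esub> y) = f x \<oplus>\<^bsub>N\<^esub> f y"
  shows "additive M N f"
  using assms by (auto simp: additive_def)

lemma linearI:
  assumes "\<And>x. x \<in> carrier M \<Longrightarrow> f x \<in> carrier N"
    and "\<And>x y. x \<in> carrier M \<Longrightarrow> y \<in> carrier M \<Longrightarrow> f (x \<oplus>\<^bsub>M\<^esub> y) = f x \<oplus>\<^bsub>N\<^esub> f y"
    and "\<And>r x. r \<in> carrier R \<Longrightarrow> x \<in> carrier M \<Longrightarrow> f (r \<odot>\<^bsub>M\<^esub> x) = r \<odot>\<^bsub>N\<^esub> f x"
  shows "linear R M N f"
  using assms by (auto simp: additive_def linear_def)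

lemma additive_closed: "additive M N f \<Longrightarrow> x \<in> carrier M \<Longrightarrow> f x \<in> carrier N"
  by (auto simp: additive_def)

lemma additive_add:
  "additive M N f \<Longrightarrow> x \<in> carrier M \<Longrightarrow> y \<in> carrier M \<Longrightarrow> f (x \<oplus>\<^bsub>M\<^esub> y) = f x \<oplus>\<^bsub>N\<^esub> f y"
  by (auto simp: additive_def)

lemma linear_additive: "linear R M N f \<Longrightarrow> additive M N f"
  by (simp add: linear_def)

lemmas linear_closed = additive_closed[OF linear_additive]
lemmas linear_add = additive_add[OF linear_additive]

lemma linear_smult:
  "linear R M N f \<Longrightarrow> r \<in> carrier R \<Longrightarrow> x \<in> carrier M \<Longrightarrow> f (r \<odot>\<^bsub>M\<^esub> x) = r \<odot>\<^bsub>N\<^esub> f x"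
  by (auto simp: linear_def)

lemma additive_zero:
  assumes "abelian_group M" "abelian_group N" "additive M N f"
  shows "f \<zero>\<^bsub>M\<^esub> = \<zero>\<^bsub>N\<^esub>"
proof -
  interpret M: abelian_group M by fact
  interpret N: abelian_group N by fact
  have f: "f \<zero>\<^bsub>M\<^esub> \<in> carrier N" using assms(3) by (auto simp: additive_def)
  have "f \<zero>\<^bsub>M\<^esub> \<oplus>\<^bsub>N\<^esub> f \<zero>\<^bsub>M\<^esub> = f \<zero>\<^bsub>M\<^esub>"
    using additive_add[OF assms(3), of "\<zero>\<^bsub>M\<^esub>" "\<zero>\<^bsub>M\<^esub>"] by simp
  thus ?thesis using f by (metis N.add.r_cancel_one')
qed

lemma additive_minus:
  assumes "abelian_group M" "abelian_group N" "additive M N f" "x \<in> carrier M"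
  shows "f (\<ominus>\<^bsub>M\<^esub> x) = \<ominus>\<^bsub>N\<^esub> f x"
proof -
  interpret M: abelian_group M by fact
  interpret N: abelian_group N by fact
  have "f (\<ominus>\<^bsub>M\<^esub> x) \<oplus>\<^bsub>N\<^esub> f x = \<zero>\<^bsub>N\<^esub>"
    using additive_add[OF assms(3), of "\<ominus>\<^bsub>M\<^esub> x" x] additive_zero[OF assms(1-3)] assms(4)
    by (simp add: M.l_neg)
  thus ?thesis using N.minus_equality assms additive_closed[OF assms(3)]
    by (metis M.a_inv_closed)
qed

lemma additive_finsum:
  assumes "abelian_group M" "abelian_group N" "additive M N f" "g \<in> A \<rightarrow> carrier M"
  shows "f (\<Oplus>\<^bsub>M\<^esub>i\<in>A. g i) = (\<Oplus>\<^bsub>N\<^esub>i\<in>A. f (g i))"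
proof -
  interpret M: abelian_group M by fact
  interpret N: abelian_group N by fact
  note f0 = additive_zero[OF assms(1-3)]
  show ?thesis
  proof (cases "finite A")
    case True
    then show ?thesis using assms(4)
    proof (induction A)
      case empty then show ?case by (simp add: f0)
    next
      case (insert a A)
      have g: "g \<in> A \<rightarrow> carrier M" "g a \<in> carrier M" using insert by auto
      have fg: "(\<lambda>i. f (g i)) \<in> A \<rightarrow> carrier N" "f (g a) \<in> carrier N"
        using g additive_closed[OF assms(3)] by auto
      have "f (finsum M g (insert a A)) = f (g a \<oplus>\<^bsub>M\<^esub> finsum M g A)"
        using insert g by (simp add: M.finsum_insert)
      also have "\<dots> = f (g a) \<oplus>\<^bsub>N\<^esub> f (finsum M g A)"
        by (rule additive_add[OF assms(3)]) (use g M.finsum_closed in auto)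
      finally show ?case using insert fg g by (simp add: N.finsum_insert)
    qed
  qed (simp add: f0 M.add.finprod_infinite[unfolded finsum_def[symmetric]]
        N.add.finprod_infinite[unfolded finsum_def[symmetric]])
qed

lemma module_abelian_group: "module R M \<Longrightarrow> abelian_group M"
  by (simp add: module_def)

lemma module_cring: "module R M \<Longrightarrow> cring R"
  by (simp add: module_def)

lemma linear_zero: "module R M \<Longrightarrow> module R N \<Longrightarrow> linear R M N f \<Longrightarrow> f \<zero>\<^bsub>M\<^esub> = \<zero>\<^bsub>N\<^esub>"
  using additive_zero module_abelian_group linear_additive by metis

lemma linear_finsum:
  "module R M \<Longrightarrow> module R N \<Longrightarrow> linear R M N f \<Longrightarrow> g \<in> A \<rightarrow> carrier M \<Longrightarrow>
    f (\<Oplus>\<^bsub>M\<^esub>i\<in>A. g i) = (\<Oplus>\<^bsub>N\<^esub>i\<in>A. f (g i))"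
  by (rule additive_finsum) (auto simp: module_abelian_group linear_additive)

lemma linear_compose:
  "linear R M N f \<Longrightarrow> linear R N L g \<Longrightarrow> linear R M L (\<lambda>x. g (f x))"
  by (auto simp: linear_def additive_def Pi_def)

lemma linear_id: "linear R M M (\<lambda>x. x)"
  by (auto simp: linear_def additive_def)

lemma linear_diff:
  assumes "module R M" "module R N" "linear R M N f" "linear R M N g"
  shows "linear R M N (\<lambda>x. f x \<ominus>\<^bsub>N\<^esub> g x)"
proof -
  interpret M: module R M by fact
  interpret N: module R N by fact
  note [simp] = linear_closed[OF assms(3)] linear_closed[OF assms(4)]
    linear_add[OF assms(3)] linear_add[OF assms(4)]
    linear_smult[OF assms(3)] linear_smult[OF assms(4)]
  show ?thesis
    by (rule linearI)
      (auto simp: a_minus_def N.smult_r_distr N.smult_r_minus N.M.minus_add N.M.a_ac)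
qed

lemma linear_into_submodule:
  "linear R M N f \<Longrightarrow> f ` carrier M \<subseteq> H \<Longrightarrow> linear R M (N\<lparr>carrier := H\<rparr>) f"
  by (auto simp: linear_def additive_def)

lemma free_module_smult: "(r \<odot>\<^bsub>free_module R B\<^esub> f) b = r \<otimes>\<^bsub>R\<^esub> f b"
  by (simp add: free_module_def)

lemma free_module_add: "(f \<oplus>\<^bsub>free_module R B\<^esub> g) b = f b \<oplus>\<^bsub>R\<^esub> g b"
  by (simp add: free_module_def)

lemma free_module_zero: "\<zero>\<^bsub>free_module R B\<^esub> = (\<lambda>_. \<zero>\<^bsub>R\<^esub>)"
  by (simp add: free_module_def)

lemma free_module_closed: "f \<in> carrier (free_module R B) \<Longrightarrow> f b \<in> carrier R"
  by (simp add: free_module_def)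

lemma free_module_finite: "f \<in> carrier (free_module R B) \<Longrightarrow> finite {b. f b \<noteq> \<zero>\<^bsub>R\<^esub>}"
  by (simp add: free_module_def)

lemma free_module_support: "f \<in> carrier (free_module R B) \<Longrightarrow> {b. f b \<noteq> \<zero>\<^bsub>R\<^esub>} \<subseteq> B"
  by (auto simp: free_module_def)

lemma free_module_outside: "f \<in> carrier (free_module R B) \<Longrightarrow> b \<notin> B \<Longrightarrow> f b = \<zero>\<^bsub>R\<^esub>"
  by (auto simp: free_module_def)

lemma free_module_coord_additive: "cring R \<Longrightarrow> additive (free_module R B) R (\<lambda>f. f b)"
  by (rule additiveI) (auto simp: free_module_def)

lemma free_module_expand:
  assumes "cring R" "f \<in> carrier (free_module R B)" "finite A" "{b. f b \<noteq> \<zero>\<^bsub>R\<^esub>} \<subseteq> A" "A \<subseteq> B"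
  shows "f = (\<Oplus>\<^bsub>free_module R B\<^esub>b\<in>A. f b \<odot>\<^bsub>free_module R B\<^esub> basis_elem R b)"
proof
  fix c
  interpret cring R by fact
  let ?F = "free_module R B"
  have F: "module R ?F" by (rule free_module_is_module) fact
  interpret F: module R ?F by fact
  have fb: "f b \<in> carrier R" for b using assms(2) by (rule free_module_closed)
  have Pi: "(\<lambda>b. f b \<odot>\<^bsub>?F\<^esub> basis_elem R b) \<in> A \<rightarrow> carrier ?F"
  proof
    fix b assume "b \<in> A"
    hence "basis_elem R b \<in> carrier ?F" using assms(5) by (intro basis_elem_closed[OF assms(1)]) auto
    thus "f b \<odot>\<^bsub>?F\<^esub> basis_elem R b \<in> carrier ?F" using fb by (rule F.smult_closed[rotated])
  qed
  have "(\<Oplus>\<^bsub>?F\<^esub>b\<in>A. f b \<odot>\<^bsub>?F\<^esub> basis_elem R b) c = (\<Oplus>\<^bsub>R\<^esub>b\<in>A. (f b \<odot>\<^bsub>?F\<^esub> basis_elem R b) c)"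
    using additive_finsum[OF F.M.abelian_group_axioms abelian_group_axioms
        free_module_coord_additive[OF assms(1)] Pi] .
  also have "\<dots> = (\<Oplus>\<^bsub>R\<^esub>b\<in>A. if c = b then f b else \<zero>\<^bsub>R\<^esub>)"
    by (rule finsum_cong') (auto simp: free_module_smult basis_elem_def fb)
  also have "\<dots> = f c"
  proof (cases "c \<in> A")
    case True
    then show ?thesis using add.finprod_singleton[of c A f] assms(3) fb by auto
  next
    case False
    hence "(\<Oplus>\<^bsub>R\<^esub>b\<in>A. if c = b then f b else \<zero>\<^bsub>R\<^esub>) = (\<Oplus>\<^bsub>R\<^esub>b\<in>A. \<zero>\<^bsub>R\<^esub>)"
      by (intro finsum_cong') auto
    moreover have "f c = \<zero>\<^bsub>R\<^esub>" using False assms(4) by auto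
    ultimately show ?thesis by simp
  qed
  finally show "f c = (\<Oplus>\<^bsub>?F\<^esub>b\<in>A. f b \<odot>\<^bsub>?F\<^esub> basis_elem R b) c" by simp
qed

lemma linear_expand:
  assumes "module R N" "linear R (free_module R B) N \<phi>"
    "f \<in> carrier (free_module R B)" "finite A" "{b. f b \<noteq> \<zero>\<^bsub>R\<^esub>} \<subseteq> A" "A \<subseteq> B"
  shows "\<phi> f = (\<Oplus>\<^bsub>N\<^esub>b\<in>A. f b \<odot>\<^bsub>N\<^esub> \<phi> (basis_elem R b))"
proof -
  interpret N: module R N by fact
  let ?F = "free_module R B"
  interpret F: module R ?F by (rule free_module_is_module) (rule N.R.is_cring)
  have e: "basis_elem R b \<in> carrier ?F" if "b \<in> A" for b
    by (rule basis_elem_closed[OF N.R.is_cring]) (use assms(6) that in auto)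
  have fb: "f b \<in> carrier R" for b using assms(3) by (rule free_module_closed)
  have Pi: "(\<lambda>b. f b \<odot>\<^bsub>?F\<^esub> basis_elem R b) \<in> A \<rightarrow> carrier ?F" using e fb by auto
  have "\<phi> f = \<phi> (\<Oplus>\<^bsub>?F\<^esub>b\<in>A. f b \<odot>\<^bsub>?F\<^esub> basis_elem R b)"
    by (rule arg_cong[where f = \<phi>], rule free_module_expand[OF N.R.is_cring assms(3-6)])
  also have "\<dots> = (\<Oplus>\<^bsub>N\<^esub>b\<in>A. \<phi> (f b \<odot>\<^bsub>?F\<^esub> basis_elem R b))"
    by (rule linear_finsum[OF F.module_axioms assms(1,2) Pi])
  also have "\<dots> = (\<Oplus>\<^bsub>N\<^esub>b\<in>A. f b \<odot>\<^bsub>N\<^esub> \<phi> (basis_elem R b))"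
  proof (rule N.M.finsum_cong'[OF refl])
    show "(\<lambda>b. f b \<odot>\<^bsub>N\<^esub> \<phi> (basis_elem R b)) \<in> A \<rightarrow> carrier N"
      using N.smult_closed[OF fb linear_closed[OF assms(2) e]] by blast
    show "\<phi> (f b \<odot>\<^bsub>?F\<^esub> basis_elem R b) = f b \<odot>\<^bsub>N\<^esub> \<phi> (basis_elem R b)" if "b \<in> A" for b
      by (rule linear_smult[OF assms(2) fb e[OF that]])
  qed
  finally show ?thesis .
qed

lemma linear_free_eqI:
  assumes "module R N" "linear R (free_module R B) N \<phi>" "linear R (free_module R B) N \<psi>"
    and "\<And>b. b \<in> B \<Longrightarrow> \<phi> (basis_elem R b) = \<psi> (basis_elem R b)" "f \<in> carrier (free_module R B)"
  shows "\<phi> f = \<psi> f"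
proof -
  interpret N: module R N by fact
  let ?A = "{b. f b \<noteq> \<zero>\<^bsub>R\<^esub>}"
  have A: "finite ?A" "?A \<subseteq> B" using free_module_finite[OF assms(5)] free_module_support[OF assms(5)] by auto
  have e: "basis_elem R b \<in> carrier (free_module R B)" if "b \<in> B" for b
    using that by (rule basis_elem_closed[OF N.R.is_cring])
  have "\<phi> f = (\<Oplus>\<^bsub>N\<^esub>b\<in>?A. f b \<odot>\<^bsub>N\<^esub> \<phi> (basis_elem R b))"
    by (rule linear_expand[OF assms(1,2,5) A(1) subset_refl A(2)])
  also have "\<dots> = (\<Oplus>\<^bsub>N\<^esub>b\<in>?A. f b \<odot>\<^bsub>N\<^esub> \<psi> (basis_elem R b))"
  proof (rule N.M.finsum_cong'[OF refl])
    show "(\<lambda>b. f b \<odot>\<^bsub>N\<^esub> \<psi> (basis_elem R b)) \<in> ?A \<rightarrow> carrier N"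
      using N.smult_closed[OF free_module_closed[OF assms(5)] linear_closed[OF assms(3) e]] A by blast
    show "f b \<odot>\<^bsub>N\<^esub> \<phi> (basis_elem R b) = f b \<odot>\<^bsub>N\<^esub> \<psi> (basis_elem R b)" if "b \<in> ?A" for b
      using assms(4)[of b] A that by auto
  qed
  also have "\<dots> = \<psi> f"
    by (rule linear_expand[OF assms(1,3,5) A(1) subset_refl A(2), symmetric])
  finally show ?thesis .
qed

lemma linear_ext_linear:
  assumes "module R P" "v \<in> B \<rightarrow> carrier P"
  shows "linear R (free_module R B) P (linear_ext R P v)"
proof (rule linearI)
  fix f g r assume f: "f \<in> carrier (free_module R B)"
  show "linear_ext R P v f \<in> carrier P" by (rule linear_ext_closed[OF assms(1) f assms(2)])
  show "linear_ext R P v (f \<oplus>\<^bsub>free_module R B\<^esub> g) = linear_ext R P v f \<oplus>\<^bsub>P\<^esub> linear_ext R P v g"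
    if "g \<in> carrier (free_module R B)" by (rule linear_ext_add[OF assms(1) f that assms(2)])
  show "linear_ext R P v (r \<odot>\<^bsub>free_module R B\<^esub> f) = r \<odot>\<^bsub>P\<^esub> linear_ext R P v f"
    if "r \<in> carrier R" by (rule linear_ext_smult[OF assms(1) f that assms(2)])
qed

lemma free_module_lift:
  assumes "module R P" "module R Q" "linear R (free_module R B) P \<phi>" "linear R Q P g"
    and "\<And>f. f \<in> carrier (free_module R B) \<Longrightarrow> \<phi> f \<in> g ` carrier Q"
  obtains h where "linear R (free_module R B) Q h"
    "\<And>f. f \<in> carrier (free_module R B) \<Longrightarrow> g (h f) = \<phi> f"
proof -
  have e: "basis_elem R b \<in> carrier (free_module R B)" if "b \<in> B" for b
    using that by (rule basis_elem_closed[OF module_cring[OF assms(1)]])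
  have "\<forall>b\<in>B. \<exists>x\<in>carrier Q. g x = \<phi> (basis_elem R b)" 
  proof
    fix b assume "b \<in> B"
    from assms(5)[OF e[OF this]] show "\<exists>x\<in>carrier Q. g x = \<phi> (basis_elem R b)" by auto
  qed
  then obtain v where v: "\<And>b. b \<in> B \<Longrightarrow> v b \<in> carrier Q" "\<And>b. b \<in> B \<Longrightarrow> g (v b) = \<phi> (basis_elem R b)"
    by metis
  have v': "v \<in> B \<rightarrow> carrier Q" using v by auto
  let ?h = "linear_ext R Q v"
  have h: "linear R (free_module R B) Q ?h" by (rule linear_ext_linear[OF assms(2) v'])
  have "g (?h f) = \<phi> f" if "f \<in> carrier (free_module R B)" for f
    by (rule linear_free_eqI[OF assms(1) linear_compose[OF h assms(4)] assms(3) _ that])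
       (metis linear_ext_basis[OF assms(2) _ v'] v(2))
  thus thesis using h that by blast
qed

lemma finsum_swap:
  assumes "abelian_group N" "finite A" "finite B" "\<And>a b. a \<in> A \<Longrightarrow> b \<in> B \<Longrightarrow> f a b \<in> carrier N"
  shows "(\<Oplus>\<^bsub>N\<^esub>a\<in>A. \<Oplus>\<^bsub>N\<^esub>b\<in>B. f a b) = (\<Oplus>\<^bsub>N\<^esub>b\<in>B. \<Oplus>\<^bsub>N\<^esub>a\<in>A. f a b)"
proof -
  interpret N: abelian_group N by fact
  show ?thesis using assms(2,4)
  proof (induction A)
    case empty
    then show ?case by simp
  next
    case (insert x A)
    have "(\<Oplus>\<^bsub>N\<^esub>a\<in>insert x A. \<Oplus>\<^bsub>N\<^esub>b\<in>B. f a b) = (\<Oplus>\<^bsub>N\<^esub>b\<in>B. f x b) \<oplus>\<^bsub>N\<^esub> (\<Oplus>\<^bsub>N\<^esub>b\<in>B. \<Oplus>\<^bsub>N\<^esub>a\<in>A. f a b)"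
      using insert by (subst N.finsum_insert) (auto intro!: N.finsum_closed)
    also have "\<dots> = (\<Oplus>\<^bsub>N\<^esub>b\<in>B. f x b \<oplus>\<^bsub>N\<^esub> (\<Oplus>\<^bsub>N\<^esub>a\<in>A. f a b))"
      by (rule N.finsum_addf[symmetric]) (use insert in \<open>auto intro!: N.finsum_closed\<close>)
    also have "\<dots> = (\<Oplus>\<^bsub>N\<^esub>b\<in>B. \<Oplus>\<^bsub>N\<^esub>a\<in>insert x A. f a b)"
      by (rule N.finsum_cong')
         (use insert in \<open>auto intro!: N.finsum_closed N.add.m_closed simp: N.finsum_insert Pi_def\<close>)
    finally show ?case .
  qed
qed

section \<open>Extension of scalars for matrices\<close>

definition fin_supp :: "('b, 'm) ring_scheme \<Rightarrow> 'g set \<Rightarrow> ('g \<Rightarrow> 'b) set" where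
  "fin_supp N B = {g. (\<forall>b. g b \<in> carrier N) \<and> (\<forall>b. b \<notin> B \<longrightarrow> g b = \<zero>\<^bsub>N\<^esub>) \<and> finite {b. g b \<noteq> \<zero>\<^bsub>N\<^esub>}}"

definition ring_module :: "('a, 'm) ring_scheme \<Rightarrow> ('a, 'a) module" where
  "ring_module R = \<lparr>carrier = carrier R, monoid.mult = undefined, one = undefined,
     ring.zero = \<zero>\<^bsub>R\<^esub>, add = add R, smult = monoid.mult R\<rparr>"

definition balanced ::
  "('a, 'm) ring_scheme \<Rightarrow> ('a, 'b, 'n) module_scheme \<Rightarrow> ('a, 'c, 'l) module_scheme \<Rightarrow>
   ('d, 'k) ring_scheme \<Rightarrow> ('b \<Rightarrow> 'c \<Rightarrow> 'd) \<Rightarrow> bool" where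
  "balanced R K N A \<beta> \<longleftrightarrow> module R K \<and> module R N \<and> abelian_group A \<and>
     (\<forall>x\<in>carrier K. additive N A (\<beta> x)) \<and> (\<forall>y\<in>carrier N. additive K A (\<lambda>x. \<beta> x y)) \<and>
     (\<forall>r\<in>carrier R. \<forall>x\<in>carrier K. \<forall>y\<in>carrier N. \<beta> (r \<odot>\<^bsub>K\<^esub> x) y = \<beta> x (r \<odot>\<^bsub>N\<^esub> y))"

definition tensor_eval ::
  "('a, 'm) ring_scheme \<Rightarrow> ('c, 'l) ring_scheme \<Rightarrow> ('d, 'k) ring_scheme \<Rightarrow> ('b \<Rightarrow> 'c \<Rightarrow> 'd) \<Rightarrow>
   (('g \<Rightarrow> 'a) \<Rightarrow> 'b) \<Rightarrow> ('g \<Rightarrow> 'c) \<Rightarrow> 'd" where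
  "tensor_eval R N A \<beta> \<phi> g = (\<Oplus>\<^bsub>A\<^esub>b\<in>{b. g b \<noteq> \<zero>\<^bsub>N\<^esub>}. \<beta> (\<phi> (basis_elem R b)) (g b))"

definition extend_scalars ::
  "('a, 'm) ring_scheme \<Rightarrow> ('a, 'c, 'l) module_scheme \<Rightarrow> (('g \<Rightarrow> 'a) \<Rightarrow> ('h \<Rightarrow> 'a)) \<Rightarrow> ('g \<Rightarrow> 'c) \<Rightarrow> ('h \<Rightarrow> 'c)" where
  "extend_scalars R N \<phi> g = (\<lambda>c. tensor_eval R N N (smult N) (\<lambda>f. \<phi> f c) g)"

lemma ring_module_is_module: "cring R \<Longrightarrow> module R (ring_module R)"
proof -
  assume "cring R" then interpret cring R .
  show ?thesis
  proof (rule moduleI)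
    show "abelian_group (ring_module R)"
      by (rule abelian_groupI) (auto simp: ring_module_def a_ac intro: exI[of _ "\<ominus>\<^bsub>R\<^esub> _"] bexI[of _ "\<ominus>\<^bsub>R\<^esub> _"] l_neg)
  qed (use \<open>cring R\<close> in \<open>auto simp: ring_module_def l_distr r_distr m_assoc\<close>)
qed

lemma ring_module_simps [simp]:
  "carrier (ring_module R) = carrier R" "\<zero>\<^bsub>ring_module R\<^esub> = \<zero>\<^bsub>R\<^esub>"
  "add (ring_module R) = add R" "smult (ring_module R) = monoid.mult R"
  by (simp_all add: ring_module_def)

lemma linear_coord: "cring R \<Longrightarrow> linear R (free_module R B) (ring_module R) (\<lambda>f. f c)"
  by (rule linearI) (auto simp: free_module_def)

lemma fin_suppD:
  assumes "g \<in> fin_supp N B"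
  shows "g b \<in> carrier N" "finite {b. g b \<noteq> \<zero>\<^bsub>N\<^esub>}" "{b. g b \<noteq> \<zero>\<^bsub>N\<^esub>} \<subseteq> B" "b \<notin> B \<Longrightarrow> g b = \<zero>\<^bsub>N\<^esub>"
  using assms by (auto simp: fin_supp_def)

lemma fin_suppI:
  assumes "\<And>b. g b \<in> carrier N" "finite S" "S \<subseteq> B" "\<And>b. b \<notin> S \<Longrightarrow> g b = \<zero>\<^bsub>N\<^esub>"
  shows "g \<in> fin_supp N B"
  using assms finite_subset[of "{b. g b \<noteq> \<zero>\<^bsub>N\<^esub>}" S] by (auto simp: fin_supp_def)

lemma fin_supp_add:
  assumes "abelian_group N" "g \<in> fin_supp N B" "h \<in> fin_supp N B"
  shows "(\<lambda>b. g b \<oplus>\<^bsub>N\<^esub> h b) \<in> fin_supp N B"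
proof -
  interpret N: abelian_group N by fact
  note g = fin_suppD[OF assms(2)] and h = fin_suppD[OF assms(3)]
  show ?thesis
    by (rule fin_suppI[of _ _ "{b. g b \<noteq> \<zero>\<^bsub>N\<^esub>} \<union> {b. h b \<noteq> \<zero>\<^bsub>N\<^esub>}"])
       (use g(2,3) h(2,3) N.add.m_closed[OF g(1) h(1)] in auto)
qed

lemma balancedD:
  assumes "balanced R K N A \<beta>"
  shows "module R K" "module R N" "abelian_group A"
    "x \<in> carrier K \<Longrightarrow> additive N A (\<beta> x)" "y \<in> carrier N \<Longrightarrow> additive K A (\<lambda>x. \<beta> x y)"
    "r \<in> carrier R \<Longrightarrow> x \<in> carrier K \<Longrightarrow> y \<in> carrier N \<Longrightarrow> \<beta> (r \<odot>\<^bsub>K\<^esub> x) y = \<beta> x (r \<odot>\<^bsub>N\<^esub> y)"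
  using assms by (auto simp: balanced_def)

lemma balanced_closed:
  "balanced R K N A \<beta> \<Longrightarrow> x \<in> carrier K \<Longrightarrow> y \<in> carrier N \<Longrightarrow> \<beta> x y \<in> carrier A"
  using balancedD(4) additive_closed by metis

lemma balanced_zero:
  "balanced R K N A \<beta> \<Longrightarrow> x \<in> carrier K \<Longrightarrow> \<beta> x \<zero>\<^bsub>N\<^esub> = \<zero>\<^bsub>A\<^esub>"
  using additive_zero[OF module_abelian_group[OF balancedD(2)] balancedD(3,4)] .

lemma balanced_smult: "module R N \<Longrightarrow> balanced R (ring_module R) N N (smult N)"
proof -
  assume N: "module R N" then interpret N: module R N .
  show ?thesis
    using ring_module_is_module[OF N.R.is_cring] N
    by (auto simp: balanced_def additive_def N.smult_r_distr N.smult_l_distr N.smult_assoc1[symmetric]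
        N.R.m_comm N.M.abelian_group_axioms)
qed

lemma tensor_eval_superset:
  assumes "balanced R K N A \<beta>" "linear R (free_module R B) K \<phi>" "g \<in> fin_supp N B"
    "finite S" "{b. g b \<noteq> \<zero>\<^bsub>N\<^esub>} \<subseteq> S" "S \<subseteq> B"
  shows "tensor_eval R N A \<beta> \<phi> g = (\<Oplus>\<^bsub>A\<^esub>b\<in>S. \<beta> (\<phi> (basis_elem R b)) (g b))"
proof -
  interpret A: abelian_group A by (rule balancedD(3)[OF assms(1)])
  have e: "\<phi> (basis_elem R b) \<in> carrier K" if "b \<in> S" for b
    by (rule linear_closed[OF assms(2) basis_elem_closed])
       (use module_cring[OF balancedD(1)[OF assms(1)]] assms(6) that in auto)
  note c = balanced_closed[OF assms(1) e fin_suppD(1)[OF assms(3)]]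
  have "\<beta> (\<phi> (basis_elem R b)) (g b) = \<zero>\<^bsub>A\<^esub>" if "b \<in> S - {b. g b \<noteq> \<zero>\<^bsub>N\<^esub>}" for b
    using that balanced_zero[OF assms(1) e] by auto
  thus ?thesis unfolding tensor_eval_def
    by (intro A.add.finprod_mono_neutral_cong_left) (use assms(4,5) c in auto)
qed

lemma tensor_eval_closed:
  assumes "balanced R K N A \<beta>" "linear R (free_module R B) K \<phi>" "g \<in> fin_supp N B"
  shows "tensor_eval R N A \<beta> \<phi> g \<in> carrier A"
proof -
  interpret A: abelian_group A by (rule balancedD(3)[OF assms(1)])
  note g = fin_suppD[OF assms(3)]
  have e: "\<phi> (basis_elem R b) \<in> carrier K" if "b \<in> B" for b
    by (rule linear_closed[OF assms(2) basis_elem_closed])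
       (use module_cring[OF balancedD(1)[OF assms(1)]] that in auto)
  show ?thesis unfolding tensor_eval_def
    by (rule A.finsum_closed) (use g(3) balanced_closed[OF assms(1) e g(1)] in auto)
qed

lemma tensor_eval_add:
  assumes "balanced R K N A \<beta>" "linear R (free_module R B) K \<phi>" "g \<in> fin_supp N B" "h \<in> fin_supp N B"
  shows "tensor_eval R N A \<beta> \<phi> (\<lambda>b. g b \<oplus>\<^bsub>N\<^esub> h b) =
    tensor_eval R N A \<beta> \<phi> g \<oplus>\<^bsub>A\<^esub> tensor_eval R N A \<beta> \<phi> h"
proof -
  interpret A: abelian_group A by (rule balancedD(3)[OF assms(1)])
  interpret N: module R N by (rule balancedD(2)[OF assms(1)])
  note g = fin_suppD[OF assms(3)] and h = fin_suppD[OF assms(4)]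
  let ?S = "{b. g b \<noteq> \<zero>\<^bsub>N\<^esub>} \<union> {b. h b \<noteq> \<zero>\<^bsub>N\<^esub>}"
  have S: "finite ?S" "?S \<subseteq> B" using g(2,3) h(2,3) by auto
  have e: "\<phi> (basis_elem R b) \<in> carrier K" if "b \<in> ?S" for b
    by (rule linear_closed[OF assms(2) basis_elem_closed])
       (use module_cring[OF balancedD(1)[OF assms(1)]] S that in auto)
  note cg = balanced_closed[OF assms(1) e g(1)] and ch = balanced_closed[OF assms(1) e h(1)]
  have "tensor_eval R N A \<beta> \<phi> (\<lambda>b. g b \<oplus>\<^bsub>N\<^esub> h b) =
      (\<Oplus>\<^bsub>A\<^esub>b\<in>?S. \<beta> (\<phi> (basis_elem R b)) (g b \<oplus>\<^bsub>N\<^esub> h b))"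
    by (rule tensor_eval_superset[OF assms(1,2) fin_supp_add[OF N.abelian_group_axioms assms(3,4)] S(1) _ S(2)])
       auto
  also have "\<dots> = (\<Oplus>\<^bsub>A\<^esub>b\<in>?S. \<beta> (\<phi> (basis_elem R b)) (g b) \<oplus>\<^bsub>A\<^esub> \<beta> (\<phi> (basis_elem R b)) (h b))"
  proof (rule A.finsum_cong'[OF refl])
    show "(\<lambda>b. \<beta> (\<phi> (basis_elem R b)) (g b) \<oplus>\<^bsub>A\<^esub> \<beta> (\<phi> (basis_elem R b)) (h b)) \<in> ?S \<rightarrow> carrier A"
      using A.add.m_closed[OF cg ch] by blast
  qed (rule additive_add[OF balancedD(4)[OF assms(1) e] g(1) h(1)])
  also have "\<dots> = (\<Oplus>\<^bsub>A\<^esub>b\<in>?S. \<beta> (\<phi> (basis_elem R b)) (g b)) \<oplus>\<^bsub>A\<^esub> (\<Oplus>\<^bsub>A\<^esub>b\<in>?S. \<beta> (\<phi> (basis_elem R b)) (h b))"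
    by (rule A.finsum_addf) (use cg ch in blast)+
  also have "(\<Oplus>\<^bsub>A\<^esub>b\<in>?S. \<beta> (\<phi> (basis_elem R b)) (g b)) = tensor_eval R N A \<beta> \<phi> g"
    by (rule tensor_eval_superset[OF assms(1-3) S(1) _ S(2), symmetric]) auto
  also have "(\<Oplus>\<^bsub>A\<^esub>b\<in>?S. \<beta> (\<phi> (basis_elem R b)) (h b)) = tensor_eval R N A \<beta> \<phi> h"
    by (rule tensor_eval_superset[OF assms(1,2,4) S(1) _ S(2), symmetric]) auto
  finally show ?thesis .
qed

lemma fin_supp_smult:
  assumes "module R N" "g \<in> fin_supp N B" "r \<in> carrier R"
  shows "(\<lambda>b. r \<odot>\<^bsub>N\<^esub> g b) \<in> fin_supp N B"
proof -
  interpret N: module R N by fact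
  note g = fin_suppD[OF assms(2)]
  show ?thesis
    by (rule fin_suppI[of _ _ "{b. g b \<noteq> \<zero>\<^bsub>N\<^esub>}"]) (use g(2,3) N.smult_closed[OF assms(3) g(1)] assms(3) in auto)
qed

lemma tensor_eval_smult:
  assumes "balanced R K N A \<beta>" "linear R (free_module R B) K \<phi>" "g \<in> fin_supp N B" "r \<in> carrier R"
    and A: "module R A"
    and r: "\<And>x y. x \<in> carrier K \<Longrightarrow> y \<in> carrier N \<Longrightarrow> \<beta> x (r \<odot>\<^bsub>N\<^esub> y) = r \<odot>\<^bsub>A\<^esub> \<beta> x y"
  shows "tensor_eval R N A \<beta> \<phi> (\<lambda>b. r \<odot>\<^bsub>N\<^esub> g b) = r \<odot>\<^bsub>A\<^esub> tensor_eval R N A \<beta> \<phi> g"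
proof -
  interpret A: module R A by (rule A)
  interpret N: module R N by (rule balancedD(2)[OF assms(1)])
  note g = fin_suppD[OF assms(3)]
  let ?S = "{b. g b \<noteq> \<zero>\<^bsub>N\<^esub>}"
  have e: "\<phi> (basis_elem R b) \<in> carrier K" if "b \<in> ?S" for b
    by (rule linear_closed[OF assms(2) basis_elem_closed])
       (use module_cring[OF balancedD(1)[OF assms(1)]] g(3) that in auto)
  note cg = balanced_closed[OF assms(1) e g(1)]
  have "tensor_eval R N A \<beta> \<phi> (\<lambda>b. r \<odot>\<^bsub>N\<^esub> g b) = (\<Oplus>\<^bsub>A\<^esub>b\<in>?S. \<beta> (\<phi> (basis_elem R b)) (r \<odot>\<^bsub>N\<^esub> g b))"
    by (rule tensor_eval_superset[OF assms(1,2) fin_supp_smult[OF N.module_axioms assms(3,4)] g(2) _ g(3)])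
       (use assms(4) in auto)
  also have "\<dots> = (\<Oplus>\<^bsub>A\<^esub>b\<in>?S. r \<odot>\<^bsub>A\<^esub> \<beta> (\<phi> (basis_elem R b)) (g b))"
    by (rule A.M.finsum_cong'[OF refl _ r[OF e g(1)]]) (use A.smult_closed[OF assms(4) cg] in blast)
  also have "\<dots> = r \<odot>\<^bsub>A\<^esub> tensor_eval R N A \<beta> \<phi> g" unfolding tensor_eval_def
    by (rule A.finsum_smult_ldistr[symmetric]) (use g(2) assms(4) cg in blast)+
  finally show ?thesis .
qed

lemma tensor_eval_pure:
  assumes "balanced R K N A \<beta>" "linear R (free_module R B) K \<phi>" "f \<in> carrier (free_module R B)" "y \<in> carrier N"
  shows "tensor_eval R N A \<beta> \<phi> (\<lambda>b. f b \<odot>\<^bsub>N\<^esub> y) = \<beta> (\<phi> f) y"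
proof -
  interpret A: abelian_group A by (rule balancedD(3)[OF assms(1)])
  interpret K: module R K by (rule balancedD(1)[OF assms(1)])
  interpret N: module R N by (rule balancedD(2)[OF assms(1)])
  note f = free_module_closed[OF assms(3)] free_module_finite[OF assms(3)] free_module_support[OF assms(3)]
  let ?S = "{b. f b \<noteq> \<zero>\<^bsub>R\<^esub>}"
  have e: "\<phi> (basis_elem R b) \<in> carrier K" if "b \<in> ?S" for b
    by (rule linear_closed[OF assms(2) basis_elem_closed])
       (use module_cring[OF balancedD(1)[OF assms(1)]] f(3) that in auto)
  have fy: "f b \<odot>\<^bsub>N\<^esub> y \<in> carrier N" for b using f(1) assms(4) by simp
  have "tensor_eval R N A \<beta> \<phi> (\<lambda>b. f b \<odot>\<^bsub>N\<^esub> y) = (\<Oplus>\<^bsub>A\<^esub>b\<in>?S. \<beta> (\<phi> (basis_elem R b)) (f b \<odot>\<^bsub>N\<^esub> y))"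
    by (rule tensor_eval_superset[OF assms(1,2) _ f(2) _ f(3)], rule fin_suppI[OF fy f(2,3)])
       (use assms(4) in auto)
  also have "\<dots> = (\<Oplus>\<^bsub>A\<^esub>b\<in>?S. \<beta> (f b \<odot>\<^bsub>K\<^esub> \<phi> (basis_elem R b)) y)"
    by (rule A.finsum_cong'[OF refl _ balancedD(6)[OF assms(1) f(1) e assms(4), symmetric]])
       (use balanced_closed[OF assms(1) K.smult_closed[OF f(1) e] assms(4)] in blast)
  also have "\<dots> = \<beta> (\<Oplus>\<^bsub>K\<^esub>b\<in>?S. f b \<odot>\<^bsub>K\<^esub> \<phi> (basis_elem R b)) y"
    by (rule additive_finsum[OF K.abelian_group_axioms A.abelian_group_axioms
          balancedD(5)[OF assms(1,4)], symmetric])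
       (use K.smult_closed[OF f(1) e] in blast)
  also have "(\<Oplus>\<^bsub>K\<^esub>b\<in>?S. f b \<odot>\<^bsub>K\<^esub> \<phi> (basis_elem R b)) = \<phi> f"
    by (rule linear_expand[OF K.module_axioms assms(2,3) f(2) subset_refl f(3), symmetric])
  finally show ?thesis .
qed

lemma extend_scalars_closed:
  assumes "module R N" "linear R (free_module R B) (free_module R B') \<phi>" "g \<in> fin_supp N B"
  shows "extend_scalars R N \<phi> g \<in> fin_supp N B'"
proof (rule fin_suppI)
  interpret N: module R N by fact
  note g = fin_suppD[OF assms(3)]
  let ?S = "\<Union>b\<in>{b. g b \<noteq> \<zero>\<^bsub>N\<^esub>}. {c. \<phi> (basis_elem R b) c \<noteq> \<zero>\<^bsub>R\<^esub>}"
  have e: "\<phi> (basis_elem R b) \<in> carrier (free_module R B')" if "b \<in> {b. g b \<noteq> \<zero>\<^bsub>N\<^esub>}" for b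
    by (rule linear_closed[OF assms(2) basis_elem_closed])
       (use N.R.is_cring g(3) that in auto)
  show "finite ?S" using g(2) free_module_finite[OF e] by blast
  show "?S \<subseteq> B'" using free_module_support[OF e] by blast
  show "extend_scalars R N \<phi> g c \<in> carrier N" for c unfolding extend_scalars_def
    by (rule tensor_eval_closed[OF balanced_smult[OF assms(1)]
          linear_compose[OF assms(2) linear_coord[OF N.R.is_cring]] assms(3)])
  show "extend_scalars R N \<phi> g c = \<zero>\<^bsub>N\<^esub>" if "c \<notin> ?S" for c
    unfolding extend_scalars_def tensor_eval_def
    by (rule N.M.add.finprod_one_eqI[unfolded finsum_def[symmetric], simplified])
       (use that g(1) in auto)
qed

lemma tensor_eval_extend_scalars:
  assumes "balanced R K N A \<beta>" "linear R (free_module R B') K \<phi>"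
    "linear R (free_module R B) (free_module R B') \<delta>" "g \<in> fin_supp N B"
  shows "tensor_eval R N A \<beta> \<phi> (extend_scalars R N \<delta> g) = tensor_eval R N A \<beta> (\<lambda>f. \<phi> (\<delta> f)) g"
proof -
  interpret A: abelian_group A by (rule balancedD(3)[OF assms(1)])
  interpret K: module R K by (rule balancedD(1)[OF assms(1)])
  interpret N: module R N by (rule balancedD(2)[OF assms(1)])
  note g = fin_suppD[OF assms(4)]
  let ?T = "{b. g b \<noteq> \<zero>\<^bsub>N\<^esub>}"
  let ?S = "\<Union>b\<in>?T. {c. \<delta> (basis_elem R b) c \<noteq> \<zero>\<^bsub>R\<^esub>}"
  have e: "\<delta> (basis_elem R b) \<in> carrier (free_module R B')" if "b \<in> ?T" for b
    by (rule linear_closed[OF assms(3) basis_elem_closed])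
       (use K.R.is_cring g(3) that in auto)
  have S: "finite ?S" "?S \<subseteq> B'" using g(2) free_module_finite[OF e] free_module_support[OF e] by blast+
  have e': "\<phi> (basis_elem R c) \<in> carrier K" if "c \<in> ?S" for c
    by (rule linear_closed[OF assms(2) basis_elem_closed]) (use K.R.is_cring S that in auto)
  note dc = free_module_closed[OF e]
  let ?f = "\<lambda>c b. \<delta> (basis_elem R b) c \<odot>\<^bsub>N\<^esub> g b"
  have es: "extend_scalars R N \<delta> g c = (\<Oplus>\<^bsub>N\<^esub>b\<in>?T. ?f c b)" for c
    by (simp add: extend_scalars_def tensor_eval_def)
  have "{c. extend_scalars R N \<delta> g c \<noteq> \<zero>\<^bsub>N\<^esub>} \<subseteq> ?S"
  proof safe
    fix c assume c: "extend_scalars R N \<delta> g c \<noteq> \<zero>\<^bsub>N\<^esub>"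
    show "c \<in> ?S"
    proof (rule ccontr)
      assume "c \<notin> ?S"
      hence "extend_scalars R N \<delta> g c = \<zero>\<^bsub>N\<^esub>" unfolding es
        by (intro N.M.add.finprod_one_eqI[unfolded finsum_def[symmetric], simplified]) (use g(1) in auto)
      thus False using c by simp
    qed
  qed
  hence "tensor_eval R N A \<beta> \<phi> (extend_scalars R N \<delta> g) =
    (\<Oplus>\<^bsub>A\<^esub>c\<in>?S. \<beta> (\<phi> (basis_elem R c)) (extend_scalars R N \<delta> g c))"
    by (rule tensor_eval_superset[OF assms(1,2) extend_scalars_closed[OF N.module_axioms assms(3,4)] S(1) _ S(2)])
  also have "\<dots> = (\<Oplus>\<^bsub>A\<^esub>c\<in>?S. \<Oplus>\<^bsub>A\<^esub>b\<in>?T. \<beta> (\<phi> (basis_elem R c)) (?f c b))"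
  proof (rule A.finsum_cong'[OF refl])
    fix c assume c: "c \<in> ?S"
    have fc: "?f c b \<in> carrier N" if "b \<in> ?T" for b using N.smult_closed[OF dc[OF that] g(1)] .
    show "\<beta> (\<phi> (basis_elem R c)) (extend_scalars R N \<delta> g c) = (\<Oplus>\<^bsub>A\<^esub>b\<in>?T. \<beta> (\<phi> (basis_elem R c)) (?f c b))"
      unfolding es
      by (rule additive_finsum[OF N.abelian_group_axioms A.abelian_group_axioms balancedD(4)[OF assms(1) e'[OF c]]])
         (use fc in blast)
  next
    show "(\<lambda>c. \<Oplus>\<^bsub>A\<^esub>b\<in>?T. \<beta> (\<phi> (basis_elem R c)) (?f c b)) \<in> ?S \<rightarrow> carrier A"
      using balanced_closed[OF assms(1) e' N.smult_closed[OF dc g(1)]]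
      by (intro funcsetI A.finsum_closed) blast
  qed
  also have "\<dots> = (\<Oplus>\<^bsub>A\<^esub>b\<in>?T. \<Oplus>\<^bsub>A\<^esub>c\<in>?S. \<beta> (\<phi> (basis_elem R c)) (?f c b))"
    by (rule finsum_swap[OF A.abelian_group_axioms S(1) g(2)])
       (rule balanced_closed[OF assms(1) e' N.smult_closed[OF dc g(1)]])
  also have "\<dots> = (\<Oplus>\<^bsub>A\<^esub>b\<in>?T. \<beta> (\<phi> (\<delta> (basis_elem R b))) (g b))"
  proof (rule A.finsum_cong'[OF refl])
    show "(\<lambda>b. \<beta> (\<phi> (\<delta> (basis_elem R b))) (g b)) \<in> ?T \<rightarrow> carrier A"
      using balanced_closed[OF assms(1) linear_closed[OF assms(2) e] g(1)] by blast
    fix b assume b: "b \<in> ?T"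
    have fy: "?f c b \<in> carrier N" for c using N.smult_closed[OF dc[OF b] g(1)] .
    have sub: "{c. ?f c b \<noteq> \<zero>\<^bsub>N\<^esub>} \<subseteq> ?S" using b g(1) by auto
    have "\<beta> (\<phi> (\<delta> (basis_elem R b))) (g b) = tensor_eval R N A \<beta> \<phi> (\<lambda>c. ?f c b)"
      by (rule tensor_eval_pure[OF assms(1,2) e[OF b] g(1), symmetric])
    also have "\<dots> = (\<Oplus>\<^bsub>A\<^esub>c\<in>?S. \<beta> (\<phi> (basis_elem R c)) (?f c b))"
      by (rule tensor_eval_superset[OF assms(1,2) fin_suppI[OF fy S] S(1) sub S(2)]) (use sub in blast)
    finally show "(\<Oplus>\<^bsub>A\<^esub>c\<in>?S. \<beta> (\<phi> (basis_elem R c)) (?f c b)) = \<beta> (\<phi> (\<delta> (basis_elem R b))) (g b)" ..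
  qed
  finally show ?thesis by (simp add: tensor_eval_def)
qed

lemma extend_scalars_compose:
  assumes "module R N" "linear R (free_module R B) (free_module R B') \<phi>"
    "linear R (free_module R B') (free_module R B'') \<psi>" "g \<in> fin_supp N B"
  shows "extend_scalars R N \<psi> (extend_scalars R N \<phi> g) = extend_scalars R N (\<lambda>f. \<psi> (\<phi> f)) g"
  unfolding extend_scalars_def[of R N \<psi>] extend_scalars_def[of R N "\<lambda>f. \<psi> (\<phi> f)"]
  by (rule ext, rule tensor_eval_extend_scalars[OF balanced_smult[OF assms(1)]
     linear_compose[OF assms(3) linear_coord[OF module_cring[OF assms(1)]]] assms(2,4)])

lemma extend_scalars_add:
  assumes "module R N" "linear R (free_module R B) (free_module R B') \<phi>"
    "g \<in> fin_supp N B" "h \<in> fin_supp N B"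
  shows "extend_scalars R N \<phi> (\<lambda>b. g b \<oplus>\<^bsub>N\<^esub> h b) =
    (\<lambda>c. extend_scalars R N \<phi> g c \<oplus>\<^bsub>N\<^esub> extend_scalars R N \<phi> h c)"
  unfolding extend_scalars_def
  by (rule ext, rule tensor_eval_add[OF balanced_smult[OF assms(1)]
     linear_compose[OF assms(2) linear_coord[OF module_cring[OF assms(1)]]] assms(3,4)])

lemma extend_scalars_smult:
  assumes "module R N" "linear R (free_module R B) (free_module R B') \<phi>"
    "g \<in> fin_supp N B" "r \<in> carrier R"
  shows "extend_scalars R N \<phi> (\<lambda>b. r \<odot>\<^bsub>N\<^esub> g b) = (\<lambda>c. r \<odot>\<^bsub>N\<^esub> extend_scalars R N \<phi> g c)"
proof -
  interpret N: module R N by fact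
  show ?thesis unfolding extend_scalars_def
    by (rule ext, rule tensor_eval_smult[OF balanced_smult[OF assms(1)]
       linear_compose[OF assms(2) linear_coord[OF module_cring[OF assms(1)]]] assms(3,4,1)])
      (use assms(4) in \<open>auto simp: N.smult_assoc1[symmetric] N.R.m_comm\<close>)
qed

lemma extend_scalars_pure:
  assumes "module R N" "linear R (free_module R B) (free_module R B') \<phi>"
    "f \<in> carrier (free_module R B)" "y \<in> carrier N"
  shows "extend_scalars R N \<phi> (\<lambda>b. f b \<odot>\<^bsub>N\<^esub> y) = (\<lambda>c. \<phi> f c \<odot>\<^bsub>N\<^esub> y)"
  unfolding extend_scalars_def
  by (rule ext, rule tensor_eval_pure[OF balanced_smult[OF assms(1)]
     linear_compose[OF assms(2) linear_coord[OF module_cring[OF assms(1)]]] assms(3,4)])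

lemma extend_scalars_cong:
  assumes "module R N" "linear R (free_module R B) (free_module R B') \<psi>" "g \<in> fin_supp N B"
    "\<And>f. f \<in> carrier (free_module R B) \<Longrightarrow> \<phi> f = \<psi> f"
  shows "extend_scalars R N \<phi> g = extend_scalars R N \<psi> g"
proof
  fix c
  interpret N: module R N by fact
  let ?T = "{b. g b \<noteq> \<zero>\<^bsub>N\<^esub>}"
  have e: "basis_elem R b \<in> carrier (free_module R B)" if "b \<in> ?T" for b
    using fin_suppD(3)[OF assms(3)] that by (intro basis_elem_closed[OF N.R.is_cring]) auto
  show "extend_scalars R N \<phi> g c = extend_scalars R N \<psi> g c"
    unfolding extend_scalars_def tensor_eval_def
  proof (rule N.M.finsum_cong'[OF refl])
    show "(\<lambda>b. \<psi> (basis_elem R b) c \<odot>\<^bsub>N\<^esub> g b) \<in> ?T \<rightarrow> carrier N"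
      using N.smult_closed[OF free_module_closed[OF linear_closed[OF assms(2) e]] fin_suppD(1)[OF assms(3)]] by blast
    show "\<phi> (basis_elem R b) c \<odot>\<^bsub>N\<^esub> g b = \<psi> (basis_elem R b) c \<odot>\<^bsub>N\<^esub> g b" if "b \<in> ?T" for b
      using assms(4)[OF e[OF that]] by simp
  qed
qed

section \<open>Free resolutions\<close>

lemma linear_add_maps:
  assumes "module R M" "module R N" "linear R M N f" "linear R M N g"
  shows "linear R M N (\<lambda>x. f x \<oplus>\<^bsub>N\<^esub> g x)"
proof -
  interpret M: module R M by fact
  interpret N: module R N by fact
  note [simp] = linear_closed[OF assms(3)] linear_closed[OF assms(4)]
    linear_add[OF assms(3)] linear_add[OF assms(4)]
    linear_smult[OF assms(3)] linear_smult[OF assms(4)]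
  show ?thesis by (rule linearI) (auto simp: N.smult_r_distr N.M.a_ac)
qed

lemma extend_scalars_add_maps:
  assumes "module R N" "linear R (free_module R B) (free_module R B') \<phi>"
    "linear R (free_module R B) (free_module R B') \<psi>" "g \<in> fin_supp N B"
  shows "extend_scalars R N (\<lambda>x. \<phi> x \<oplus>\<^bsub>free_module R B'\<^esub> \<psi> x) g =
    (\<lambda>c. extend_scalars R N \<phi> g c \<oplus>\<^bsub>N\<^esub> extend_scalars R N \<psi> g c)"
proof
  fix c
  interpret N: module R N by fact
  let ?T = "{b. g b \<noteq> \<zero>\<^bsub>N\<^esub>}"
  note g = fin_suppD[OF assms(4)]
  have e: "basis_elem R b \<in> carrier (free_module R B)" if "b \<in> ?T" for b
    using g(3) that by (intro basis_elem_closed[OF N.R.is_cring]) auto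
  note p1 = free_module_closed[OF linear_closed[OF assms(2) e]]
  note p2 = free_module_closed[OF linear_closed[OF assms(3) e]]
  have "extend_scalars R N (\<lambda>x. \<phi> x \<oplus>\<^bsub>free_module R B'\<^esub> \<psi> x) g c =
    (\<Oplus>\<^bsub>N\<^esub>b\<in>?T. \<phi> (basis_elem R b) c \<odot>\<^bsub>N\<^esub> g b \<oplus>\<^bsub>N\<^esub> \<psi> (basis_elem R b) c \<odot>\<^bsub>N\<^esub> g b)"
    unfolding extend_scalars_def tensor_eval_def free_module_add
    by (rule N.M.finsum_cong'[OF refl _ N.smult_l_distr[OF p1 p2 g(1)]])
       (use N.M.add.m_closed[OF N.smult_closed[OF p1 g(1)] N.smult_closed[OF p2 g(1)]] in blast)
  also have "\<dots> = extend_scalars R N \<phi> g c \<oplus>\<^bsub>N\<^esub> extend_scalars R N \<psi> g c"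
    unfolding extend_scalars_def tensor_eval_def
    by (rule N.M.finsum_addf) (use N.smult_closed[OF p1 g(1)] N.smult_closed[OF p2 g(1)] in blast)+
  finally show "extend_scalars R N (\<lambda>x. \<phi> x \<oplus>\<^bsub>free_module R B'\<^esub> \<psi> x) g c =
    extend_scalars R N \<phi> g c \<oplus>\<^bsub>N\<^esub> extend_scalars R N \<psi> g c" .
qed

lemma extend_scalars_id:
  assumes "module R N" "g \<in> fin_supp N B"
  shows "extend_scalars R N (\<lambda>x. x) g = g"
proof
  fix c
  interpret N: module R N by fact
  let ?T = "{b. g b \<noteq> \<zero>\<^bsub>N\<^esub>}"
  note g = fin_suppD[OF assms(2)]
  have "extend_scalars R N (\<lambda>x. x) g c = (\<Oplus>\<^bsub>N\<^esub>b\<in>?T. if c = b then g b else \<zero>\<^bsub>N\<^esub>)"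
    unfolding extend_scalars_def tensor_eval_def
    by (rule N.M.finsum_cong') (use g(1) in \<open>auto simp: basis_elem_def\<close>)
  also have "\<dots> = g c"
  proof (cases "c \<in> ?T")
    case True
    then show ?thesis using N.M.add.finprod_singleton[of c ?T g] g(1,2) by auto
  next
    case False
    hence "(\<Oplus>\<^bsub>N\<^esub>b\<in>?T. if c = b then g b else \<zero>\<^bsub>N\<^esub>) = (\<Oplus>\<^bsub>N\<^esub>b\<in>?T. \<zero>\<^bsub>N\<^esub>)"
      by (intro N.M.finsum_cong') auto
    thus ?thesis using False by simp
  qed
  finally show "extend_scalars R N (\<lambda>x. x) g c = g c" .
qed

lemma extend_scalars_zero:
  assumes "module R N" shows "extend_scalars R N \<phi> (\<lambda>_. \<zero>\<^bsub>N\<^esub>) = (\<lambda>_. \<zero>\<^bsub>N\<^esub>)"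
proof -
  interpret N: module R N by fact
  show ?thesis by (simp add: extend_scalars_def tensor_eval_def)
qed

definition free_resolution ::
  "('a, 'm) ring_scheme \<Rightarrow> ('a, 'b, 'n) module_scheme \<Rightarrow> (nat \<Rightarrow> 'g set) \<Rightarrow>
   (nat \<Rightarrow> ('g \<Rightarrow> 'a) \<Rightarrow> ('g \<Rightarrow> 'a)) \<Rightarrow> (('g \<Rightarrow> 'a) \<Rightarrow> 'b) \<Rightarrow> bool" where
  "free_resolution R M B d e \<longleftrightarrow> module R M \<and>
     linear R (free_module R (B 0)) M e \<and> e ` carrier (free_module R (B 0)) = carrier M \<and>
     (\<forall>n. linear R (free_module R (B (Suc n))) (free_module R (B n)) (d n)) \<and>
     d 0 ` carrier (free_module R (B (Suc 0))) = {x \<in> carrier (free_module R (B 0)). e x = \<zero>\<^bsub>M\<^esub>} \<and>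
     (\<forall>n. d (Suc n) ` carrier (free_module R (B (Suc (Suc n)))) =
        {x \<in> carrier (free_module R (B (Suc n))). d n x = \<zero>\<^bsub>free_module R (B n)\<^esub>})"

definition tor_vanishes ::
  "('a, 'm) ring_scheme \<Rightarrow> ('a, 'c, 'n) module_scheme \<Rightarrow> (nat \<Rightarrow> 'g set) \<Rightarrow>
   (nat \<Rightarrow> ('g \<Rightarrow> 'a) \<Rightarrow> ('g \<Rightarrow> 'a)) \<Rightarrow> nat \<Rightarrow> bool" where
  "tor_vanishes R N B d n \<longleftrightarrow>
     (\<forall>g\<in>fin_supp N (B n). (\<forall>i. n = Suc i \<longrightarrow> extend_scalars R N (d i) g = (\<lambda>_. \<zero>\<^bsub>N\<^esub>)) \<longrightarrow>
        (\<exists>h\<in>fin_supp N (B (Suc n)). extend_scalars R N (d n) h = g))"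

lemma free_resolutionD:
  assumes "free_resolution R M B d e"
  shows "module R M" "linear R (free_module R (B 0)) M e"
    "e ` carrier (free_module R (B 0)) = carrier M"
    "linear R (free_module R (B (Suc n))) (free_module R (B n)) (d n)"
    "d 0 ` carrier (free_module R (B (Suc 0))) = {x \<in> carrier (free_module R (B 0)). e x = \<zero>\<^bsub>M\<^esub>}"
    "d (Suc n) ` carrier (free_module R (B (Suc (Suc n)))) =
        {x \<in> carrier (free_module R (B (Suc n))). d n x = \<zero>\<^bsub>free_module R (B n)\<^esub>}"
  using assms unfolding free_resolution_def by blast+

lemma free_resolution_std:
  assumes "module R M"
  shows "free_resolution R M (res_gens R M) (res_diff R M) (res_aug R M)"
proof -
  interpret M: module R M by fact
  have e: "elt \<in> res_gens R M 0 \<rightarrow> carrier M" by auto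
  have w: "formal_sum R \<circ> terms \<in> res_gens R M (Suc n) \<rightarrow> carrier (free_module R (res_gens R M n))" for n
    by (cases n) (auto intro!: formal_sum_closed[OF M.R.is_cring] simp del: res_gens.simps(1))
  note ex = res_exact[OF assms, unfolded res_module_def a_kernel_def' One_nat_def]
  show ?thesis unfolding free_resolution_def
    using linear_ext_linear[OF assms e, folded res_aug_def] assms ex
      linear_ext_linear[OF free_module_is_module[OF M.R.is_cring] w]
    unfolding res_diff_def res_module_def by blast
qed

abbreviation kernel_module where
  "kernel_module M N f \<equiv> M\<lparr>carrier := {x \<in> carrier M. f x = \<zero>\<^bsub>N\<^esub>}\<rparr>"

lemma kernel_submodule:
  assumes "module R M" "module R N" "linear R M N f"
  shows "submodule {x \<in> carrier M. f x = \<zero>\<^bsub>N\<^esub>} R M"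
proof -
  interpret M: module R M by fact
  interpret N: module R N by fact
  show ?thesis
  proof (rule M.submoduleI)
    show "\<zero>\<^bsub>M\<^esub> \<in> {x \<in> carrier M. f x = \<zero>\<^bsub>N\<^esub>}" using linear_zero[OF assms] by simp
    show "\<ominus>\<^bsub>M\<^esub> a \<in> {x \<in> carrier M. f x = \<zero>\<^bsub>N\<^esub>}" if "a \<in> {x \<in> carrier M. f x = \<zero>\<^bsub>N\<^esub>}" for a
      using that additive_minus[OF M.abelian_group_axioms N.abelian_group_axioms linear_additive[OF assms(3)]]
      by auto
  qed (auto simp: linear_add[OF assms(3)] linear_smult[OF assms(3)])
qed

lemma kernel_module_is_module:
  "module R M \<Longrightarrow> module R N \<Longrightarrow> linear R M N f \<Longrightarrow> module R (kernel_module M N f)"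
  by (rule submodule.submodule_is_module[OF kernel_submodule])

lemma free_resolution_shift:
  assumes "free_resolution R M B d e"
  shows "free_resolution R (kernel_module (free_module R (B 0)) M e) (\<lambda>n. B (Suc n)) (\<lambda>n. d (Suc n)) (d 0)"
proof -
  note r = free_resolutionD[OF assms]
  have F: "module R (free_module R (B 0))" by (rule free_module_is_module[OF module_cring[OF r(1)]])
  show ?thesis unfolding free_resolution_def
    using kernel_module_is_module[OF F r(1,2)] linear_into_submodule[OF r(4)[of 0]] r(4,5,6)
    by auto
qed

lemma tor_vanishes_shift:
  "tor_vanishes R N B d (Suc (Suc n)) \<Longrightarrow> tor_vanishes R N (\<lambda>n. B (Suc n)) (\<lambda>n. d (Suc n)) (Suc n)"
  unfolding tor_vanishes_def by simp

definition retract_data where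
  "retract_data R B d C c n f g h \<longleftrightarrow>
     linear R (free_module R (B n)) (free_module R (C n)) f \<and>
     linear R (free_module R (C n)) (free_module R (B n)) g \<and>
     linear R (free_module R (B n)) (free_module R (B (Suc n))) h \<and>
     (\<forall>x\<in>carrier (free_module R (B (Suc n))). f (d n x) \<in> c n ` carrier (free_module R (C (Suc n)))) \<and>
     (\<forall>x\<in>carrier (free_module R (C (Suc n))). g (c n x) \<in> d n ` carrier (free_module R (B (Suc n)))) \<and>
     (\<forall>x\<in>carrier (free_module R (B (Suc n))).
        d n x \<ominus>\<^bsub>free_module R (B n)\<^esub> g (f (d n x)) = d n (h (d n x)))"

lemma retract_data_0:
  assumes B: "free_resolution R M B d e" and C: "free_resolution R K C c u"
    and j: "linear R M K j" and p: "linear R K M p" and pj: "\<And>x. x \<in> carrier M \<Longrightarrow> p (j x) = x"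
  obtains f g h where "retract_data R B d C c 0 f g h"
proof -
  note b = free_resolutionD[OF B] and c = free_resolutionD[OF C]
  interpret M: module R M by (rule b(1))
  interpret K: module R K by (rule c(1))
  have FB: "module R (free_module R (B n))" for n by (rule free_module_is_module[OF M.R.is_cring])
  have FC: "module R (free_module R (C n))" for n by (rule free_module_is_module[OF M.R.is_cring])
  interpret F0: module R "free_module R (B 0)" by (rule FB)
  have "j (e x) \<in> u ` carrier (free_module R (C 0))" if "x \<in> carrier (free_module R (B 0))" for x
    using linear_closed[OF j linear_closed[OF b(2) that]] c(3) by simp
  then obtain f where f: "linear R (free_module R (B 0)) (free_module R (C 0)) f"
    "\<And>x. x \<in> carrier (free_module R (B 0)) \<Longrightarrow> u (f x) = j (e x)"
    using free_module_lift[OF c(1) FC linear_compose[OF b(2) j] c(2)] by blast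
  have "p (u x) \<in> e ` carrier (free_module R (B 0))" if "x \<in> carrier (free_module R (C 0))" for x
    using linear_closed[OF p linear_closed[OF c(2) that]] b(3) by simp
  then obtain g where g: "linear R (free_module R (C 0)) (free_module R (B 0)) g"
    "\<And>x. x \<in> carrier (free_module R (C 0)) \<Longrightarrow> e (g x) = p (u x)"
    using free_module_lift[OF b(1) FB linear_compose[OF c(2) p] b(2)] by blast
  let ?\<phi> = "\<lambda>x. x \<ominus>\<^bsub>free_module R (B 0)\<^esub> g (f x)"
  have \<phi>: "linear R (free_module R (B 0)) (free_module R (B 0)) ?\<phi>"
    by (rule linear_diff[OF FB FB linear_id linear_compose[OF f(1) g(1)]])
  have "?\<phi> x \<in> d 0 ` carrier (free_module R (B (Suc 0)))" if x: "x \<in> carrier (free_module R (B 0))" for x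
  proof -
    have gf: "g (f x) \<in> carrier (free_module R (B 0))" by (rule linear_closed[OF g(1) linear_closed[OF f(1) x]])
    have "e (?\<phi> x) = e x \<ominus>\<^bsub>M\<^esub> e (g (f x))"
      using linear_add[OF b(2) x F0.M.a_inv_closed[OF gf]]
        additive_minus[OF F0.abelian_group_axioms M.abelian_group_axioms linear_additive[OF b(2)] gf]
      by (simp add: a_minus_def)
    also have "e (g (f x)) = e x"
      using g(2)[OF linear_closed[OF f(1) x]] f(2)[OF x] pj[OF linear_closed[OF b(2) x]] by simp
    finally have "e (?\<phi> x) = \<zero>\<^bsub>M\<^esub>" using linear_closed[OF b(2) x] by (simp add: a_minus_def M.M.r_neg)
    thus ?thesis unfolding b(5) using linear_closed[OF \<phi> x] by simp
  qed
  then obtain h where h: "linear R (free_module R (B 0)) (free_module R (B (Suc 0))) h"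
    "\<And>x. x \<in> carrier (free_module R (B 0)) \<Longrightarrow> d 0 (h x) = ?\<phi> x"
    using free_module_lift[OF FB FB \<phi> b(4)] by blast
  have im: "d 0 x \<in> carrier (free_module R (B 0))" "e (d 0 x) = \<zero>\<^bsub>M\<^esub>"
    if "x \<in> carrier (free_module R (B (Suc 0)))" for x using that b(5) by auto
  have im': "c 0 x \<in> carrier (free_module R (C 0))" "u (c 0 x) = \<zero>\<^bsub>K\<^esub>"
    if "x \<in> carrier (free_module R (C (Suc 0)))" for x using that c(5) by auto
  have "retract_data R B d C c 0 f g h" unfolding retract_data_def
    using f(1) g(1) h(1) unfolding c(5) b(5)
    using linear_closed[OF f(1) im(1)] f(2)[OF im(1)] im(2) linear_zero[OF b(1) c(1) j]
      linear_closed[OF g(1) im'(1)] g(2)[OF im'(1)] im'(2) linear_zero[OF c(1) b(1) p] h(2)[OF im(1)]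
    by auto
  thus thesis by (rule that)
qed

lemma retract_data_Suc:
  assumes B: "free_resolution R M B d e" and C: "free_resolution R K C c u"
    and P: "retract_data R B d C c n f g h"
  obtains f' g' h' where "retract_data R B d C c (Suc n) f' g' h'"
    "\<And>x. x \<in> carrier (free_module R (B (Suc n))) \<Longrightarrow> c n (f' x) = f (d n x)"
    "\<And>x. x \<in> carrier (free_module R (C (Suc n))) \<Longrightarrow> d n (g' x) = g (c n x)"
    "\<And>x. x \<in> carrier (free_module R (B (Suc n))) \<Longrightarrow>
       x = (g' (f' x) \<oplus>\<^bsub>free_module R (B (Suc n))\<^esub> h (d n x)) \<oplus>\<^bsub>free_module R (B (Suc n))\<^esub> d (Suc n) (h' x)"
proof -
  note b = free_resolutionD[OF B] and c = free_resolutionD[OF C]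
  interpret M: module R M by (rule b(1))
  have FB: "module R (free_module R (B n))" for n by (rule free_module_is_module[OF M.R.is_cring])
  have FC: "module R (free_module R (C n))" for n by (rule free_module_is_module[OF M.R.is_cring])
  interpret F0: module R "free_module R (B n)" by (rule FB)
  interpret F1: module R "free_module R (B (Suc n))" by (rule FB)
  have f: "linear R (free_module R (B n)) (free_module R (C n)) f"
    and g: "linear R (free_module R (C n)) (free_module R (B n)) g"
    and h: "linear R (free_module R (B n)) (free_module R (B (Suc n))) h"
    and fd: "\<And>x. x \<in> carrier (free_module R (B (Suc n))) \<Longrightarrow> f (d n x) \<in> c n ` carrier (free_module R (C (Suc n)))"
    and gc: "\<And>x. x \<in> carrier (free_module R (C (Suc n))) \<Longrightarrow> g (c n x) \<in> d n ` carrier (free_module R (B (Suc n)))"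
    and hd: "\<And>x. x \<in> carrier (free_module R (B (Suc n))) \<Longrightarrow>
        d n x \<ominus>\<^bsub>free_module R (B n)\<^esub> g (f (d n x)) = d n (h (d n x))"
    using P unfolding retract_data_def by auto
  obtain f' where f': "linear R (free_module R (B (Suc n))) (free_module R (C (Suc n))) f'"
    "\<And>x. x \<in> carrier (free_module R (B (Suc n))) \<Longrightarrow> c n (f' x) = f (d n x)"
    using free_module_lift[OF FC FC linear_compose[OF b(4) f] c(4) fd] by blast
  obtain g' where g': "linear R (free_module R (C (Suc n))) (free_module R (B (Suc n))) g'"
    "\<And>x. x \<in> carrier (free_module R (C (Suc n))) \<Longrightarrow> d n (g' x) = g (c n x)"
    using free_module_lift[OF FB FB linear_compose[OF c(4) g] b(4) gc] by blast
  note gf = linear_compose[OF f'(1) g'(1)] and hd_lin = linear_compose[OF b(4)[of n] h]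
  let ?\<phi> = "\<lambda>x. x \<ominus>\<^bsub>free_module R (B (Suc n))\<^esub> (g' (f' x) \<oplus>\<^bsub>free_module R (B (Suc n))\<^esub> h (d n x))"
  have \<phi>: "linear R (free_module R (B (Suc n))) (free_module R (B (Suc n))) ?\<phi>"
    by (rule linear_diff[OF FB FB linear_id linear_add_maps[OF FB FB gf hd_lin]])
  have "?\<phi> x \<in> d (Suc n) ` carrier (free_module R (B (Suc (Suc n))))"
    if x: "x \<in> carrier (free_module R (B (Suc n)))" for x
  proof -
    have k: "g' (f' x) \<in> carrier (free_module R (B (Suc n)))" "h (d n x) \<in> carrier (free_module R (B (Suc n)))"
      using linear_closed[OF gf x] linear_closed[OF hd_lin x] by auto
    have dx: "d n x \<in> carrier (free_module R (B n))" by (rule linear_closed[OF b(4) x])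
    have gfd: "g (f (d n x)) \<in> carrier (free_module R (B n))" by (rule linear_closed[OF g linear_closed[OF f dx]])
    have "d n (?\<phi> x) = d n x \<ominus>\<^bsub>free_module R (B n)\<^esub> d n (g' (f' x) \<oplus>\<^bsub>free_module R (B (Suc n))\<^esub> h (d n x))"
      using linear_add[OF b(4) x F1.M.a_inv_closed[OF F1.M.add.m_closed[OF k]]]
        additive_minus[OF F1.abelian_group_axioms F0.abelian_group_axioms linear_additive[OF b(4)] F1.M.add.m_closed[OF k]]
      by (simp add: a_minus_def)
    also have "d n (g' (f' x) \<oplus>\<^bsub>free_module R (B (Suc n))\<^esub> h (d n x)) =
        g (f (d n x)) \<oplus>\<^bsub>free_module R (B n)\<^esub> (d n x \<ominus>\<^bsub>free_module R (B n)\<^esub> g (f (d n x)))"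
      using linear_add[OF b(4) k] g'(2)[OF linear_closed[OF f'(1) x]] f'(2)[OF x] hd[OF x] by simp
    also have "\<dots> = d n x"
      using dx gfd by (metis F0.M.a_comm F0.M.a_inv_closed a_minus_def F0.M.r_neg2)
    finally have "d n (?\<phi> x) = \<zero>\<^bsub>free_module R (B n)\<^esub>" using dx by (simp add: a_minus_def F0.M.r_neg)
    thus ?thesis unfolding b(6) using linear_closed[OF \<phi> x] by simp
  qed
  then obtain h' where h': "linear R (free_module R (B (Suc n))) (free_module R (B (Suc (Suc n)))) h'"
    "\<And>x. x \<in> carrier (free_module R (B (Suc n))) \<Longrightarrow> d (Suc n) (h' x) = ?\<phi> x"
    using free_module_lift[OF FB FB \<phi> b(4)] by blast
  have eq: "x = (g' (f' x) \<oplus>\<^bsub>free_module R (B (Suc n))\<^esub> h (d n x)) \<oplus>\<^bsub>free_module R (B (Suc n))\<^esub> d (Suc n) (h' x)"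
    if x: "x \<in> carrier (free_module R (B (Suc n)))" for x
  proof -
    have "g' (f' x) \<oplus>\<^bsub>free_module R (B (Suc n))\<^esub> h (d n x) \<in> carrier (free_module R (B (Suc n)))"
      using linear_closed[OF gf x] linear_closed[OF hd_lin x] by (rule F1.M.add.m_closed)
    thus ?thesis unfolding h'(2)[OF x] using x
      by (metis F1.M.a_comm F1.M.a_inv_closed a_minus_def F1.M.r_neg2)
  qed
  have im: "d (Suc n) x \<in> carrier (free_module R (B (Suc n)))" "d n (d (Suc n) x) = \<zero>\<^bsub>free_module R (B n)\<^esub>"
    if "x \<in> carrier (free_module R (B (Suc (Suc n))))" for x using that b(6)[of n] by auto
  have im': "c (Suc n) x \<in> carrier (free_module R (C (Suc n)))" "c n (c (Suc n) x) = \<zero>\<^bsub>free_module R (C n)\<^esub>"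
    if "x \<in> carrier (free_module R (C (Suc (Suc n))))" for x using that c(6)[of n] by auto
  have h0: "h \<zero>\<^bsub>free_module R (B n)\<^esub> = \<zero>\<^bsub>free_module R (B (Suc n))\<^esub>" by (rule linear_zero[OF FB FB h])
  have "retract_data R B d C c (Suc n) f' g' h'" unfolding retract_data_def
  proof (intro conjI ballI f' g' h')
    fix x assume x: "x \<in> carrier (free_module R (B (Suc (Suc n))))"
    show "f' (d (Suc n) x) \<in> c (Suc n) ` carrier (free_module R (C (Suc (Suc n))))"
      unfolding c(6) using linear_closed[OF f'(1) im(1)[OF x]] f'(2)[OF im(1)[OF x]] im(2)[OF x]
        linear_zero[OF FB FC f] by simp
    show "d (Suc n) x \<ominus>\<^bsub>free_module R (B (Suc n))\<^esub> g' (f' (d (Suc n) x)) = d (Suc n) (h' (d (Suc n) x))"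
      unfolding h'(2)[OF im(1)[OF x]] im(2)[OF x] h0
      using linear_closed[OF gf im(1)[OF x]] by simp
  next
    fix x assume x: "x \<in> carrier (free_module R (C (Suc (Suc n))))"
    show "g' (c (Suc n) x) \<in> d (Suc n) ` carrier (free_module R (B (Suc (Suc n))))"
      unfolding b(6) using linear_closed[OF g'(1) im'(1)[OF x]] g'(2)[OF im'(1)[OF x]] im'(2)[OF x]
        linear_zero[OF FC FB g] by simp
  qed
  thus thesis using f'(2) g'(2) eq that by blast
qed

lemma tor_vanishes_retract:
  assumes B: "free_resolution R M B d e" and C: "free_resolution R K C c u"
    and j: "linear R M K j" and p: "linear R K M p" and pj: "\<And>x. x \<in> carrier M \<Longrightarrow> p (j x) = x"
    and N: "module R N" and van: "tor_vanishes R N C c (Suc n)"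
  shows "tor_vanishes R N B d (Suc n)"
proof -
  have "\<exists>f g h. retract_data R B d C c n f g h"
  proof (induction n)
    case 0 show ?case using retract_data_0[OF B C j p pj] by metis
  next
    case (Suc n) then show ?case using retract_data_Suc[OF B C] by metis
  qed
  then obtain f g h where P: "retract_data R B d C c n f g h" by blast
  obtain f' g' h' where P': "retract_data R B d C c (Suc n) f' g' h'"
    and cf: "\<And>x. x \<in> carrier (free_module R (B (Suc n))) \<Longrightarrow> c n (f' x) = f (d n x)"
    and eq: "\<And>x. x \<in> carrier (free_module R (B (Suc n))) \<Longrightarrow>
       x = (g' (f' x) \<oplus>\<^bsub>free_module R (B (Suc n))\<^esub> h (d n x)) \<oplus>\<^bsub>free_module R (B (Suc n))\<^esub> d (Suc n) (h' x)"
    using retract_data_Suc[OF B C P] by metis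
  obtain f'' g'' h'' where P'': "retract_data R B d C c (Suc (Suc n)) f'' g'' h''"
    and dg: "\<And>x. x \<in> carrier (free_module R (C (Suc (Suc n)))) \<Longrightarrow> d (Suc n) (g'' x) = g' (c (Suc n) x)"
    using retract_data_Suc[OF B C P'] by metis
  note b = free_resolutionD[OF B] and c = free_resolutionD[OF C]
  interpret N: module R N by (rule N)
  have FB: "module R (free_module R (B n))" for n by (rule free_module_is_module[OF N.R.is_cring])
  have lin: "linear R (free_module R (B n)) (free_module R (C n)) f"
    "linear R (free_module R (B n)) (free_module R (B (Suc n))) h"
    "linear R (free_module R (B (Suc n))) (free_module R (C (Suc n))) f'"
    "linear R (free_module R (C (Suc n))) (free_module R (B (Suc n))) g'"
    "linear R (free_module R (B (Suc n))) (free_module R (B (Suc (Suc n)))) h'"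
    "linear R (free_module R (C (Suc (Suc n)))) (free_module R (B (Suc (Suc n)))) g''"
    using P P' P'' by (auto simp: retract_data_def)
  let ?E = "extend_scalars R N"
  show ?thesis unfolding tor_vanishes_def
  proof (intro ballI impI)
    fix z assume z: "z \<in> fin_supp N (B (Suc n))"
      and "\<forall>i. Suc n = Suc i \<longrightarrow> ?E (d i) z = (\<lambda>_. \<zero>\<^bsub>N\<^esub>)"
    hence dz: "?E (d n) z = (\<lambda>_. \<zero>\<^bsub>N\<^esub>)" by simp
    have w: "?E f' z \<in> fin_supp N (C (Suc n))" by (rule extend_scalars_closed[OF N lin(3) z])
    have "?E (c n) (?E f' z) = ?E (\<lambda>x. c n (f' x)) z" by (rule extend_scalars_compose[OF N lin(3) c(4) z])
    also have "\<dots> = ?E (\<lambda>x. f (d n x)) z"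
      by (rule extend_scalars_cong[OF N linear_compose[OF b(4) lin(1)] z cf])
    also have "\<dots> = ?E f (?E (d n) z)" by (rule extend_scalars_compose[OF N b(4) lin(1) z, symmetric])
    also have "\<dots> = (\<lambda>_. \<zero>\<^bsub>N\<^esub>)" unfolding dz by (rule extend_scalars_zero[OF N])
    finally obtain y where y: "y \<in> fin_supp N (C (Suc (Suc n)))" "?E (c (Suc n)) y = ?E f' z"
      using van w unfolding tor_vanishes_def by blast
    have gy: "?E g'' y \<in> fin_supp N (B (Suc (Suc n)))" by (rule extend_scalars_closed[OF N lin(6) y(1)])
    have hz: "?E h' z \<in> fin_supp N (B (Suc (Suc n)))" by (rule extend_scalars_closed[OF N lin(5) z])
    have "?E (d (Suc n)) (?E g'' y) = ?E (\<lambda>x. d (Suc n) (g'' x)) y"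
      by (rule extend_scalars_compose[OF N lin(6) b(4) y(1)])
    also have "\<dots> = ?E (\<lambda>x. g' (c (Suc n) x)) y"
      by (rule extend_scalars_cong[OF N linear_compose[OF c(4) lin(4)] y(1) dg])
    also have "\<dots> = ?E g' (?E f' z)" unfolding y(2)[symmetric]
      by (rule extend_scalars_compose[OF N c(4) lin(4) y(1), symmetric])
    also have "\<dots> = ?E (\<lambda>x. g' (f' x)) z" by (rule extend_scalars_compose[OF N lin(3,4) z])
    finally have 1: "?E (d (Suc n)) (?E g'' y) = ?E (\<lambda>x. g' (f' x)) z" .
    have 2: "?E (\<lambda>x. h (d n x)) z = (\<lambda>_. \<zero>\<^bsub>N\<^esub>)"
      using extend_scalars_compose[OF N b(4) lin(2) z] by (simp add: dz extend_scalars_zero[OF N])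
    have 3: "?E (\<lambda>x. d (Suc n) (h' x)) z = ?E (d (Suc n)) (?E h' z)"
      by (rule extend_scalars_compose[OF N lin(5) b(4) z, symmetric])
    note l1 = linear_compose[OF lin(3,4)] and l2 = linear_compose[OF b(4)[of n] lin(2)]
      and l3 = linear_compose[OF lin(5) b(4)[of "Suc n"]]
    note l12 = linear_add_maps[OF FB FB l1 l2]
    have "z = ?E (\<lambda>x. x) z" by (rule extend_scalars_id[OF N z, symmetric])
    also have "\<dots> = ?E (\<lambda>x. (g' (f' x) \<oplus>\<^bsub>free_module R (B (Suc n))\<^esub> h (d n x)) \<oplus>\<^bsub>free_module R (B (Suc n))\<^esub> d (Suc n) (h' x)) z"
      by (rule extend_scalars_cong[OF N linear_add_maps[OF FB FB l12 l3] z eq])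
    also have "\<dots> = (\<lambda>b. (?E (d (Suc n)) (?E g'' y) b \<oplus>\<^bsub>N\<^esub> \<zero>\<^bsub>N\<^esub>) \<oplus>\<^bsub>N\<^esub> ?E (d (Suc n)) (?E h' z) b)"
      unfolding extend_scalars_add_maps[OF N l12 l3 z] extend_scalars_add_maps[OF N l1 l2 z] 1 2 3 ..
    also have "\<dots> = (\<lambda>b. ?E (d (Suc n)) (?E g'' y) b \<oplus>\<^bsub>N\<^esub> ?E (d (Suc n)) (?E h' z) b)"
      using fin_suppD(1)[OF extend_scalars_closed[OF N b(4) gy]] by simp
    also have "\<dots> = ?E (d (Suc n)) (\<lambda>b. ?E g'' y b \<oplus>\<^bsub>N\<^esub> ?E h' z b)"
      by (rule extend_scalars_add[OF N b(4) gy hz, symmetric])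
    finally have "?E (d (Suc n)) (\<lambda>b. ?E g'' y b \<oplus>\<^bsub>N\<^esub> ?E h' z b) = z" ..
    thus "\<exists>h\<in>fin_supp N (B (Suc (Suc n))). ?E (d (Suc n)) h = z"
      using fin_supp_add[OF N.abelian_group_axioms gy hz] by blast
  qed
qed

section \<open>Tensor products with free modules and Tor\<close>

lemma linear_minus:
  assumes "module R M" "module R N" "linear R M N f" "x \<in> carrier M" "y \<in> carrier M"
  shows "f (x \<ominus>\<^bsub>M\<^esub> y) = f x \<ominus>\<^bsub>N\<^esub> f y"
proof -
  interpret M: module R M by fact
  interpret N: module R N by fact
  show ?thesis unfolding a_minus_def
    using linear_add[OF assms(3,4) M.M.a_inv_closed[OF assms(5)]]
      additive_minus[OF M.abelian_group_axioms N.abelian_group_axioms linear_additive[OF assms(3)] assms(5)]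
    by simp
qed

lemma submodule_abelian_subgroup:
  assumes "module R M" "submodule H R M"
  shows "abelian_subgroup H M"
proof -
  interpret M: module R M by fact
  show ?thesis
    by (rule abelian_subgroupI3[OF additive_subgroupI[OF submodule.axioms(1)[OF assms(2)]] M.abelian_group_axioms])
qed

lemma quotient_module_simps:
  "carrier (quotient_module M H) = a_rcosets\<^bsub>M\<^esub> H" "\<zero>\<^bsub>quotient_module M H\<^esub> = H"
  "add (quotient_module M H) = set_add M"
  by (simp_all add: quotient_module_def)

lemma quotient_module_smult:
  assumes M: "module R M" and H: "submodule H R M" and r: "r \<in> carrier R" and x: "x \<in> carrier M"
  shows "r \<odot>\<^bsub>quotient_module M H\<^esub> (H +>\<^bsub>M\<^esub> x) = H +>\<^bsub>M\<^esub> (r \<odot>\<^bsub>M\<^esub> x)"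
proof -
  interpret M: module R M by fact
  interpret H: abelian_subgroup H M by (rule submodule_abelian_subgroup[OF M H])
  have "H +>\<^bsub>M\<^esub> (r \<odot>\<^bsub>M\<^esub> c) = H +>\<^bsub>M\<^esub> (r \<odot>\<^bsub>M\<^esub> x)" if c: "c \<in> H +>\<^bsub>M\<^esub> x" for c
  proof -
    obtain h where h: "h \<in> H" "c = h \<oplus>\<^bsub>M\<^esub> x" using c by (auto simp: a_r_coset_def')
    have "r \<odot>\<^bsub>M\<^esub> c = r \<odot>\<^bsub>M\<^esub> h \<oplus>\<^bsub>M\<^esub> r \<odot>\<^bsub>M\<^esub> x" using h r x by (simp add: M.smult_r_distr)
    moreover have "r \<odot>\<^bsub>M\<^esub> h \<in> H" using submodule.smult_closed[OF H r h(1)] .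
    ultimately have "r \<odot>\<^bsub>M\<^esub> c \<in> H +>\<^bsub>M\<^esub> (r \<odot>\<^bsub>M\<^esub> x)" by (auto simp: a_r_coset_def')
    from H.a_repr_independence'[OF this] r x show ?thesis by simp
  qed
  hence "(\<Union>c\<in>H +>\<^bsub>M\<^esub> x. H +>\<^bsub>M\<^esub> (r \<odot>\<^bsub>M\<^esub> c)) = (\<Union>c\<in>H +>\<^bsub>M\<^esub> x. H +>\<^bsub>M\<^esub> (r \<odot>\<^bsub>M\<^esub> x))"
    by (rule SUP_cong[OF refl])
  also have "\<dots> = H +>\<^bsub>M\<^esub> (r \<odot>\<^bsub>M\<^esub> x)" using H.a_rcos_self[OF x] by blast
  finally show ?thesis by (simp add: quotient_module_def)
qed

lemma quotient_module_is_module: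
  assumes M: "module R M" and H: "submodule H R M"
  shows "module R (quotient_module M H)"
proof -
  interpret M: module R M by fact
  interpret H: abelian_subgroup H M by (rule submodule_abelian_subgroup[OF M H])
  let ?Q = "quotient_module M H"
  have H0: "H = H +>\<^bsub>M\<^esub> \<zero>\<^bsub>M\<^esub>" using M.a_coset_add_zero H.a_subset by metis
  have add: "(H +>\<^bsub>M\<^esub> x) \<oplus>\<^bsub>?Q\<^esub> (H +>\<^bsub>M\<^esub> y) = H +>\<^bsub>M\<^esub> (x \<oplus>\<^bsub>M\<^esub> y)"
    if "x \<in> carrier M" "y \<in> carrier M" for x y
    using H.a_rcos_sum[OF that] by (simp add: quotient_module_simps)
  have rep: "\<exists>x\<in>carrier M. C = H +>\<^bsub>M\<^esub> x" if "C \<in> carrier ?Q" for C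
    using that by (auto simp: quotient_module_simps A_RCOSETS_def')
  have cl: "H +>\<^bsub>M\<^esub> x \<in> carrier ?Q" if "x \<in> carrier M" for x
    using that by (auto simp: quotient_module_simps A_RCOSETS_def')
  have z: "\<zero>\<^bsub>?Q\<^esub> = H +>\<^bsub>M\<^esub> \<zero>\<^bsub>M\<^esub>" using H0 by (simp add: quotient_module_simps)
  note sm = quotient_module_smult[OF M H]
  show ?thesis
  proof (rule moduleI[OF M.R.is_cring])
    show "abelian_group ?Q"
    proof (rule abelian_groupI)
      show "\<zero>\<^bsub>?Q\<^esub> \<in> carrier ?Q" unfolding z by (rule cl) simp
      fix C assume C: "C \<in> carrier ?Q"
      then obtain x where x: "x \<in> carrier M" "C = H +>\<^bsub>M\<^esub> x" using rep[OF C] by blast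
      show "\<zero>\<^bsub>?Q\<^esub> \<oplus>\<^bsub>?Q\<^esub> C = C" unfolding z x(2) using x(1) by (simp add: add)
      show "\<exists>y\<in>carrier ?Q. y \<oplus>\<^bsub>?Q\<^esub> C = \<zero>\<^bsub>?Q\<^esub>"
        by (rule bexI[OF _ cl[OF M.M.a_inv_closed[OF x(1)]]]) (use x in \<open>simp add: add z M.M.l_neg\<close>)
      fix D assume D: "D \<in> carrier ?Q"
      then obtain y where y: "y \<in> carrier M" "D = H +>\<^bsub>M\<^esub> y" using rep[OF D] by blast
      show "C \<oplus>\<^bsub>?Q\<^esub> D \<in> carrier ?Q" unfolding x y add[OF x(1) y(1)] using x y by (intro cl) simp
      show "C \<oplus>\<^bsub>?Q\<^esub> D = D \<oplus>\<^bsub>?Q\<^esub> C" unfolding x y using x y by (simp add: add M.M.a_comm)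
      fix E assume E: "E \<in> carrier ?Q"
      then obtain w where w: "w \<in> carrier M" "E = H +>\<^bsub>M\<^esub> w" using rep[OF E] by blast
      show "C \<oplus>\<^bsub>?Q\<^esub> D \<oplus>\<^bsub>?Q\<^esub> E = C \<oplus>\<^bsub>?Q\<^esub> (D \<oplus>\<^bsub>?Q\<^esub> E)" unfolding x y w
        using x y w by (simp add: add M.M.a_assoc)
    qed
  next
    fix r s C D assume r: "r \<in> carrier R" and C: "C \<in> carrier ?Q"
    obtain x where x: "x \<in> carrier M" "C = H +>\<^bsub>M\<^esub> x" using rep[OF C] by blast
    show "r \<odot>\<^bsub>?Q\<^esub> C \<in> carrier ?Q" using r x by (simp add: sm cl)
    show "(r \<oplus>\<^bsub>R\<^esub> s) \<odot>\<^bsub>?Q\<^esub> C = r \<odot>\<^bsub>?Q\<^esub> C \<oplus>\<^bsub>?Q\<^esub> s \<odot>\<^bsub>?Q\<^esub> C" if "s \<in> carrier R"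
      using r x that by (simp add: sm add M.smult_l_distr)
    show "(r \<otimes>\<^bsub>R\<^esub> s) \<odot>\<^bsub>?Q\<^esub> C = r \<odot>\<^bsub>?Q\<^esub> (s \<odot>\<^bsub>?Q\<^esub> C)" if "s \<in> carrier R"
      using r x that by (simp add: sm M.smult_assoc1)
    show "r \<odot>\<^bsub>?Q\<^esub> (C \<oplus>\<^bsub>?Q\<^esub> D) = r \<odot>\<^bsub>?Q\<^esub> C \<oplus>\<^bsub>?Q\<^esub> r \<odot>\<^bsub>?Q\<^esub> D" if D: "D \<in> carrier ?Q"
    proof -
      obtain y where "y \<in> carrier M" "D = H +>\<^bsub>M\<^esub> y" using rep[OF D] by blast
      thus ?thesis using r x by (simp add: sm add M.smult_r_distr)
    qed
  next
    fix C assume C: "C \<in> carrier ?Q"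
    then obtain x where x: "x \<in> carrier M" "C = H +>\<^bsub>M\<^esub> x" using rep[OF C] by blast
    show "\<one>\<^bsub>R\<^esub> \<odot>\<^bsub>?Q\<^esub> C = C" using x by (simp add: sm)
  qed
qed

lemma linear_quotient:
  assumes M: "module R M" and H: "submodule H R M"
  shows "linear R M (quotient_module M H) (\<lambda>x. H +>\<^bsub>M\<^esub> x)"
proof -
  interpret M: module R M by fact
  interpret H: abelian_subgroup H M by (rule submodule_abelian_subgroup[OF M H])
  show ?thesis
  proof (rule linearI)
    fix x assume x: "x \<in> carrier M"
    show "H +>\<^bsub>M\<^esub> x \<in> carrier (quotient_module M H)"
      using x by (auto simp: quotient_module_simps A_RCOSETS_def')
    show "H +>\<^bsub>M\<^esub> (x \<oplus>\<^bsub>M\<^esub> y) = (H +>\<^bsub>M\<^esub> x) \<oplus>\<^bsub>quotient_module M H\<^esub> (H +>\<^bsub>M\<^esub> y)"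
      if "y \<in> carrier M" for y using H.a_rcos_sum[OF x that] by (simp add: quotient_module_simps)
    show "H +>\<^bsub>M\<^esub> (r \<odot>\<^bsub>M\<^esub> x) = r \<odot>\<^bsub>quotient_module M H\<^esub> (H +>\<^bsub>M\<^esub> x)" if "r \<in> carrier R" for r
      by (rule quotient_module_smult[OF M H that x, symmetric])
  qed
qed

lemma quotient_eq_zero_iff:
  assumes M: "module R M" and H: "submodule H R M" and x: "x \<in> carrier M"
  shows "H +>\<^bsub>M\<^esub> x = H \<longleftrightarrow> x \<in> H"
proof -
  interpret M: module R M by fact
  interpret H: abelian_subgroup H M by (rule submodule_abelian_subgroup[OF M H])
  show ?thesis using H.a_rcos_self[OF x] H.a_rcos_const by metis
qed

lemma span_module_submodule:
  assumes M: "module R M" and A: "A \<subseteq> carrier M"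
  shows "submodule (span_module R M A) R M"
proof -
  interpret M: module R M by fact
  let ?T = "{H. submodule H R M \<and> A \<subseteq> H}"
  have c: "carrier M \<in> ?T" using M.carrier_is_submodule A by simp
  have eq: "span_module R M A = \<Inter>?T" by (simp add: span_module_def hull_def)
  note E = M.submoduleE
  show ?thesis unfolding eq
  proof (rule M.submoduleI)
    show "\<Inter>?T \<subseteq> carrier M" using c by blast
    show "\<zero>\<^bsub>M\<^esub> \<in> \<Inter>?T"
    proof (rule InterI)
      fix H assume "H \<in> ?T"
      hence "subgroup H (add_monoid M)" by (auto dest: submodule.axioms(1))
      from subgroup.one_closed[OF this] show "\<zero>\<^bsub>M\<^esub> \<in> H" by simp
    qed
  qed (use E in auto)
qed

text \<open>
  The coordinates of the element of \<open>F \<otimes> N = N\<^bsup>(B)\<^esup>\<close> represented by a formal combination \<open>p\<close> of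
  pairs, where \<open>F\<close> is free on \<open>B\<close>.
\<close>

definition tensor_coord ::
  "('a, 'm) ring_scheme \<Rightarrow> ('a, 'c, 'n) module_scheme \<Rightarrow> (('g \<Rightarrow> 'a) \<times> 'c \<Rightarrow> 'a) \<Rightarrow> 'g \<Rightarrow> 'c" where
  "tensor_coord R N p b = linear_ext R N (\<lambda>(f, y). f b \<odot>\<^bsub>N\<^esub> y) p"

context
  fixes R :: "('a, 'm) ring_scheme" and N :: "('a, 'c) module"
  assumes N: "module R N"
begin

interpretation N: module R N by (rule N)

abbreviation (input) "FF B \<equiv> free_module R B"
abbreviation (input) "PP B \<equiv> free_module R (carrier (FF B) \<times> carrier N)"
abbreviation (input) "UU B \<equiv> tensor_rels R (FF B) N"

lemma tensor_coord_linear: "linear R (PP B) N (\<lambda>p. tensor_coord R N p b)"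
  unfolding tensor_coord_def
  by (rule linear_ext_linear[OF N]) (auto simp: free_module_def)

lemma tensor_coord_basis:
  assumes "f \<in> carrier (FF B)" "y \<in> carrier N"
  shows "tensor_coord R N (basis_elem R (f, y)) b = f b \<odot>\<^bsub>N\<^esub> y"
  unfolding tensor_coord_def
  by (subst linear_ext_basis[OF N, of "(f, y)" "carrier (FF B) \<times> carrier N"])
     (use assms in \<open>auto simp: free_module_def\<close>)

lemma tensor_coord_fin_supp:
  assumes p: "p \<in> carrier (PP B)"
  shows "tensor_coord R N p \<in> fin_supp N B"
proof (rule fin_suppI)
  let ?T = "{x. p x \<noteq> \<zero>\<^bsub>R\<^esub>}"
  let ?S = "\<Union>x\<in>?T. {b. fst x b \<noteq> \<zero>\<^bsub>R\<^esub>}"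
  have T: "finite ?T" "?T \<subseteq> carrier (FF B) \<times> carrier N"
    using free_module_finite[OF p] free_module_support[OF p] .
  have x: "fst x \<in> carrier (FF B)" "snd x \<in> carrier N" if "x \<in> ?T" for x using T(2) that by auto
  show "finite ?S" using T(1) free_module_finite[OF x(1)] by blast
  show "?S \<subseteq> B" using free_module_support[OF x(1)] by blast
  show "tensor_coord R N p b \<in> carrier N" for b
    by (rule linear_closed[OF tensor_coord_linear p])
  show "tensor_coord R N p b = \<zero>\<^bsub>N\<^esub>" if "b \<notin> ?S" for b
    unfolding tensor_coord_def linear_ext_def
    by (rule N.M.add.finprod_one_eqI[unfolded finsum_def[symmetric], simplified])
       (use that x(2) free_module_closed[OF p] in \<open>auto split: prod.splits\<close>)
qed

lemma PP_module: "module R (PP B)"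
  by (rule free_module_is_module[OF N.R.is_cring])

lemma FF_module: "module R (FF B)"
  by (rule free_module_is_module[OF N.R.is_cring])

lemma PP_basis: "f \<in> carrier (FF B) \<Longrightarrow> y \<in> carrier N \<Longrightarrow> basis_elem R (f, y) \<in> carrier (PP B)"
  by (rule basis_elem_closed[OF N.R.is_cring]) simp

definition tensor_gens where
  "tensor_gens B = (let e = basis_elem R in
     {e (x \<oplus>\<^bsub>FF B\<^esub> x', y) \<ominus>\<^bsub>PP B\<^esub> (e (x, y) \<oplus>\<^bsub>PP B\<^esub> e (x', y)) |x x' y.
        x \<in> carrier (FF B) \<and> x' \<in> carrier (FF B) \<and> y \<in> carrier N} \<union>
     {e (x, y \<oplus>\<^bsub>N\<^esub> y') \<ominus>\<^bsub>PP B\<^esub> (e (x, y) \<oplus>\<^bsub>PP B\<^esub> e (x, y')) |x y y'.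
        x \<in> carrier (FF B) \<and> y \<in> carrier N \<and> y' \<in> carrier N} \<union>
     {e (r \<odot>\<^bsub>FF B\<^esub> x, y) \<ominus>\<^bsub>PP B\<^esub> (r \<odot>\<^bsub>PP B\<^esub> e (x, y)) |r x y.
        r \<in> carrier R \<and> x \<in> carrier (FF B) \<and> y \<in> carrier N} \<union>
     {e (x, r \<odot>\<^bsub>N\<^esub> y) \<ominus>\<^bsub>PP B\<^esub> (r \<odot>\<^bsub>PP B\<^esub> e (x, y)) |r x y.
        r \<in> carrier R \<and> x \<in> carrier (FF B) \<and> y \<in> carrier N})"

lemma tensor_rels_span: "UU B = span_module R (PP B) (tensor_gens B)"
  unfolding tensor_rels_def tensor_gens_def Let_def by (rule refl)

lemma tensor_gensE:
  assumes "a \<in> tensor_gens B"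
  obtains x x' y where "x \<in> carrier (FF B)" "x' \<in> carrier (FF B)" "y \<in> carrier N"
    "a = basis_elem R (x \<oplus>\<^bsub>FF B\<^esub> x', y) \<ominus>\<^bsub>PP B\<^esub> (basis_elem R (x, y) \<oplus>\<^bsub>PP B\<^esub> basis_elem R (x', y))"
  | x y y' where "x \<in> carrier (FF B)" "y \<in> carrier N" "y' \<in> carrier N"
    "a = basis_elem R (x, y \<oplus>\<^bsub>N\<^esub> y') \<ominus>\<^bsub>PP B\<^esub> (basis_elem R (x, y) \<oplus>\<^bsub>PP B\<^esub> basis_elem R (x, y'))"
  | r x y where "r \<in> carrier R" "x \<in> carrier (FF B)" "y \<in> carrier N"
    "a = basis_elem R (r \<odot>\<^bsub>FF B\<^esub> x, y) \<ominus>\<^bsub>PP B\<^esub> (r \<odot>\<^bsub>PP B\<^esub> basis_elem R (x, y))"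
  | r x y where "r \<in> carrier R" "x \<in> carrier (FF B)" "y \<in> carrier N"
    "a = basis_elem R (x, r \<odot>\<^bsub>N\<^esub> y) \<ominus>\<^bsub>PP B\<^esub> (r \<odot>\<^bsub>PP B\<^esub> basis_elem R (x, y))"
  using assms unfolding tensor_gens_def Let_def
  apply (elim UnE CollectE exE conjE)
  subgoal for x x' y by (rule that(1)[of x x' y])
  subgoal for x y y' by (rule that(2)[of x y y'])
  subgoal for r x y by (rule that(3)[of r x y])
  subgoal for r x y by (rule that(4)[of r x y])
  done

lemma tensor_gens_coord:
  assumes "a \<in> tensor_gens B"
  shows "a \<in> carrier (PP B) \<and> tensor_coord R N a b = \<zero>\<^bsub>N\<^esub>"
proof -
  let ?F = "FF B" and ?P = "PP B"
  let ?e = "basis_elem R :: ('d \<Rightarrow> 'a) \<times> 'c \<Rightarrow> _"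
  interpret F: module R ?F by (rule FF_module)
  interpret P: module R ?P by (rule PP_module)
  note lin = tensor_coord_linear[of B b]
  note mi = linear_minus[OF PP_module N lin] and ad = linear_add[OF lin] and sm = linear_smult[OF lin]
  note e = PP_basis[of _ B] and te = tensor_coord_basis[of _ B]
  have diff: "p \<ominus>\<^bsub>?P\<^esub> q \<in> carrier ?P \<and> tensor_coord R N (p \<ominus>\<^bsub>?P\<^esub> q) b = \<zero>\<^bsub>N\<^esub>"
    if "p \<in> carrier ?P" "q \<in> carrier ?P" "tensor_coord R N p b = tensor_coord R N q b" for p q
    using mi[OF that(1,2)] that linear_closed[OF lin that(2)] P.M.minus_closed[OF that(1,2)]
    by (simp add: a_minus_def N.M.r_neg)
  from assms show ?thesis
  proof (cases rule: tensor_gensE)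
    case (1 x x' y)
    note fc = free_module_closed[OF 1(1), of b] free_module_closed[OF 1(2), of b]
    show ?thesis unfolding 1(4)
    proof (rule diff)
      show "?e (x \<oplus>\<^bsub>?F\<^esub> x', y) \<in> carrier ?P" by (rule e[OF F.M.add.m_closed[OF 1(1,2)] 1(3)])
      show "?e (x, y) \<oplus>\<^bsub>?P\<^esub> ?e (x', y) \<in> carrier ?P" by (rule P.M.add.m_closed[OF e[OF 1(1,3)] e[OF 1(2,3)]])
      show "tensor_coord R N (?e (x \<oplus>\<^bsub>?F\<^esub> x', y)) b = tensor_coord R N (?e (x, y) \<oplus>\<^bsub>?P\<^esub> ?e (x', y)) b"
        unfolding ad[OF e[OF 1(1,3)] e[OF 1(2,3)]] te[OF F.M.add.m_closed[OF 1(1,2)] 1(3)] te[OF 1(1,3)] te[OF 1(2,3)]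
        using fc 1(3) by (simp add: free_module_add N.smult_l_distr)
    qed
  next
    case (2 x y y')
    note fc = free_module_closed[OF 2(1), of b]
    show ?thesis unfolding 2(4)
    proof (rule diff)
      show "?e (x, y \<oplus>\<^bsub>N\<^esub> y') \<in> carrier ?P" by (rule e[OF 2(1) N.M.add.m_closed[OF 2(2,3)]])
      show "?e (x, y) \<oplus>\<^bsub>?P\<^esub> ?e (x, y') \<in> carrier ?P" by (rule P.M.add.m_closed[OF e[OF 2(1,2)] e[OF 2(1,3)]])
      show "tensor_coord R N (?e (x, y \<oplus>\<^bsub>N\<^esub> y')) b = tensor_coord R N (?e (x, y) \<oplus>\<^bsub>?P\<^esub> ?e (x, y')) b"
        unfolding ad[OF e[OF 2(1,2)] e[OF 2(1,3)]] te[OF 2(1) N.M.add.m_closed[OF 2(2,3)]] te[OF 2(1,2)] te[OF 2(1,3)]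
        by (rule N.smult_r_distr[OF fc 2(2,3)])
    qed
  next
    case (3 r x y)
    note fc = free_module_closed[OF 3(2), of b]
    show ?thesis unfolding 3(4)
    proof (rule diff)
      show "?e (r \<odot>\<^bsub>?F\<^esub> x, y) \<in> carrier ?P" by (rule e[OF F.smult_closed[OF 3(1,2)] 3(3)])
      show "r \<odot>\<^bsub>?P\<^esub> ?e (x, y) \<in> carrier ?P" by (rule P.smult_closed[OF 3(1) e[OF 3(2,3)]])
      show "tensor_coord R N (?e (r \<odot>\<^bsub>?F\<^esub> x, y)) b = tensor_coord R N (r \<odot>\<^bsub>?P\<^esub> ?e (x, y)) b"
        unfolding sm[OF 3(1) e[OF 3(2,3)]] te[OF F.smult_closed[OF 3(1,2)] 3(3)] te[OF 3(2,3)] free_module_smult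
        by (rule N.smult_assoc1[OF 3(1) fc 3(3)])
    qed
  next
    case (4 r x y)
    note fc = free_module_closed[OF 4(2), of b]
    show ?thesis unfolding 4(4)
    proof (rule diff)
      show "?e (x, r \<odot>\<^bsub>N\<^esub> y) \<in> carrier ?P" by (rule e[OF 4(2) N.smult_closed[OF 4(1,3)]])
      show "r \<odot>\<^bsub>?P\<^esub> ?e (x, y) \<in> carrier ?P" by (rule P.smult_closed[OF 4(1) e[OF 4(2,3)]])
      show "tensor_coord R N (?e (x, r \<odot>\<^bsub>N\<^esub> y)) b = tensor_coord R N (r \<odot>\<^bsub>?P\<^esub> ?e (x, y)) b"
        unfolding sm[OF 4(1) e[OF 4(2,3)]] te[OF 4(2) N.smult_closed[OF 4(1,3)]] te[OF 4(2,3)]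
        using N.smult_assoc1[OF 4(1) fc 4(3)] N.smult_assoc1[OF fc 4(1,3)] N.R.m_comm[OF 4(1) fc] by simp
    qed
  qed
qed

lemma tensor_rels_submodule: "submodule (UU B) R (PP B)"
  unfolding tensor_rels_span
  by (rule span_module_submodule[OF PP_module], rule subsetI, simp add: tensor_gens_coord)

lemma tensor_rels_coord:
  assumes "p \<in> UU B" shows "tensor_coord R N p b = \<zero>\<^bsub>N\<^esub>"
proof -
  have "span_module R (PP B) (tensor_gens B) \<subseteq> {p \<in> carrier (PP B). tensor_coord R N p b = \<zero>\<^bsub>N\<^esub>}"
    unfolding span_module_def
    by (rule hull_minimal[where S = "\<lambda>H. submodule H R (PP B)", OF _ kernel_submodule[OF PP_module N tensor_coord_linear]])
       (rule subsetI, simp add: tensor_gens_coord)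
  thus ?thesis using assms unfolding tensor_rels_span by blast
qed

definition pure_tensor where
  "pure_tensor B f y = UU B +>\<^bsub>PP B\<^esub> basis_elem R (f, y)"

lemma pure_tensor_eqI:
  assumes "p \<ominus>\<^bsub>PP B\<^esub> p' \<in> tensor_gens B" "p \<in> carrier (PP B)" "p' \<in> carrier (PP B)"
  shows "UU B +>\<^bsub>PP B\<^esub> p = UU B +>\<^bsub>PP B\<^esub> p'"
proof -
  interpret P: module R "PP B" by (rule PP_module)
  interpret U: abelian_subgroup "UU B" "PP B" by (rule submodule_abelian_subgroup[OF PP_module tensor_rels_submodule])
  have "p \<ominus>\<^bsub>PP B\<^esub> p' \<in> UU B" unfolding tensor_rels_span span_module_def
    by (rule subsetD[OF hull_subset assms(1)])
  hence "p \<in> UU B +>\<^bsub>PP B\<^esub> p'" using U.a_rcos_module[OF assms(3,2)] by (simp add: a_minus_def)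
  from U.a_repr_independence'[OF this assms(3)] show ?thesis ..
qed

lemma pure_tensor_rules:
  fixes B :: "'g set"
  defines "Q \<equiv> quotient_module (PP B) (UU B)"
  shows "x \<in> carrier (FF B) \<Longrightarrow> y \<in> carrier N \<Longrightarrow> pure_tensor B x y \<in> carrier Q"
    and "x \<in> carrier (FF B) \<Longrightarrow> x' \<in> carrier (FF B) \<Longrightarrow> y \<in> carrier N \<Longrightarrow>
      pure_tensor B (x \<oplus>\<^bsub>FF B\<^esub> x') y = pure_tensor B x y \<oplus>\<^bsub>Q\<^esub> pure_tensor B x' y"
    and "x \<in> carrier (FF B) \<Longrightarrow> y \<in> carrier N \<Longrightarrow> y' \<in> carrier N \<Longrightarrow>
      pure_tensor B x (y \<oplus>\<^bsub>N\<^esub> y') = pure_tensor B x y \<oplus>\<^bsub>Q\<^esub> pure_tensor B x y'"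
    and "r \<in> carrier R \<Longrightarrow> x \<in> carrier (FF B) \<Longrightarrow> y \<in> carrier N \<Longrightarrow>
      pure_tensor B (r \<odot>\<^bsub>FF B\<^esub> x) y = r \<odot>\<^bsub>Q\<^esub> pure_tensor B x y"
    and "r \<in> carrier R \<Longrightarrow> x \<in> carrier (FF B) \<Longrightarrow> y \<in> carrier N \<Longrightarrow>
      pure_tensor B x (r \<odot>\<^bsub>N\<^esub> y) = r \<odot>\<^bsub>Q\<^esub> pure_tensor B x y"
proof -
  let ?F = "FF B" and ?P = "PP B"
  let ?e = "basis_elem R :: ('g \<Rightarrow> 'a) \<times> 'c \<Rightarrow> _"
  interpret F: module R ?F by (rule FF_module)
  interpret P: module R ?P by (rule PP_module)
  note q = linear_quotient[OF PP_module tensor_rels_submodule, of B, folded Q_def]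
  note e = PP_basis[of _ B]
  show "pure_tensor B x y \<in> carrier Q" if "x \<in> carrier ?F" "y \<in> carrier N"
    unfolding pure_tensor_def by (rule linear_closed[OF q e[OF that]])
  show "pure_tensor B (x \<oplus>\<^bsub>?F\<^esub> x') y = pure_tensor B x y \<oplus>\<^bsub>Q\<^esub> pure_tensor B x' y"
    if x: "x \<in> carrier ?F" "x' \<in> carrier ?F" "y \<in> carrier N"
    unfolding pure_tensor_def linear_add[OF q e[OF x(1,3)] e[OF x(2,3)], symmetric]
  proof (rule pure_tensor_eqI)
    show "?e (x \<oplus>\<^bsub>?F\<^esub> x', y) \<ominus>\<^bsub>?P\<^esub> (?e (x, y) \<oplus>\<^bsub>?P\<^esub> ?e (x', y)) \<in> tensor_gens B"
      unfolding tensor_gens_def Let_def using x by blast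
    show "?e (x \<oplus>\<^bsub>?F\<^esub> x', y) \<in> carrier ?P" by (rule e[OF F.M.add.m_closed[OF x(1,2)] x(3)])
    show "?e (x, y) \<oplus>\<^bsub>?P\<^esub> ?e (x', y) \<in> carrier ?P" by (rule P.M.add.m_closed[OF e[OF x(1,3)] e[OF x(2,3)]])
  qed
  show "pure_tensor B x (y \<oplus>\<^bsub>N\<^esub> y') = pure_tensor B x y \<oplus>\<^bsub>Q\<^esub> pure_tensor B x y'"
    if x: "x \<in> carrier ?F" "y \<in> carrier N" "y' \<in> carrier N"
    unfolding pure_tensor_def linear_add[OF q e[OF x(1,2)] e[OF x(1,3)], symmetric]
  proof (rule pure_tensor_eqI)
    show "?e (x, y \<oplus>\<^bsub>N\<^esub> y') \<ominus>\<^bsub>?P\<^esub> (?e (x, y) \<oplus>\<^bsub>?P\<^esub> ?e (x, y')) \<in> tensor_gens B"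
      unfolding tensor_gens_def Let_def using x by blast
    show "?e (x, y \<oplus>\<^bsub>N\<^esub> y') \<in> carrier ?P" by (rule e[OF x(1) N.M.add.m_closed[OF x(2,3)]])
    show "?e (x, y) \<oplus>\<^bsub>?P\<^esub> ?e (x, y') \<in> carrier ?P" by (rule P.M.add.m_closed[OF e[OF x(1,2)] e[OF x(1,3)]])
  qed
  show "pure_tensor B (r \<odot>\<^bsub>?F\<^esub> x) y = r \<odot>\<^bsub>Q\<^esub> pure_tensor B x y"
    if x: "r \<in> carrier R" "x \<in> carrier ?F" "y \<in> carrier N"
    unfolding pure_tensor_def linear_smult[OF q x(1) e[OF x(2,3)], symmetric]
  proof (rule pure_tensor_eqI)
    show "?e (r \<odot>\<^bsub>?F\<^esub> x, y) \<ominus>\<^bsub>?P\<^esub> (r \<odot>\<^bsub>?P\<^esub> ?e (x, y)) \<in> tensor_gens B"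
      unfolding tensor_gens_def Let_def using x by blast
    show "?e (r \<odot>\<^bsub>?F\<^esub> x, y) \<in> carrier ?P" by (rule e[OF F.smult_closed[OF x(1,2)] x(3)])
    show "r \<odot>\<^bsub>?P\<^esub> ?e (x, y) \<in> carrier ?P" by (rule P.smult_closed[OF x(1) e[OF x(2,3)]])
  qed
  show "pure_tensor B x (r \<odot>\<^bsub>N\<^esub> y) = r \<odot>\<^bsub>Q\<^esub> pure_tensor B x y"
    if x: "r \<in> carrier R" "x \<in> carrier ?F" "y \<in> carrier N"
    unfolding pure_tensor_def linear_smult[OF q x(1) e[OF x(2,3)], symmetric]
  proof (rule pure_tensor_eqI)
    show "?e (x, r \<odot>\<^bsub>N\<^esub> y) \<ominus>\<^bsub>?P\<^esub> (r \<odot>\<^bsub>?P\<^esub> ?e (x, y)) \<in> tensor_gens B"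
      unfolding tensor_gens_def Let_def using x by blast
    show "?e (x, r \<odot>\<^bsub>N\<^esub> y) \<in> carrier ?P" by (rule e[OF x(2) N.smult_closed[OF x(1,3)]])
    show "r \<odot>\<^bsub>?P\<^esub> ?e (x, y) \<in> carrier ?P" by (rule P.smult_closed[OF x(1) e[OF x(2,3)]])
  qed
qed

lemma pure_tensor_balanced: "balanced R (FF B) N (quotient_module (PP B) (UU B)) (pure_tensor B)"
proof -
  have Q: "module R (quotient_module (PP B) (UU B))"
    by (rule quotient_module_is_module[OF PP_module tensor_rels_submodule])
  have "additive N (quotient_module (PP B) (UU B)) (pure_tensor B x)" if "x \<in> carrier (FF B)" for x
    by (rule additiveI) (rule pure_tensor_rules(1)[OF that] pure_tensor_rules(3)[OF that], assumption+)+
  moreover have "additive (FF B) (quotient_module (PP B) (UU B)) (\<lambda>x. pure_tensor B x y)" if "y \<in> carrier N" for y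
    by (rule additiveI) (rule pure_tensor_rules(1)[OF _ that] pure_tensor_rules(2)[OF _ _ that], assumption+)+
  moreover have "pure_tensor B (s \<odot>\<^bsub>FF B\<^esub> x) y = pure_tensor B x (s \<odot>\<^bsub>N\<^esub> y)"
    if x: "s \<in> carrier R" "x \<in> carrier (FF B)" "y \<in> carrier N" for s x y
    using pure_tensor_rules(4)[OF x] pure_tensor_rules(5)[OF x] by simp
  ultimately show ?thesis unfolding balanced_def
    by (intro conjI ballI FF_module N module_abelian_group[OF Q])
qed

lemma tensor_rels_iff:
  assumes p: "p \<in> carrier (PP B)"
  shows "p \<in> UU B \<longleftrightarrow> tensor_coord R N p = (\<lambda>_. \<zero>\<^bsub>N\<^esub>)"
proof
  assume "tensor_coord R N p = (\<lambda>_. \<zero>\<^bsub>N\<^esub>)"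
  let ?Q = "quotient_module (PP B) (UU B)"
  let ?k = "\<lambda>p. tensor_eval R N ?Q (pure_tensor B) (\<lambda>f. f) (tensor_coord R N p)"
  have Q: "module R ?Q" by (rule quotient_module_is_module[OF PP_module tensor_rels_submodule])
  interpret Q: module R ?Q by (rule Q)
  note id = linear_id[of R "FF B"] and b = pure_tensor_balanced[of B] and tl = tensor_coord_linear[of B]
  have k: "linear R (PP B) ?Q ?k"
  proof (rule linearI)
    fix x assume x: "x \<in> carrier (PP B)"
    note tx = tensor_coord_fin_supp[OF x]
    show "?k x \<in> carrier ?Q" by (rule tensor_eval_closed[OF b id tx])
    show "?k (x \<oplus>\<^bsub>PP B\<^esub> y) = ?k x \<oplus>\<^bsub>?Q\<^esub> ?k y" if y: "y \<in> carrier (PP B)" for y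
    proof -
      have "tensor_coord R N (x \<oplus>\<^bsub>PP B\<^esub> y) = (\<lambda>b. tensor_coord R N x b \<oplus>\<^bsub>N\<^esub> tensor_coord R N y b)"
        by (rule ext, rule linear_add[OF tl x y])
      thus ?thesis using tensor_eval_add[OF b id tx tensor_coord_fin_supp[OF y]] by simp
    qed
    show "?k (r \<odot>\<^bsub>PP B\<^esub> x) = r \<odot>\<^bsub>?Q\<^esub> ?k x" if r: "r \<in> carrier R" for r
    proof -
      have "tensor_coord R N (r \<odot>\<^bsub>PP B\<^esub> x) = (\<lambda>b. r \<odot>\<^bsub>N\<^esub> tensor_coord R N x b)"
        by (rule ext, rule linear_smult[OF tl r x])
      thus ?thesis using tensor_eval_smult[OF b id tx r Q pure_tensor_rules(5)[OF r]] by simp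
    qed
  qed
  have "UU B +>\<^bsub>PP B\<^esub> p = ?k p"
  proof (rule linear_free_eqI[OF Q linear_quotient[OF PP_module tensor_rels_submodule] k _ p])
    fix fy assume "fy \<in> carrier (FF B) \<times> carrier N"
    then obtain f y where fy: "fy = (f, y)" "f \<in> carrier (FF B)" "y \<in> carrier N" by auto
    have "tensor_coord R N (basis_elem R fy) = (\<lambda>b. f b \<odot>\<^bsub>N\<^esub> y)"
      unfolding fy(1) by (rule ext, rule tensor_coord_basis[OF fy(2,3)])
    thus "UU B +>\<^bsub>PP B\<^esub> basis_elem R fy = ?k (basis_elem R fy)"
      using tensor_eval_pure[OF b id fy(2,3)] by (simp add: pure_tensor_def fy(1))
  qed
  also have "\<dots> = \<zero>\<^bsub>?Q\<^esub>"
    unfolding \<open>tensor_coord R N p = (\<lambda>_. \<zero>\<^bsub>N\<^esub>)\<close> by (simp add: tensor_eval_def)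
  finally have "UU B +>\<^bsub>PP B\<^esub> p = UU B" by (simp add: quotient_module_simps)
  thus "p \<in> UU B" using quotient_eq_zero_iff[OF PP_module tensor_rels_submodule p] by simp
qed (rule ext, erule tensor_rels_coord)

lemma tensor_coord_surj:
  assumes g: "g \<in> fin_supp N B"
  obtains p where "p \<in> carrier (PP B)" "tensor_coord R N p = g"
proof -
  let ?T = "{b. g b \<noteq> \<zero>\<^bsub>N\<^esub>}"
  interpret P: module R "PP B" by (rule PP_module)
  note gD = fin_suppD[OF g]
  have e: "basis_elem R b \<in> carrier (FF B)" if "b \<in> ?T" for b
    by (rule basis_elem_closed[OF N.R.is_cring]) (use gD(3) that in auto)
  let ?p = "\<Oplus>\<^bsub>PP B\<^esub>b\<in>?T. basis_elem R (basis_elem R b, g b)"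
  have Pi: "(\<lambda>b. basis_elem R (basis_elem R b, g b)) \<in> ?T \<rightarrow> carrier (PP B)"
    using PP_basis[OF e gD(1)] by blast
  have p: "?p \<in> carrier (PP B)" by (rule P.M.finsum_closed[OF Pi])
  have "tensor_coord R N ?p c = g c" for c
  proof -
    have "tensor_coord R N ?p c = (\<Oplus>\<^bsub>N\<^esub>b\<in>?T. tensor_coord R N (basis_elem R (basis_elem R b, g b)) c)"
      by (rule linear_finsum[OF PP_module N tensor_coord_linear Pi])
    also have "\<dots> = extend_scalars R N (\<lambda>x. x) g c"
      unfolding extend_scalars_def tensor_eval_def
      by (rule N.M.finsum_cong'[OF refl])
         (use tensor_coord_basis[OF e gD(1)] N.smult_closed[OF free_module_closed[OF e] gD(1)] in blast)+
    finally show ?thesis by (simp add: extend_scalars_id[OF N g])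
  qed
  hence "tensor_coord R N ?p = g" by blast
  with p that show thesis by blast
qed

definition tensor_map_lift where
  "tensor_map_lift B B' d = linear_ext R (PP B') (\<lambda>(x, y). basis_elem R (d x, y))"

context
  fixes B :: "'g set" and B' :: "'h set" and d
  assumes d: "linear R (FF B) (FF B') d"
begin

lemma tensor_map_lift_linear: "linear R (PP B) (PP B') (tensor_map_lift B B' d)"
  unfolding tensor_map_lift_def
  by (rule linear_ext_linear[OF PP_module]) (use PP_basis[OF linear_closed[OF d]] in auto)

lemma tensor_coord_lift:
  assumes p: "p \<in> carrier (PP B)"
  shows "tensor_coord R N (tensor_map_lift B B' d p) = extend_scalars R N d (tensor_coord R N p)"
proof
  fix c
  let ?k = "\<lambda>p. extend_scalars R N d (tensor_coord R N p) c"
  note tl = tensor_coord_linear[of B]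
  have k: "linear R (PP B) N ?k"
  proof (rule linearI)
    fix x assume x: "x \<in> carrier (PP B)"
    note tx = tensor_coord_fin_supp[OF x]
    show "?k x \<in> carrier N" by (rule fin_suppD(1)[OF extend_scalars_closed[OF N d tx]])
    show "?k (x \<oplus>\<^bsub>PP B\<^esub> y) = ?k x \<oplus>\<^bsub>N\<^esub> ?k y" if y: "y \<in> carrier (PP B)" for y
    proof -
      have "tensor_coord R N (x \<oplus>\<^bsub>PP B\<^esub> y) = (\<lambda>b. tensor_coord R N x b \<oplus>\<^bsub>N\<^esub> tensor_coord R N y b)"
        by (rule ext, rule linear_add[OF tl x y])
      thus ?thesis using extend_scalars_add[OF N d tx tensor_coord_fin_supp[OF y]] by simp
    qed
    show "?k (r \<odot>\<^bsub>PP B\<^esub> x) = r \<odot>\<^bsub>N\<^esub> ?k x" if r: "r \<in> carrier R" for r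
    proof -
      have "tensor_coord R N (r \<odot>\<^bsub>PP B\<^esub> x) = (\<lambda>b. r \<odot>\<^bsub>N\<^esub> tensor_coord R N x b)"
        by (rule ext, rule linear_smult[OF tl r x])
      thus ?thesis using extend_scalars_smult[OF N d tx r] by simp
    qed
  qed
  show "tensor_coord R N (tensor_map_lift B B' d p) c = ?k p"
  proof (rule linear_free_eqI[OF N linear_compose[OF tensor_map_lift_linear tensor_coord_linear] k _ p])
    fix fy assume "fy \<in> carrier (FF B) \<times> carrier N"
    then obtain f y where fy: "fy = (f, y)" "f \<in> carrier (FF B)" "y \<in> carrier N" by auto
    have 1: "tensor_coord R N (basis_elem R fy) = (\<lambda>b. f b \<odot>\<^bsub>N\<^esub> y)"
      unfolding fy(1) by (rule ext, rule tensor_coord_basis[OF fy(2,3)])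
    have "tensor_map_lift B B' d (basis_elem R fy) = basis_elem R (d f, y)"
      unfolding tensor_map_lift_def
      by (subst linear_ext_basis[OF PP_module, of fy "carrier (FF B) \<times> carrier N"])
         (use fy PP_basis[OF linear_closed[OF d]] in auto)
    thus "tensor_coord R N (tensor_map_lift B B' d (basis_elem R fy)) c = ?k (basis_elem R fy)"
      unfolding 1 extend_scalars_pure[OF N d fy(2,3)]
      using tensor_coord_basis[OF linear_closed[OF d fy(2)] fy(3)] by simp
  qed
qed

lemma tensor_map_coset:
  assumes p: "p \<in> carrier (PP B)"
  shows "tensor_map R (FF B) (FF B') N d (UU B +>\<^bsub>PP B\<^esub> p) = UU B' +>\<^bsub>PP B'\<^esub> tensor_map_lift B B' d p"
proof -
  interpret P: module R "PP B" by (rule PP_module)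
  interpret U: abelian_subgroup "UU B" "PP B" by (rule submodule_abelian_subgroup[OF PP_module tensor_rels_submodule])
  interpret U': abelian_subgroup "UU B'" "PP B'" by (rule submodule_abelian_subgroup[OF PP_module tensor_rels_submodule])
  note l = tensor_map_lift_linear
  have "UU B' +>\<^bsub>PP B'\<^esub> tensor_map_lift B B' d c = UU B' +>\<^bsub>PP B'\<^esub> tensor_map_lift B B' d p"
    if c: "c \<in> UU B +>\<^bsub>PP B\<^esub> p" for c
  proof -
    obtain u where u: "u \<in> UU B" "c = u \<oplus>\<^bsub>PP B\<^esub> p" using c by (auto simp: a_r_coset_def')
    have uc: "u \<in> carrier (PP B)" using u(1) U.a_subset by blast
    have "tensor_map_lift B B' d u \<in> UU B'"
      unfolding tensor_rels_iff[OF linear_closed[OF l uc]] tensor_coord_lift[OF uc]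
      using u(1) tensor_rels_iff[OF uc] by (simp add: extend_scalars_zero[OF N])
    hence "tensor_map_lift B B' d c \<in> UU B' +>\<^bsub>PP B'\<^esub> tensor_map_lift B B' d p"
      unfolding u(2) linear_add[OF l uc p] by (auto simp: a_r_coset_def')
    from U'.a_repr_independence'[OF this linear_closed[OF l p]] show ?thesis ..
  qed
  hence "(\<lambda>c. UU B' +>\<^bsub>PP B'\<^esub> tensor_map_lift B B' d c) ` (UU B +>\<^bsub>PP B\<^esub> p) =
      {UU B' +>\<^bsub>PP B'\<^esub> tensor_map_lift B B' d p}"
    using U.a_rcos_self[OF p] by blast
  thus ?thesis by (simp add: tensor_map_def Let_def tensor_map_lift_def)
qed

end

end

lemma zero_Tor_tor_vanishes:
  assumes M: "module R M" and N: "module R N" and zero: "zero_module (Tor R n M N)"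
  shows "tor_vanishes R N (res_gens R M) (res_diff R M) n"
  unfolding tor_vanishes_def
proof (intro ballI impI)
  let ?B = "res_gens R M" and ?d = "res_diff R M"
  let ?F = "\<lambda>i. free_module R (?B i)"
  let ?P = "\<lambda>i. free_module R (carrier (?F i) \<times> carrier N)"
  let ?U = "\<lambda>i. tensor_rels R (?F i) N"
  note r = free_resolutionD[OF free_resolution_std[OF M]]
  fix g assume g: "g \<in> fin_supp N (?B n)"
    and cyc: "\<forall>i. n = Suc i \<longrightarrow> extend_scalars R N (?d i) g = (\<lambda>_. \<zero>\<^bsub>N\<^esub>)"
  obtain p where p: "p \<in> carrier (?P n)" "tensor_coord R N p = g" by (rule tensor_coord_surj[OF N g])
  let ?C = "\<lambda>i. tensor_module R (res_module R M i) N"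
  let ?D = "\<lambda>i. tensor_map R (res_module R M (Suc i)) (res_module R M i) N (?d i)"
  let ?Z = "(?C n)\<lparr>carrier := (case n of 0 \<Rightarrow> carrier (?C 0) | Suc i \<Rightarrow> a_kernel (?C n) (?C i) (?D i))\<rparr>"
  let ?H = "?D n ` carrier (?C (Suc n))"
  let ?z = "?U n +>\<^bsub>?P n\<^esub> p"
  have C: "?C i = quotient_module (?P i) (?U i)" for i by (simp add: tensor_module_def res_module_def)
  have Cc: "?U i +>\<^bsub>?P i\<^esub> x \<in> carrier (?C i)" if "x \<in> carrier (?P i)" for x i
    using that unfolding C by (auto simp: quotient_module_simps A_RCOSETS_def')
  have D: "?D i (?U (Suc i) +>\<^bsub>?P (Suc i)\<^esub> x) = ?U i +>\<^bsub>?P i\<^esub> tensor_map_lift R N (?B (Suc i)) (?B i) (?d i) x"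
    if "x \<in> carrier (?P (Suc i))" for x i
    using tensor_map_coset[OF N r(4) that] by (simp add: res_module_def)
  note ll = tensor_map_lift_linear[OF N r(4)]
  have P: "module R (?P i)" for i by (rule PP_module[OF N])
  interpret Pn: module R "?P n" by (rule P)
  interpret Pn1: module R "?P (Suc n)" by (rule P)
  interpret Q: module R "quotient_module (?P n) (?U n)"
    by (rule quotient_module_is_module[OF P tensor_rels_submodule[OF N]])
  have z: "?z \<in> carrier ?Z"
  proof (cases n)
    case 0 then show ?thesis using Cc[OF p(1)] by simp
  next
    case (Suc i)
    have p': "p \<in> carrier (?P (Suc i))" using p(1) Suc by simp
    have "tensor_map_lift R N (?B (Suc i)) (?B i) (?d i) p \<in> ?U i"
      unfolding tensor_rels_iff[OF N linear_closed[OF ll p']] tensor_coord_lift[OF N r(4) p'] p(2)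
      using cyc Suc by simp
    hence "?D i (?U (Suc i) +>\<^bsub>?P (Suc i)\<^esub> p) = \<zero>\<^bsub>?C i\<^esub>"
      unfolding D[OF p'] C quotient_module_simps
      using quotient_eq_zero_iff[OF P tensor_rels_submodule[OF N] linear_closed[OF ll p']] by simp
    thus ?thesis using Suc Cc[OF p'] by (simp add: a_kernel_def')
  qed
  have "carrier (quotient_module ?Z ?H) = {\<zero>\<^bsub>quotient_module ?Z ?H\<^esub>}"
    using zero unfolding zero_module_def Tor_def homology_module_def .
  hence Hz: "?H +>\<^bsub>?Z\<^esub> ?z = ?H" using z by (auto simp: quotient_module_simps A_RCOSETS_def')
  have UH: "?U n \<in> ?H"
  proof -
    have z1: "\<zero>\<^bsub>?P (Suc n)\<^esub> \<in> carrier (?P (Suc n))" by simp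
    have "tensor_coord R N \<zero>\<^bsub>?P n\<^esub> = (\<lambda>_. \<zero>\<^bsub>N\<^esub>)"
      by (rule ext, rule linear_zero[OF P N tensor_coord_linear[OF N]])
    hence "?D n (?U (Suc n) +>\<^bsub>?P (Suc n)\<^esub> \<zero>\<^bsub>?P (Suc n)\<^esub>) = ?U n"
      unfolding D[OF z1] linear_zero[OF P P ll]
      using quotient_eq_zero_iff[OF P tensor_rels_submodule[OF N], of "\<zero>\<^bsub>?P n\<^esub>"]
        tensor_rels_iff[OF N, of "\<zero>\<^bsub>?P n\<^esub>"] by simp
    thus ?thesis using Cc[OF z1] by (metis image_eqI)
  qed
  have Uz: "?U n \<oplus>\<^bsub>?Z\<^esub> ?z = ?z"
    using Q.M.l_zero Cc[OF p(1)] C[of n] by (simp add: quotient_module_simps)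
  have "?U n \<oplus>\<^bsub>?Z\<^esub> ?z \<in> ?H +>\<^bsub>?Z\<^esub> ?z"
    unfolding a_r_coset_def'[of ?Z] using UH by blast
  hence "?z \<in> ?H" unfolding Uz Hz .
  then obtain p' where p': "p' \<in> carrier (?P (Suc n))" "?z = ?D n (?U (Suc n) +>\<^bsub>?P (Suc n)\<^esub> p')"
    unfolding C by (auto simp: quotient_module_simps A_RCOSETS_def')
  let ?l = "tensor_map_lift R N (?B (Suc n)) (?B n) (?d n) p'"
  have lc: "?l \<in> carrier (?P n)" by (rule linear_closed[OF ll p'(1)])
  have "p \<in> ?U n +>\<^bsub>?P n\<^esub> ?l"
    using abelian_subgroup.a_rcos_self[OF submodule_abelian_subgroup[OF P tensor_rels_submodule[OF N]] p(1)]
      p'(2) D[OF p'(1)] by simp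
  then obtain u where u: "u \<in> ?U n" "p = u \<oplus>\<^bsub>?P n\<^esub> ?l" by (auto simp: a_r_coset_def')
  have uc: "u \<in> carrier (?P n)"
    using u(1) Pn.submoduleE(1)[OF tensor_rels_submodule[OF N]] by blast
  have "g b = tensor_coord R N ?l b" for b
  proof -
    have "g b = tensor_coord R N u b \<oplus>\<^bsub>N\<^esub> tensor_coord R N ?l b"
      unfolding p(2)[symmetric] u(2) by (rule linear_add[OF tensor_coord_linear[OF N] uc lc])
    thus ?thesis using tensor_rels_coord[OF N u(1)] linear_closed[OF tensor_coord_linear[OF N] lc]
        abelian_group.axioms(1)[OF module_abelian_group[OF N]] abelian_monoid.l_zero by metis
  qed
  hence "extend_scalars R N (?d n) (tensor_coord R N p') = g"
    using tensor_coord_lift[OF N r(4) p'(1)] by auto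
  thus "\<exists>h\<in>fin_supp N (?B (Suc n)). extend_scalars R N (?d n) h = g"
    using tensor_coord_fin_supp[OF N p'(1)] by blast
qed

section \<open>Local rings and their residue fields\<close>

lemma restrict_scalars_simps [simp]:
  "carrier (restrict_scalars h M) = carrier M" "\<zero>\<^bsub>restrict_scalars h M\<^esub> = \<zero>\<^bsub>M\<^esub>"
  "add (restrict_scalars h M) = add M" "r \<odot>\<^bsub>restrict_scalars h M\<^esub> x = h r \<odot>\<^bsub>M\<^esub> x"
  by (simp_all add: restrict_scalars_def)

lemma restrict_scalars_is_module:
  assumes R: "cring R" and h: "h \<in> ring_hom R S" and M: "module S M"
  shows "module R (restrict_scalars h M)"
proof -
  interpret R: cring R by (rule R)
  interpret M: module S M by (rule M)
  show ?thesis
  proof (rule moduleI[OF R])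
    show "abelian_group (restrict_scalars h M)"
      by (rule abelian_groupI) (auto simp: M.M.a_ac intro: bexI[of _ "\<ominus>\<^bsub>M\<^esub> _"] M.M.l_neg)
  qed (auto simp: ring_hom_closed[OF h] ring_hom_add[OF h] ring_hom_mult[OF h] ring_hom_one[OF h]
      M.smult_l_distr M.smult_r_distr M.smult_assoc1)
qed

lemma linear_restrict_scalars:
  assumes "h \<in> ring_hom R S" "linear S M N f"
  shows "linear R (restrict_scalars h M) (restrict_scalars h N) f"
  using assms(2) ring_hom_closed[OF assms(1)] by (auto simp: linear_def additive_def)

abbreviation functional where
  "functional R \<pi> k M \<equiv> linear R M (restrict_scalars \<pi> (ring_module k))"

lemma functionalD:
  assumes "functional R \<pi> k M f"
  shows "x \<in> carrier M \<Longrightarrow> f x \<in> carrier k"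
    "x \<in> carrier M \<Longrightarrow> y \<in> carrier M \<Longrightarrow> f (x \<oplus>\<^bsub>M\<^esub> y) = f x \<oplus>\<^bsub>k\<^esub> f y"
    "r \<in> carrier R \<Longrightarrow> x \<in> carrier M \<Longrightarrow> f (r \<odot>\<^bsub>M\<^esub> x) = \<pi> r \<otimes>\<^bsub>k\<^esub> f x"
  using assms by (auto simp: linear_def additive_def)

definition minimal_generators where
  "minimal_generators S p k M A \<longleftrightarrow> finite A \<and> A \<subseteq> carrier M \<and>
     linear_ext S M id ` carrier (free_module S A) = carrier M \<and>
     (\<forall>c\<in>carrier (free_module S A). linear_ext S M id c = \<zero>\<^bsub>M\<^esub> \<longrightarrow> (\<forall>a. p (c a) = \<zero>\<^bsub>k\<^esub>))"

lemma minimal_generatorsD: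
  assumes "minimal_generators S p k M A"
  shows "finite A" "A \<subseteq> carrier M" "linear_ext S M id ` carrier (free_module S A) = carrier M"
    "c \<in> carrier (free_module S A) \<Longrightarrow> linear_ext S M id c = \<zero>\<^bsub>M\<^esub> \<Longrightarrow> p (c a) = \<zero>\<^bsub>k\<^esub>"
  using assms unfolding minimal_generators_def by blast+

locale residue_field = S: local_ring S + k: field k
  for S :: "'s ring" and k :: "'k ring" +
  fixes p :: "'s \<Rightarrow> 'k"
  assumes hom: "p \<in> ring_hom S k" and surj: "p ` carrier S = carrier k" and not_iso: "p \<notin> ring_iso S k"
begin

lemma p_simps [simp]:
  "x \<in> carrier S \<Longrightarrow> p x \<in> carrier k"
  "x \<in> carrier S \<Longrightarrow> y \<in> carrier S \<Longrightarrow> p (x \<oplus>\<^bsub>S\<^esub> y) = p x \<oplus>\<^bsub>k\<^esub> p y"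
  "x \<in> carrier S \<Longrightarrow> y \<in> carrier S \<Longrightarrow> p (x \<otimes>\<^bsub>S\<^esub> y) = p x \<otimes>\<^bsub>k\<^esub> p y"
  "p \<one>\<^bsub>S\<^esub> = \<one>\<^bsub>k\<^esub>"
  using ring_hom_closed[OF hom] ring_hom_add[OF hom] ring_hom_mult[OF hom] ring_hom_one[OF hom] by auto

lemma p_additive: "additive S k p"
  by (rule additiveI) auto

lemma p_zero [simp]: "p \<zero>\<^bsub>S\<^esub> = \<zero>\<^bsub>k\<^esub>"
  by (rule additive_zero[OF S.abelian_group_axioms k.abelian_group_axioms p_additive])

lemma p_minus [simp]: "x \<in> carrier S \<Longrightarrow> p (\<ominus>\<^bsub>S\<^esub> x) = \<ominus>\<^bsub>k\<^esub> p x"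
  by (rule additive_minus[OF S.abelian_group_axioms k.abelian_group_axioms p_additive])

lemma p_inverse:
  assumes "x \<in> carrier S" "p x \<noteq> \<zero>\<^bsub>k\<^esub>"
  obtains y where "y \<in> carrier S" "p (y \<otimes>\<^bsub>S\<^esub> x) = \<one>\<^bsub>k\<^esub>"
proof -
  have "p x \<in> Units k" using assms k.field_Units by simp
  then obtain v where v: "v \<in> carrier k" "v \<otimes>\<^bsub>k\<^esub> p x = \<one>\<^bsub>k\<^esub>" by (auto simp: Units_def)
  obtain y where "y \<in> carrier S" "v = p y" using surj v(1) by blast
  thus thesis using that[of y] v(2) assms by simp
qed

lemma residue_ideal: "ideal {x \<in> carrier S. p x = \<zero>\<^bsub>k\<^esub>} S"
proof (rule idealI[OF S.ring_axioms])
  have "p (\<zero>\<^bsub>S\<^esub>) = \<zero>\<^bsub>k\<^esub>" by simp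
  thus "subgroup {x \<in> carrier S. p x = \<zero>\<^bsub>k\<^esub>} (add_monoid S)"
    by (intro S.add.subgroupI) auto
qed auto

lemma residue_maximalideal: "maximalideal {x \<in> carrier S. p x = \<zero>\<^bsub>k\<^esub>} S"
proof (rule maximalidealI[OF residue_ideal])
  show "carrier S \<noteq> {x \<in> carrier S. p x = \<zero>\<^bsub>k\<^esub>}" using S.one_closed p_simps(4) k.one_not_zero by force
  fix J assume J: "ideal J S" "{x \<in> carrier S. p x = \<zero>\<^bsub>k\<^esub>} \<subseteq> J" "J \<subseteq> carrier S"
  interpret J: ideal J S by (rule J)
  show "J = {x \<in> carrier S. p x = \<zero>\<^bsub>k\<^esub>} \<or> J = carrier S"
  proof (cases "\<exists>x\<in>J. p x \<noteq> \<zero>\<^bsub>k\<^esub>")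
    case True
    then obtain x where x: "x \<in> J" "p x \<noteq> \<zero>\<^bsub>k\<^esub>" "x \<in> carrier S" using J(3) by blast
    obtain y where y: "y \<in> carrier S" "p (y \<otimes>\<^bsub>S\<^esub> x) = \<one>\<^bsub>k\<^esub>" using p_inverse[OF x(3,2)] by blast
    have yx: "y \<otimes>\<^bsub>S\<^esub> x \<in> J" by (rule J.I_l_closed[OF x(1) y(1)])
    have c: "y \<otimes>\<^bsub>S\<^esub> x \<in> carrier S" "\<one>\<^bsub>S\<^esub> \<ominus>\<^bsub>S\<^esub> (y \<otimes>\<^bsub>S\<^esub> x) \<in> carrier S" using x y by auto
    have "p (\<one>\<^bsub>S\<^esub> \<ominus>\<^bsub>S\<^esub> (y \<otimes>\<^bsub>S\<^esub> x)) = \<one>\<^bsub>k\<^esub> \<oplus>\<^bsub>k\<^esub> \<ominus>\<^bsub>k\<^esub> p (y \<otimes>\<^bsub>S\<^esub> x)"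
      unfolding a_minus_def using c(1) by (metis S.a_inv_closed S.one_closed p_minus p_simps(2,4))
    hence "p (\<one>\<^bsub>S\<^esub> \<ominus>\<^bsub>S\<^esub> (y \<otimes>\<^bsub>S\<^esub> x)) = \<zero>\<^bsub>k\<^esub>" unfolding y(2) by (simp add: k.r_neg)
    hence "\<one>\<^bsub>S\<^esub> \<ominus>\<^bsub>S\<^esub> (y \<otimes>\<^bsub>S\<^esub> x) \<in> J" using J(2) c(2) by blast
    from J.a_closed[OF this yx] have "\<one>\<^bsub>S\<^esub> \<in> J"
      using c(1) by (simp add: a_minus_def S.a_assoc S.l_neg)
    thus ?thesis using J.one_imp_carrier by blast
  qed (use J in blast)
qed

lemma ideal_le_maximal:
  assumes I: "ideal I S" "I \<noteq> carrier S"
  obtains J where "maximalideal J S" "I \<subseteq> J"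
proof -
  let ?A = "{J. ideal J S \<and> I \<subseteq> J \<and> J \<noteq> carrier S}"
  have "\<exists>M\<in>?A. \<forall>X\<in>?A. M \<subseteq> X \<longrightarrow> X = M"
  proof (rule subset_Zorn_nonempty)
    show "?A \<noteq> {}" using I by blast
    fix C assume C: "C \<noteq> {}" "subset.chain ?A C"
    have "subset.chain {I. ideal I S} C" using C(2) unfolding pred_on.chain_def by blast
    from S.ideal_chain_is_trivial[OF C(1) this] show "\<Union>C \<in> ?A"
      using C(2) unfolding pred_on.chain_def by blast
  qed
  then obtain M where M: "M \<in> ?A" "\<forall>X\<in>?A. M \<subseteq> X \<longrightarrow> X = M" by (rule bexE)
  have "maximalideal M S"
  proof (rule maximalidealI)
    show "J = M \<or> J = carrier S" if "ideal J S" "M \<subseteq> J" for J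
    proof (cases "J = carrier S")
      case False
      hence "J \<in> ?A" using that M(1) by auto
      thus ?thesis using M(2) that(2) by blast
    qed simp
  qed (use M(1) in auto)
  thus thesis using M(1) that by blast
qed

lemma unit_if_residue_nonzero:
  assumes x: "x \<in> carrier S" "p x \<noteq> \<zero>\<^bsub>k\<^esub>"
  obtains y where "y \<in> carrier S" "y \<otimes>\<^bsub>S\<^esub> x = \<one>\<^bsub>S\<^esub>"
proof (cases "PIdl\<^bsub>S\<^esub> x = carrier S")
  case True
  hence "\<one>\<^bsub>S\<^esub> \<in> PIdl\<^bsub>S\<^esub> x" by simp
  then obtain y where "y \<in> carrier S" "\<one>\<^bsub>S\<^esub> = y \<otimes>\<^bsub>S\<^esub> x" unfolding cgenideal_def by blast
  thus thesis using that[of y] by simp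
next
  case False
  obtain J where J: "maximalideal J S" "PIdl\<^bsub>S\<^esub> x \<subseteq> J"
    by (rule ideal_le_maximal[OF S.cgenideal_ideal[OF x(1)] False])
  have "J = {x \<in> carrier S. p x = \<zero>\<^bsub>k\<^esub>}" using S.unique_maximal J(1) residue_maximalideal by blast
  hence "p x = \<zero>\<^bsub>k\<^esub>" using S.cgenideal_self[OF x(1)] J(2) by blast
  thus thesis using x by simp
qed

lemma residue_ideal_nonzero: "{x \<in> carrier S. p x = \<zero>\<^bsub>k\<^esub>} \<noteq> {\<zero>\<^bsub>S\<^esub>}"
proof
  assume z: "{x \<in> carrier S. p x = \<zero>\<^bsub>k\<^esub>} = {\<zero>\<^bsub>S\<^esub>}"
  have "inj_on p (carrier S)"
  proof (rule inj_onI)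
    fix x y assume xy: "x \<in> carrier S" "y \<in> carrier S" "p x = p y"
    have "p (x \<ominus>\<^bsub>S\<^esub> y) = \<zero>\<^bsub>k\<^esub>" using xy by (simp add: a_minus_def k.r_neg)
    hence "x \<ominus>\<^bsub>S\<^esub> y = \<zero>\<^bsub>S\<^esub>" using z xy by blast
    thus "x = y" using xy by simp
  qed
  hence "p \<in> ring_iso S k" using hom surj by (simp add: ring_iso_def bij_betw_def)
  thus False using not_iso by simp
qed

lemma minimal_generators_exist:
  assumes fg: "fg_module S M"
  obtains A where "minimal_generators S p k M A"
proof -
  interpret M: module S M using fg by (simp add: fg_module_def)
  let ?G = "\<lambda>A. A \<subseteq> carrier M \<and> finite A \<and> linear_ext S M id ` carrier (free_module S A) = carrier M"
  obtain A0 where "?G A0" using fg unfolding fg_module_def by blast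
  from ex_has_least_nat[of ?G, OF this, of card]
  obtain A where "?G A \<and> (\<forall>B. ?G B \<longrightarrow> card A \<le> card B)" by (rule exE)
  hence A: "?G A" "\<forall>B. ?G B \<longrightarrow> card A \<le> card B" by (rule conjunct1, rule conjunct2)
  have id: "id \<in> B \<rightarrow> carrier M" if "B \<subseteq> A" for B using that A(1) by auto
  have F: "module S (free_module S A)" by (rule free_module_is_module[OF S.is_cring])
  have "minimal_generators S p k M A" unfolding minimal_generators_def
  proof (intro conjI ballI impI allI)
    fix c a assume c: "c \<in> carrier (free_module S A)" "linear_ext S M id c = \<zero>\<^bsub>M\<^esub>"
    show "p (c a) = \<zero>\<^bsub>k\<^esub>"
    proof (rule ccontr)
      assume nz: "p (c a) \<noteq> \<zero>\<^bsub>k\<^esub>"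
      have cc: "c b \<in> carrier S" for b by (rule free_module_closed[OF c(1)])
      have a: "a \<in> A" using nz free_module_outside[OF c(1)] by force
      obtain u where u: "u \<in> carrier S" "u \<otimes>\<^bsub>S\<^esub> c a = \<one>\<^bsub>S\<^esub>" by (rule unit_if_residue_nonzero[OF cc nz])
      interpret F: module S "free_module S A" by (rule F)
      note lin = linear_ext_linear[OF M.module_axioms id[OF subset_refl]]
      have "x \<in> linear_ext S M id ` carrier (free_module S (A - {a}))" if x: "x \<in> carrier M" for x
      proof -
        obtain f where f: "f \<in> carrier (free_module S A)" "x = linear_ext S M id f" using A(1) x by blast
        have fc: "f b \<in> carrier S" for b by (rule free_module_closed[OF f(1)])
        let ?r = "f a \<otimes>\<^bsub>S\<^esub> u"
        have r: "?r \<in> carrier S" using fc u by simp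
        let ?g = "f \<ominus>\<^bsub>free_module S A\<^esub> (?r \<odot>\<^bsub>free_module S A\<^esub> c)"
        have rc: "?r \<odot>\<^bsub>free_module S A\<^esub> c \<in> carrier (free_module S A)" by (rule F.smult_closed[OF r c(1)])
        have g: "?g \<in> carrier (free_module S A)" by (rule F.M.minus_closed[OF f(1) rc])
        have "?g \<oplus>\<^bsub>free_module S A\<^esub> (?r \<odot>\<^bsub>free_module S A\<^esub> c) = f"
          using f(1) rc by (simp add: a_minus_def F.M.a_assoc F.M.l_neg)
        hence "?g a \<oplus>\<^bsub>S\<^esub> ?r \<otimes>\<^bsub>S\<^esub> c a = f a" by (metis free_module_add free_module_smult)
        moreover have "?r \<otimes>\<^bsub>S\<^esub> c a = f a" using fc cc u by (simp add: S.m_assoc)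
        ultimately have "?g a = \<zero>\<^bsub>S\<^esub>" using fc free_module_closed[OF g] by (metis S.add.r_cancel_one')
        hence g': "?g \<in> carrier (free_module S (A - {a}))" using g by (auto simp: free_module_def)
        have "linear_ext S M id ?g = linear_ext S M id f \<ominus>\<^bsub>M\<^esub> linear_ext S M id (?r \<odot>\<^bsub>free_module S A\<^esub> c)"
          by (rule linear_minus[OF F M.module_axioms lin f(1) rc])
        also have "linear_ext S M id (?r \<odot>\<^bsub>free_module S A\<^esub> c) = \<zero>\<^bsub>M\<^esub>"
          unfolding linear_smult[OF lin r c(1)] c(2) using r by simp
        also have "linear_ext S M id f \<ominus>\<^bsub>M\<^esub> \<zero>\<^bsub>M\<^esub> = x" unfolding f(2)[symmetric] using x by (simp add: a_minus_def)
        finally have "linear_ext S M id ?g = x" .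
        thus ?thesis using g' by blast
      qed
      moreover have "linear_ext S M id c' \<in> carrier M" if "c' \<in> carrier (free_module S (A - {a}))" for c'
        by (rule linear_ext_closed[OF M.module_axioms that id]) auto
      ultimately have "?G (A - {a})" using A(1) by blast
      from A(2)[rule_format, OF this] show False using a A(1) by (meson card_Diff1_less linorder_not_less)
    qed
  qed (use A in auto)
  thus thesis by (rule that)
qed

lemma dual_functional:
  assumes M: "module S M" and A: "minimal_generators S p k M A" and a: "a \<in> A"
  obtains f where "functional S p k M f" "f a = \<one>\<^bsub>k\<^esub>" "\<forall>b\<in>A. b \<noteq> a \<longrightarrow> f b = \<zero>\<^bsub>k\<^esub>"
proof -
  note A = minimal_generatorsD[OF A]
  interpret M: module S M by (rule M)
  have F: "module S (free_module S A)" by (rule free_module_is_module[OF S.is_cring])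
  interpret F: module S "free_module S A" by (rule F)
  have id: "id \<in> A \<rightarrow> carrier M" using A(2) by auto
  note lin = linear_ext_linear[OF M id]
  have wd: "p (c a) = p (c' a)" if c: "c \<in> carrier (free_module S A)" "c' \<in> carrier (free_module S A)"
    and eq: "linear_ext S M id c = linear_ext S M id c'" for c c'
  proof -
    let ?d = "c \<ominus>\<^bsub>free_module S A\<^esub> c'"
    have d: "?d \<in> carrier (free_module S A)" by (rule F.M.minus_closed[OF c])
    have "linear_ext S M id ?d = \<zero>\<^bsub>M\<^esub>"
      using linear_minus[OF F M lin c] eq linear_closed[OF lin c(2)] by (simp add: a_minus_def M.M.r_neg)
    from A(4)[OF d this] have "p (?d a) = \<zero>\<^bsub>k\<^esub>" .
    moreover have "?d \<oplus>\<^bsub>free_module S A\<^esub> c' = c" using c by (simp add: a_minus_def F.M.a_assoc F.M.l_neg)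
    hence "c a = ?d a \<oplus>\<^bsub>S\<^esub> c' a" by (metis free_module_add)
    ultimately show ?thesis using free_module_closed[OF d] free_module_closed[OF c(2)] by simp
  qed
  define f where "f x = p ((SOME c. c \<in> carrier (free_module S A) \<and> linear_ext S M id c = x) a)" for x
  have f: "f (linear_ext S M id c) = p (c a)" if c: "c \<in> carrier (free_module S A)" for c
  proof -
    let ?P = "\<lambda>c'. c' \<in> carrier (free_module S A) \<and> linear_ext S M id c' = linear_ext S M id c"
    have "?P (SOME c'. ?P c')" by (rule someI[of ?P c]) (use c in simp)
    thus ?thesis unfolding f_def using wd c by blast
  qed
  have "functional S p k M f"
  proof (rule linearI)
    fix x assume "x \<in> carrier M"
    then obtain c where c: "c \<in> carrier (free_module S A)" "x = linear_ext S M id c" using A(3) by blast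
    show "f x \<in> carrier (restrict_scalars p (ring_module k))"
      unfolding c(2) f[OF c(1)] using free_module_closed[OF c(1)] by simp
    show "f (r \<odot>\<^bsub>M\<^esub> x) = r \<odot>\<^bsub>restrict_scalars p (ring_module k)\<^esub> f x" if r: "r \<in> carrier S" for r
      unfolding c(2) linear_smult[OF lin r c(1), symmetric] f[OF c(1)] f[OF F.smult_closed[OF r c(1)]]
      using free_module_closed[OF c(1)] r by (simp add: free_module_smult)
    fix y assume "y \<in> carrier M"
    then obtain d where d: "d \<in> carrier (free_module S A)" "y = linear_ext S M id d" using A(3) by blast
    show "f (x \<oplus>\<^bsub>M\<^esub> y) = f x \<oplus>\<^bsub>restrict_scalars p (ring_module k)\<^esub> f y"
      unfolding c(2) d(2) linear_add[OF lin c(1) d(1), symmetric] f[OF c(1)] f[OF d(1)] f[OF F.M.add.m_closed[OF c(1) d(1)]]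
      using free_module_closed[OF c(1)] free_module_closed[OF d(1)] by (simp add: free_module_add)
  qed
  moreover have "f b = (if b = a then \<one>\<^bsub>k\<^esub> else \<zero>\<^bsub>k\<^esub>)" if b: "b \<in> A" for b
    using f[OF basis_elem_closed[OF S.is_cring b]] linear_ext_basis[OF M b id]
    by (simp add: basis_elem_def split: if_splits)
  ultimately show thesis using a by (intro that[of f]) auto
qed

lemma minimal_generators_empty:
  fixes M :: "('s, 'b, 'n) module_scheme"
  assumes "module S M" "minimal_generators S p k M {}" shows "zero_module M"
proof -
  have c: "carrier (free_module S ({} :: 'b set)) = {\<zero>\<^bsub>free_module S {}\<^esub>}" by (auto simp: free_module_def)
  have "linear_ext S M id \<zero>\<^bsub>free_module S {}\<^esub> = \<zero>\<^bsub>M\<^esub>" by (rule linear_ext_zero[OF assms(1)])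
  thus ?thesis using minimal_generatorsD(3)[OF assms(2)] unfolding c zero_module_def by simp
qed

lemma functional_exists:
  assumes "fg_module S M" "\<not> zero_module M"
  obtains f x where "functional S p k M f" "x \<in> carrier M" "f x = \<one>\<^bsub>k\<^esub>"
proof -
  have M: "module S M" using assms(1) by (simp add: fg_module_def)
  obtain A where A: "minimal_generators S p k M A" by (rule minimal_generators_exist[OF assms(1)])
  have "A \<noteq> {}"
  proof
    assume "A = {}"
    with A have "minimal_generators S p k M {}" by simp
    from minimal_generators_empty[OF M this] show False using assms(2) by simp
  qed
  then obtain a where a: "a \<in> A" by blast
  obtain f where f: "functional S p k M f" "f a = \<one>\<^bsub>k\<^esub>" "\<forall>b\<in>A. b \<noteq> a \<longrightarrow> f b = \<zero>\<^bsub>k\<^esub>"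
    by (rule dual_functional[OF M A a])
  have "a \<in> carrier M" using minimal_generatorsD(2)[OF A] a by blast
  with f(1) show thesis using f(2) by (rule that)
qed

abbreviation ideal_module where
  "ideal_module I \<equiv> (ring_module S)\<lparr>carrier := I\<rparr>"

lemma ideal_submodule:
  assumes "ideal I S" shows "submodule I S (ring_module S)"
proof -
  interpret I: ideal I S by fact
  interpret M: module S "ring_module S" by (rule ring_module_is_module[OF S.is_cring])
  show ?thesis
  proof (rule M.submoduleI)
    show "I \<subseteq> carrier (ring_module S)" using I.a_subset by simp
    show "\<ominus>\<^bsub>ring_module S\<^esub> x \<in> I" if x: "x \<in> I" for x
    proof -
      have "additive S (ring_module S) (\<lambda>x. x)" by (rule additiveI) auto
      from additive_minus[OF S.abelian_group_axioms M.abelian_group_axioms this] x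
      show ?thesis using I.a_inv_closed[OF x] I.a_subset by auto
    qed
  qed (auto intro: I.I_l_closed)
qed

lemma ideal_module_is_module: "ideal I S \<Longrightarrow> module S (ideal_module I)"
  by (rule submodule.submodule_is_module[OF ideal_submodule ring_module_is_module[OF S.is_cring]])

lemma fg_ideal:
  assumes I: "ideal I S" shows "fg_module S (ideal_module I)"
proof -
  interpret I: ideal I S by (rule I)
  let ?M = "ideal_module I"
  interpret M: module S ?M by (rule ideal_module_is_module[OF I])
  obtain A where A: "A \<subseteq> carrier S" "finite A" "I = Idl\<^bsub>S\<^esub> A" using S.finetely_gen[OF I] by blast
  have AI: "A \<subseteq> I" unfolding A(3) by (rule S.genideal_self[OF A(1)])
  have id: "id \<in> A \<rightarrow> carrier ?M" using AI by auto
  note lin = linear_ext_linear[OF M.module_axioms id]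
  interpret F: module S "free_module S A" by (rule free_module_is_module[OF S.is_cring])
  let ?J = "linear_ext S ?M id ` carrier (free_module S A)"
  have JI: "?J \<subseteq> I" using linear_closed[OF lin] by auto
  have "ideal ?J S"
  proof (rule idealI[OF S.ring_axioms])
    show "subgroup ?J (add_monoid S)"
    proof (rule S.add.subgroupI)
      show "?J \<subseteq> carrier S" using JI I.a_subset by auto
      show "?J \<noteq> {}" using F.M.zero_closed by blast
      fix x assume "x \<in> ?J"
      then obtain c where c: "c \<in> carrier (free_module S A)" "x = linear_ext S ?M id c" by blast
      have x: "x \<in> carrier S" using c linear_closed[OF lin] I.a_subset by auto
      have "\<ominus>\<^bsub>S\<^esub> x = (\<ominus>\<^bsub>S\<^esub> \<one>\<^bsub>S\<^esub>) \<odot>\<^bsub>?M\<^esub> x" using x by (simp add: S.l_minus)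
      also have "\<dots> = linear_ext S ?M id ((\<ominus>\<^bsub>S\<^esub> \<one>\<^bsub>S\<^esub>) \<odot>\<^bsub>free_module S A\<^esub> c)"
        unfolding c(2) by (rule linear_smult[OF lin _ c(1), symmetric]) simp
      also have "\<dots> \<in> ?J" by (rule imageI[OF F.smult_closed[OF _ c(1)]]) simp
      finally show "\<ominus>\<^bsub>S\<^esub> x \<in> ?J" .
      fix y assume "y \<in> ?J"
      then obtain d where d: "d \<in> carrier (free_module S A)" "y = linear_ext S ?M id d" by blast
      show "x \<oplus>\<^bsub>S\<^esub> y \<in> ?J"
        unfolding c(2) d(2) using linear_add[OF lin c(1) d(1)] F.M.add.m_closed[OF c(1) d(1)]
        by (intro image_eqI[of _ _ "c \<oplus>\<^bsub>free_module S A\<^esub> d"]) simp_all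
    qed
    fix x s assume "x \<in> ?J" and s: "s \<in> carrier S"
    then obtain c where c: "c \<in> carrier (free_module S A)" "x = linear_ext S ?M id c" by blast
    have x: "x \<in> carrier S" using c linear_closed[OF lin] I.a_subset by auto
    have "s \<odot>\<^bsub>?M\<^esub> x \<in> ?J" unfolding c(2) linear_smult[OF lin s c(1), symmetric]
      using F.smult_closed[OF s c(1)] by blast
    thus "s \<otimes>\<^bsub>S\<^esub> x \<in> ?J" by simp
    thus "x \<otimes>\<^bsub>S\<^esub> s \<in> ?J" using S.m_comm[OF x s] by simp
  qed
  moreover have "A \<subseteq> ?J"
  proof
    fix a assume a: "a \<in> A"
    from linear_ext_basis[OF M.module_axioms a id] basis_elem_closed[OF S.is_cring a]
    show "a \<in> ?J" by (metis id_apply image_eqI)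
  qed
  ultimately have "I \<subseteq> ?J" unfolding A(3)[symmetric] using S.genideal_minimal A(3) by metis
  hence "?J = carrier ?M" using JI by auto
  thus ?thesis unfolding fg_module_def using M.module_axioms AI A(2) by auto
qed

lemma ideal_functional:
  assumes "ideal I S" "I \<noteq> {\<zero>\<^bsub>S\<^esub>}"
  obtains f x where "functional S p k (ideal_module I) f" "x \<in> I" "f x = \<one>\<^bsub>k\<^esub>"
proof -
  have "\<not> zero_module (ideal_module I)" using assms(2) by (simp add: zero_module_def)
  from functional_exists[OF fg_ideal[OF assms(1)] this] obtain f x where
    "functional S p k (ideal_module I) f" "x \<in> carrier (ideal_module I)" "f x = \<one>\<^bsub>k\<^esub>" .
  thus thesis using that[of f x] by simp
qed

lemma discrete_valuation_domainI:
  assumes t: "t \<in> carrier S" "\<And>x. x \<in> carrier S \<Longrightarrow> p x = \<zero>\<^bsub>k\<^esub> \<longleftrightarrow> (\<exists>y\<in>carrier S. x = y \<otimes>\<^bsub>S\<^esub> t)"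
    and reg: "\<And>x. x \<in> carrier S \<Longrightarrow> x \<otimes>\<^bsub>S\<^esub> t = \<zero>\<^bsub>S\<^esub> \<Longrightarrow> x = \<zero>\<^bsub>S\<^esub>"
  shows "discrete_valuation_domain S"
proof -
  have pt: "p t = \<zero>\<^bsub>k\<^esub>" using t(2)[OF t(1)] S.one_closed t(1) S.l_one by metis
  have tn: "t [^]\<^bsub>S\<^esub> (n::nat) \<in> carrier S" for n using t(1) by simp
  have reg': "x \<otimes>\<^bsub>S\<^esub> t [^]\<^bsub>S\<^esub> (n::nat) = \<zero>\<^bsub>S\<^esub> \<Longrightarrow> x = \<zero>\<^bsub>S\<^esub>" if "x \<in> carrier S" for x n
  proof (induction n)
    case 0 then show ?case using that by simp
  next
    case (Suc n)
    have "(x \<otimes>\<^bsub>S\<^esub> t [^]\<^bsub>S\<^esub> n) \<otimes>\<^bsub>S\<^esub> t = \<zero>\<^bsub>S\<^esub>" using Suc.prems that t(1) by (simp add: S.m_assoc)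
    from reg[OF _ this] Suc.IH show ?case using that tn by simp
  qed
  have one: "\<one>\<^bsub>S\<^esub> \<noteq> \<zero>\<^bsub>S\<^esub>" using p_simps(4) p_zero k.one_not_zero by metis
  have p1: "p x \<noteq> \<zero>\<^bsub>k\<^esub>" if "y \<in> carrier S" "x \<in> carrier S" "y \<otimes>\<^bsub>S\<^esub> x = \<one>\<^bsub>S\<^esub>" for x y
    using that p_simps(3)[of y x] by auto
  let ?I = "{x \<in> carrier S. \<forall>n::nat. \<exists>y\<in>carrier S. x = y \<otimes>\<^bsub>S\<^esub> t [^]\<^bsub>S\<^esub> n}"
  have I: "ideal ?I S"
  proof (rule idealI[OF S.ring_axioms])
    show "subgroup ?I (add_monoid S)"
    proof (rule S.add.subgroupI)
      have "\<exists>y\<in>carrier S. \<zero>\<^bsub>S\<^esub> = y \<otimes>\<^bsub>S\<^esub> t [^]\<^bsub>S\<^esub> n" for n :: nat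
        by (rule bexI[of _ "\<zero>\<^bsub>S\<^esub>"]) (use tn in auto)
      thus "?I \<noteq> {}" by blast
      fix x assume x: "x \<in> ?I"
      show "\<ominus>\<^bsub>S\<^esub> x \<in> ?I"
      proof (intro CollectI conjI allI)
        fix n :: nat
        obtain y where y: "y \<in> carrier S" "x = y \<otimes>\<^bsub>S\<^esub> t [^]\<^bsub>S\<^esub> n" using x by blast
        show "\<exists>y\<in>carrier S. \<ominus>\<^bsub>S\<^esub> x = y \<otimes>\<^bsub>S\<^esub> t [^]\<^bsub>S\<^esub> n"
          by (rule bexI[of _ "\<ominus>\<^bsub>S\<^esub> y"]) (use y tn in \<open>auto simp: S.l_minus\<close>)
      qed (use x in simp)
      fix z assume z: "z \<in> ?I"
      show "x \<oplus>\<^bsub>S\<^esub> z \<in> ?I"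
      proof (intro CollectI conjI allI)
        fix n :: nat
        obtain y where y: "y \<in> carrier S" "x = y \<otimes>\<^bsub>S\<^esub> t [^]\<^bsub>S\<^esub> n" using x by blast
        obtain w where w: "w \<in> carrier S" "z = w \<otimes>\<^bsub>S\<^esub> t [^]\<^bsub>S\<^esub> n" using z by blast
        show "\<exists>y\<in>carrier S. x \<oplus>\<^bsub>S\<^esub> z = y \<otimes>\<^bsub>S\<^esub> t [^]\<^bsub>S\<^esub> n"
          by (rule bexI[of _ "y \<oplus>\<^bsub>S\<^esub> w"]) (use y w tn in \<open>auto simp: S.l_distr\<close>)
      qed (use x z in simp)
    qed auto
    fix x s assume x: "x \<in> ?I" and s: "s \<in> carrier S"
    show "s \<otimes>\<^bsub>S\<^esub> x \<in> ?I"
    proof (intro CollectI conjI allI)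
      fix n :: nat
      obtain y where y: "y \<in> carrier S" "x = y \<otimes>\<^bsub>S\<^esub> t [^]\<^bsub>S\<^esub> n" using x by blast
      show "\<exists>y\<in>carrier S. s \<otimes>\<^bsub>S\<^esub> x = y \<otimes>\<^bsub>S\<^esub> t [^]\<^bsub>S\<^esub> n"
        by (rule bexI[of _ "s \<otimes>\<^bsub>S\<^esub> y"]) (use y s tn in \<open>auto simp: S.m_assoc\<close>)
    qed (use x s in simp)
    thus "x \<otimes>\<^bsub>S\<^esub> s \<in> ?I" using x s S.m_comm by (metis (no_types, lifting) mem_Collect_eq)
  qed
  have I0: "?I = {\<zero>\<^bsub>S\<^esub>}"
  proof (rule ccontr)
    assume nz: "?I \<noteq> {\<zero>\<^bsub>S\<^esub>}"
    obtain f x where f: "functional S p k (ideal_module ?I) f" "x \<in> ?I" "f x = \<one>\<^bsub>k\<^esub>"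
      by (rule ideal_functional[OF I nz])
    have x: "x \<in> carrier S" using f(2) by simp
    have "\<exists>y\<in>carrier S. x = y \<otimes>\<^bsub>S\<^esub> t [^]\<^bsub>S\<^esub> Suc 0" using f(2) by blast
    then obtain y where y: "y \<in> carrier S" "x = y \<otimes>\<^bsub>S\<^esub> t" using t(1) by auto
    have "\<exists>w\<in>carrier S. y = w \<otimes>\<^bsub>S\<^esub> t [^]\<^bsub>S\<^esub> n" for n :: nat
    proof -
      obtain w where w: "w \<in> carrier S" "x = w \<otimes>\<^bsub>S\<^esub> t [^]\<^bsub>S\<^esub> Suc n" using f(2) by blast
      have "(y \<ominus>\<^bsub>S\<^esub> w \<otimes>\<^bsub>S\<^esub> t [^]\<^bsub>S\<^esub> n) \<otimes>\<^bsub>S\<^esub> t = y \<otimes>\<^bsub>S\<^esub> t \<ominus>\<^bsub>S\<^esub> w \<otimes>\<^bsub>S\<^esub> t [^]\<^bsub>S\<^esub> Suc n"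
        using y(1) w(1) t(1) tn by (simp add: a_minus_def S.l_distr S.l_minus S.m_assoc)
      also have "\<dots> = \<zero>\<^bsub>S\<^esub>" using y(2) w(2) x by (simp add: a_minus_def S.r_neg)
      finally have "y \<ominus>\<^bsub>S\<^esub> w \<otimes>\<^bsub>S\<^esub> t [^]\<^bsub>S\<^esub> n = \<zero>\<^bsub>S\<^esub>" using reg y(1) w(1) tn by simp
      hence "y = w \<otimes>\<^bsub>S\<^esub> t [^]\<^bsub>S\<^esub> n" using y(1) w(1) tn by simp
      thus ?thesis using w(1) by blast
    qed
    hence yI: "y \<in> ?I" using y(1) by blast
    have "f x = p t \<otimes>\<^bsub>k\<^esub> f y"
      using functionalD(3)[OF f(1) t(1), of y] yI y t(1) S.m_comm by simp
    also have "\<dots> = \<zero>\<^bsub>k\<^esub>" using pt functionalD(1)[OF f(1), of y] yI by simp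
    finally show False using f(3) k.one_not_zero by simp
  qed
  have fac: "\<exists>n u. u \<in> carrier S \<and> p u \<noteq> \<zero>\<^bsub>k\<^esub> \<and> x = u \<otimes>\<^bsub>S\<^esub> t [^]\<^bsub>S\<^esub> (n::nat)"
    if x: "x \<in> carrier S" "x \<noteq> \<zero>\<^bsub>S\<^esub>" for x
  proof -
    let ?P = "\<lambda>n::nat. \<not> (\<exists>y\<in>carrier S. x = y \<otimes>\<^bsub>S\<^esub> t [^]\<^bsub>S\<^esub> n)"
    obtain n0 where n0: "?P n0" using x I0 by blast
    have P0: "\<not> ?P 0" using x by simp
    obtain n where n: "?P (Suc n)" "\<not> ?P n" using ex_least_nat_less[of ?P, OF n0 P0] by blast
    then obtain u where u: "u \<in> carrier S" "x = u \<otimes>\<^bsub>S\<^esub> t [^]\<^bsub>S\<^esub> n" by blast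
    have "p u \<noteq> \<zero>\<^bsub>k\<^esub>"
    proof
      assume "p u = \<zero>\<^bsub>k\<^esub>"
      then obtain y where y: "y \<in> carrier S" "u = y \<otimes>\<^bsub>S\<^esub> t" using t(2)[OF u(1)] by blast
      hence "x = y \<otimes>\<^bsub>S\<^esub> t [^]\<^bsub>S\<^esub> Suc n" using u t(1) tn by (simp add: S.m_assoc S.m_comm[of t])
      thus False using n(1) y(1) by blast
    qed
    thus ?thesis using u by blast
  qed
  have dom: "domain S"
  proof (rule domain.intro[OF S.is_cring], rule domain_axioms.intro)
    show "\<one>\<^bsub>S\<^esub> \<noteq> \<zero>\<^bsub>S\<^esub>" by (rule one)
    fix x y assume xy: "x \<otimes>\<^bsub>S\<^esub> y = \<zero>\<^bsub>S\<^esub>" "x \<in> carrier S" "y \<in> carrier S"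
    show "x = \<zero>\<^bsub>S\<^esub> \<or> y = \<zero>\<^bsub>S\<^esub>"
    proof (rule ccontr)
      assume nz: "\<not> (x = \<zero>\<^bsub>S\<^esub> \<or> y = \<zero>\<^bsub>S\<^esub>)"
      obtain n u where u: "u \<in> carrier S" "p u \<noteq> \<zero>\<^bsub>k\<^esub>" "x = u \<otimes>\<^bsub>S\<^esub> t [^]\<^bsub>S\<^esub> (n::nat)"
        using fac[OF xy(2)] nz by blast
      obtain v where v: "v \<in> carrier S" "v \<otimes>\<^bsub>S\<^esub> u = \<one>\<^bsub>S\<^esub>" by (rule unit_if_residue_nonzero[OF u(1,2)])
      have "v \<otimes>\<^bsub>S\<^esub> (x \<otimes>\<^bsub>S\<^esub> y) = (v \<otimes>\<^bsub>S\<^esub> u) \<otimes>\<^bsub>S\<^esub> (y \<otimes>\<^bsub>S\<^esub> t [^]\<^bsub>S\<^esub> n)"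
        unfolding u(3) using v(1) u(1) xy(3) tn by (simp add: S.m_assoc S.m_comm[of "t [^]\<^bsub>S\<^esub> n"])
      hence "y \<otimes>\<^bsub>S\<^esub> t [^]\<^bsub>S\<^esub> n = \<zero>\<^bsub>S\<^esub>" unfolding v(2) xy(1) using v(1) xy(3) tn by simp
      thus False using reg'[OF xy(3)] nz by blast
    qed
  qed
  have "principal_domain S"
  proof (rule principal_domain.intro[OF dom], rule principal_domain_axioms.intro)
    fix I assume I: "ideal I S"
    interpret I: ideal I S by (rule I)
    show "\<exists>a\<in>carrier S. I = PIdl\<^bsub>S\<^esub> a"
    proof (cases "I = {\<zero>\<^bsub>S\<^esub>}")
      case True
      have "PIdl\<^bsub>S\<^esub> \<zero>\<^bsub>S\<^esub> = {\<zero>\<^bsub>S\<^esub>}" by (auto simp: cgenideal_def intro!: exI[of _ "\<zero>\<^bsub>S\<^esub>"])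
      thus ?thesis using True by (intro bexI[of _ "\<zero>\<^bsub>S\<^esub>"]) auto
    next
      case False
      have unit: "t [^]\<^bsub>S\<^esub> n \<in> I" if u: "u \<in> carrier S" "p u \<noteq> \<zero>\<^bsub>k\<^esub>" "u \<otimes>\<^bsub>S\<^esub> t [^]\<^bsub>S\<^esub> n \<in> I" for u and n :: nat
      proof -
        obtain v where v: "v \<in> carrier S" "v \<otimes>\<^bsub>S\<^esub> u = \<one>\<^bsub>S\<^esub>" by (rule unit_if_residue_nonzero[OF u(1,2)])
        have "v \<otimes>\<^bsub>S\<^esub> (u \<otimes>\<^bsub>S\<^esub> t [^]\<^bsub>S\<^esub> n) \<in> I" by (rule I.I_l_closed[OF u(3) v(1)])
        thus ?thesis using v u(1) tn by (simp add: S.m_assoc[symmetric])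
      qed
      let ?P = "\<lambda>n::nat. t [^]\<^bsub>S\<^esub> n \<in> I"
      obtain x where "x \<in> I" "x \<noteq> \<zero>\<^bsub>S\<^esub>" using False I.zero_closed by blast
      moreover from this obtain n u where "u \<in> carrier S" "p u \<noteq> \<zero>\<^bsub>k\<^esub>" "x = u \<otimes>\<^bsub>S\<^esub> t [^]\<^bsub>S\<^esub> (n::nat)"
        using fac I.a_subset by blast
      ultimately have "?P n" using unit by blast
      hence N: "?P (LEAST n. ?P n)" by (rule LeastI)
      let ?a = "t [^]\<^bsub>S\<^esub> (LEAST n. ?P n)"
      have "I \<subseteq> PIdl\<^bsub>S\<^esub> ?a"
      proof
        fix x assume x: "x \<in> I"
        show "x \<in> PIdl\<^bsub>S\<^esub> ?a"
        proof (cases "x = \<zero>\<^bsub>S\<^esub>")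
          case True
          have "\<zero>\<^bsub>S\<^esub> = \<zero>\<^bsub>S\<^esub> \<otimes>\<^bsub>S\<^esub> ?a" by (rule S.l_null[OF tn, symmetric])
          thus ?thesis using S.zero_closed unfolding True cgenideal_def by blast
        next
          case nz: False
          have "x \<in> carrier S" using x I.a_subset by blast
          then obtain n u where u: "u \<in> carrier S" "p u \<noteq> \<zero>\<^bsub>k\<^esub>" "x = u \<otimes>\<^bsub>S\<^esub> t [^]\<^bsub>S\<^esub> (n::nat)"
            using fac nz by blast
          have "?P n" using unit[OF u(1,2)] x u(3) by blast
          hence "(LEAST n. ?P n) \<le> n" by (rule Least_le)
          then obtain j where j: "n = j + (LEAST n. ?P n)" by (metis le_Suc_ex add.commute)
          have "x = (u \<otimes>\<^bsub>S\<^esub> t [^]\<^bsub>S\<^esub> j) \<otimes>\<^bsub>S\<^esub> ?a"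
            unfolding u(3) using S.nat_pow_mult[OF t(1), of j "LEAST n. ?P n"] j u(1) tn by (simp add: S.m_assoc)
          thus ?thesis unfolding cgenideal_def using u(1) tn by blast
        qed
      qed
      moreover have "PIdl\<^bsub>S\<^esub> ?a \<subseteq> I" using I.I_l_closed[OF N] unfolding cgenideal_def by blast
      ultimately show ?thesis using tn by blast
    qed
  qed
  moreover have "\<not> field S"
  proof
    assume "field S" then interpret F: field S .
    have "t \<noteq> \<zero>\<^bsub>S\<^esub>" using reg[OF S.one_closed] one t(1) by auto
    hence "t \<in> Units S" using F.field_Units t(1) by simp
    then obtain y where "y \<in> carrier S" "y \<otimes>\<^bsub>S\<^esub> t = \<one>\<^bsub>S\<^esub>" by (auto simp: Units_def)
    thus False using p1[of y t] t(1) pt by blast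
  qed
  ultimately show ?thesis using S.local_ring_axioms by (simp add: discrete_valuation_domain_def)
qed

end

section \<open>Syzygies over a pullback\<close>

lemma fin_supp_pure:
  assumes "module R N" "f \<in> carrier (free_module R B)" "y \<in> carrier N"
  shows "(\<lambda>b. f b \<odot>\<^bsub>N\<^esub> y) \<in> fin_supp N B"
proof -
  interpret N: module R N by fact
  show ?thesis
    by (rule fin_suppI[of _ _ "{b. f b \<noteq> \<zero>\<^bsub>R\<^esub>}"])
       (use assms(3) free_module_finite[OF assms(2)] free_module_support[OF assms(2)]
          N.smult_closed[OF free_module_closed[OF assms(2)] assms(3)] in auto)
qed

lemma tensor_eval_cong:
  assumes "balanced R K N A \<beta>" "linear R (free_module R B) K \<psi>" "g \<in> fin_supp N B"
    "\<And>f. f \<in> carrier (free_module R B) \<Longrightarrow> \<phi> f = \<psi> f"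
  shows "tensor_eval R N A \<beta> \<phi> g = tensor_eval R N A \<beta> \<psi> g"
proof -
  interpret A: abelian_group A by (rule balancedD(3)[OF assms(1)])
  have e: "basis_elem R b \<in> carrier (free_module R B)" if "b \<in> {b. g b \<noteq> \<zero>\<^bsub>N\<^esub>}" for b
    by (rule basis_elem_closed[OF module_cring[OF balancedD(1)[OF assms(1)]]])
       (use fin_suppD(3)[OF assms(3)] that in auto)
  show ?thesis unfolding tensor_eval_def
    by (rule A.finsum_cong'[OF refl])
       (use assms(4)[OF e] balanced_closed[OF assms(1) linear_closed[OF assms(2) e] fin_suppD(1)[OF assms(3)]] in auto)
qed

lemma tensor_eval_zero_map:
  assumes "balanced R K N A \<beta>" "g \<in> fin_supp N B"
    "\<And>f. f \<in> carrier (free_module R B) \<Longrightarrow> \<phi> f = \<zero>\<^bsub>K\<^esub>"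
  shows "tensor_eval R N A \<beta> \<phi> g = \<zero>\<^bsub>A\<^esub>"
proof -
  interpret A: abelian_group A by (rule balancedD(3)[OF assms(1)])
  have K: "abelian_group K" by (rule module_abelian_group[OF balancedD(1)[OF assms(1)]])
  have e: "basis_elem R b \<in> carrier (free_module R B)" if "b \<in> {b. g b \<noteq> \<zero>\<^bsub>N\<^esub>}" for b
    by (rule basis_elem_closed[OF module_cring[OF balancedD(1)[OF assms(1)]]])
       (use fin_suppD(3)[OF assms(2)] that in auto)
  have "\<beta> (\<phi> (basis_elem R b)) (g b) = \<zero>\<^bsub>A\<^esub>" if "b \<in> {b. g b \<noteq> \<zero>\<^bsub>N\<^esub>}" for b
    unfolding assms(3)[OF e[OF that]]
    by (rule additive_zero[OF K A.abelian_group_axioms balancedD(5)[OF assms(1) fin_suppD(1)[OF assms(2)]]])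
  hence "tensor_eval R N A \<beta> \<phi> g = (\<Oplus>\<^bsub>A\<^esub>b\<in>{b. g b \<noteq> \<zero>\<^bsub>N\<^esub>}. \<zero>\<^bsub>A\<^esub>)"
    unfolding tensor_eval_def by (intro A.finsum_cong') auto
  thus ?thesis by simp
qed

lemma functional_product_balanced:
  assumes K: "module R K" and N: "module R N" and k: "field k"
    and f: "functional R \<pi> k K f" and g: "functional R \<pi> k N g"
    and \<pi>: "\<And>r. r \<in> carrier R \<Longrightarrow> \<pi> r \<in> carrier k"
  shows "balanced R K N k (\<lambda>x y. f x \<otimes>\<^bsub>k\<^esub> g y)"
proof -
  interpret k: field k by (rule k)
  note f = functionalD[OF f] and g = functionalD[OF g]
  show ?thesis unfolding balanced_def
  proof (intro conjI ballI additiveI K N k.abelian_group_axioms)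
    fix r x y assume "r \<in> carrier R" "x \<in> carrier K" "y \<in> carrier N"
    thus "f (r \<odot>\<^bsub>K\<^esub> x) \<otimes>\<^bsub>k\<^esub> g y = f x \<otimes>\<^bsub>k\<^esub> g (r \<odot>\<^bsub>N\<^esub> y)"
      using f(1,3) g(1,3) \<pi> by (simp add: k.m_ac)
  qed (use f(1,2) g(1,2) in \<open>simp_all add: k.l_distr k.r_distr\<close>)
qed

lemma tor_vanishes_0_obstruction:
  assumes res: "free_resolution R M B d e" and N: "module R N" and k: "field k"
    and f: "functional R \<pi> k M f" and g: "functional R \<pi> k N g"
    and \<pi>: "\<And>r. r \<in> carrier R \<Longrightarrow> \<pi> r \<in> carrier k"
    and x: "x \<in> carrier M" "f x = \<one>\<^bsub>k\<^esub>" and y: "y \<in> carrier N" "g y = \<one>\<^bsub>k\<^esub>"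
  shows "\<not> tor_vanishes R N B d 0"
proof
  assume van: "tor_vanishes R N B d 0"
  interpret k: field k by (rule k)
  note r = free_resolutionD[OF res]
  note bal = functional_product_balanced[OF r(1) N k f g \<pi>]
  let ?\<beta> = "\<lambda>x y. f x \<otimes>\<^bsub>k\<^esub> g y"
  obtain u where u: "u \<in> carrier (free_module R (B 0))" "x = e u" using r(3) x(1) by blast
  let ?g = "\<lambda>b. u b \<odot>\<^bsub>N\<^esub> y"
  obtain h where h: "h \<in> fin_supp N (B (Suc 0))" "extend_scalars R N (d 0) h = ?g"
    using van fin_supp_pure[OF N u(1) y(1)] unfolding tor_vanishes_def by blast
  have "tensor_eval R N k ?\<beta> e ?g = \<one>\<^bsub>k\<^esub>"
    using tensor_eval_pure[OF bal r(2) u(1) y(1)] x(2) y(2) u(2) by simp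
  moreover have "tensor_eval R N k ?\<beta> e (extend_scalars R N (d 0) h) = tensor_eval R N k ?\<beta> (\<lambda>f. e (d 0 f)) h"
    by (rule tensor_eval_extend_scalars[OF bal r(2) r(4) h(1)])
  moreover have "tensor_eval R N k ?\<beta> (\<lambda>f. e (d 0 f)) h = \<zero>\<^bsub>k\<^esub>"
    by (rule tensor_eval_zero_map[OF bal h(1)]) (use r(5) in auto)
  ultimately show False using k.one_not_zero h(2) by simp
qed

lemma tor_vanishes_1_pairing:
  assumes res: "free_resolution R M B d e" and van: "tor_vanishes R N B d (Suc 0)"
    and \<phi>: "linear R (free_module R A) (free_module R (B 0)) \<phi>"
    and e\<phi>: "\<And>f. f \<in> carrier (free_module R A) \<Longrightarrow> e (\<phi> f) = \<zero>\<^bsub>M\<^esub>"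
    and w: "w \<in> fin_supp N A" and ext0: "extend_scalars R N \<phi> w = (\<lambda>_. \<zero>\<^bsub>N\<^esub>)"
    and bal: "balanced R (kernel_module (free_module R (B 0)) M e) N C \<beta>"
  shows "tensor_eval R N C \<beta> \<phi> w = \<zero>\<^bsub>C\<^esub>"
proof -
  note r = free_resolutionD[OF res]
  have F: "module R (free_module R (B n))" for n by (rule free_module_is_module[OF module_cring[OF r(1)]])
  have N: "module R N" by (rule balancedD(2)[OF bal])
  let ?K = "kernel_module (free_module R (B 0)) M e"
  have "\<phi> f \<in> d 0 ` carrier (free_module R (B (Suc 0)))" if "f \<in> carrier (free_module R A)" for f
    unfolding r(5) using e\<phi>[OF that] linear_closed[OF \<phi> that] by simp
  then obtain L where L: "linear R (free_module R A) (free_module R (B (Suc 0))) L"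
    "\<And>f. f \<in> carrier (free_module R A) \<Longrightarrow> d 0 (L f) = \<phi> f"
    using free_module_lift[OF F F \<phi> r(4)] by metis
  have g: "extend_scalars R N L w \<in> fin_supp N (B (Suc 0))" by (rule extend_scalars_closed[OF N L(1) w])
  have "extend_scalars R N (d 0) (extend_scalars R N L w) = extend_scalars R N (\<lambda>f. d 0 (L f)) w"
    by (rule extend_scalars_compose[OF N L(1) r(4) w])
  also have "\<dots> = extend_scalars R N \<phi> w" by (rule extend_scalars_cong[OF N \<phi> w L(2)])
  finally obtain h where h: "h \<in> fin_supp N (B (Suc (Suc 0)))"
    "extend_scalars R N (d (Suc 0)) h = extend_scalars R N L w"
    using van g ext0 unfolding tor_vanishes_def by (metis nat.inject)
  have dK: "linear R (free_module R (B (Suc 0))) ?K (d 0)"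
    by (rule linear_into_submodule[OF r(4)]) (use r(5) in auto)
  have \<phi>K: "linear R (free_module R A) ?K \<phi>"
    by (rule linear_into_submodule[OF \<phi>]) (use e\<phi> linear_closed[OF \<phi>] in auto)
  have "tensor_eval R N C \<beta> \<phi> w = tensor_eval R N C \<beta> (\<lambda>f. d 0 (L f)) w"
    by (rule tensor_eval_cong[OF bal linear_compose[OF L(1) dK] w]) (simp add: L(2))
  also have "\<dots> = tensor_eval R N C \<beta> (d 0) (extend_scalars R N L w)"
    by (rule tensor_eval_extend_scalars[OF bal dK L(1) w, symmetric])
  also have "\<dots> = tensor_eval R N C \<beta> (\<lambda>f. d 0 (d (Suc 0) f)) h"
    unfolding h(2)[symmetric] by (rule tensor_eval_extend_scalars[OF bal dK r(4) h(1)])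
  also have "\<dots> = \<zero>\<^bsub>C\<^esub>"
    by (rule tensor_eval_zero_map[OF bal h(1)]) (use r(6)[of 0] in auto)
  finally show ?thesis .
qed

lemma tor_vanishes_1_obstruction:
  assumes res: "free_resolution R M B d e" and N: "module R N" and k: "field k"
    and f: "functional R \<pi> k (kernel_module (free_module R (B 0)) M e) f" and g: "functional R \<pi> k N g"
    and \<pi>: "\<And>r. r \<in> carrier R \<Longrightarrow> \<pi> r \<in> carrier k"
    and u: "u \<in> carrier (free_module R (B 0))" "e u = \<zero>\<^bsub>M\<^esub>" "f u = \<one>\<^bsub>k\<^esub>"
    and y: "y \<in> carrier N" "g y = \<one>\<^bsub>k\<^esub>" and uy: "\<And>c. u c \<odot>\<^bsub>N\<^esub> y = \<zero>\<^bsub>N\<^esub>"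
  shows "\<not> tor_vanishes R N B d (Suc 0)"
proof
  assume van: "tor_vanishes R N B d (Suc 0)"
  interpret k: field k by (rule k)
  interpret N: module R N by (rule N)
  note r = free_resolutionD[OF res]
  let ?K = "kernel_module (free_module R (B 0)) M e"
  let ?\<beta> = "\<lambda>x y. f x \<otimes>\<^bsub>k\<^esub> g y"
  have F: "module R (free_module R (B 0))" by (rule free_module_is_module[OF N.R.is_cring])
  have K: "module R ?K" by (rule kernel_module_is_module[OF F r(1,2)])
  note bal = functional_product_balanced[OF K N k f g \<pi>]
  let ?\<phi> = "linear_ext R (free_module R (B 0)) (\<lambda>_. u)"
  have v: "(\<lambda>_. u) \<in> {()} \<rightarrow> carrier (free_module R (B 0))" using u by simp
  have \<phi>: "linear R (free_module R {()}) (free_module R (B 0)) ?\<phi>" by (rule linear_ext_linear[OF F v])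
  have b: "basis_elem R () \<in> carrier (free_module R {()})" by (rule basis_elem_closed[OF N.R.is_cring]) simp
  have \<phi>b: "?\<phi> (basis_elem R ()) = u" by (rule linear_ext_basis[OF F _ v]) simp
  have "linear R (free_module R {()}) M (\<lambda>_. \<zero>\<^bsub>M\<^esub>)"
  proof -
    interpret M: module R M by (rule r(1))
    show ?thesis by (rule linearI) auto
  qed
  hence e\<phi>: "e (?\<phi> f) = \<zero>\<^bsub>M\<^esub>" if "f \<in> carrier (free_module R {()})" for f
    by (rule linear_free_eqI[OF r(1) linear_compose[OF \<phi> r(2)] _ _ that]) (simp add: \<phi>b u(2))
  let ?w = "\<lambda>b. basis_elem R () b \<odot>\<^bsub>N\<^esub> y"
  have w: "?w \<in> fin_supp N {()}" by (rule fin_supp_pure[OF N b y(1)])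
  have "extend_scalars R N ?\<phi> ?w = (\<lambda>_. \<zero>\<^bsub>N\<^esub>)"
    unfolding extend_scalars_pure[OF N \<phi> b y(1)] \<phi>b uy ..
  from tor_vanishes_1_pairing[OF res van \<phi> e\<phi> w this bal]
  have "tensor_eval R N k ?\<beta> ?\<phi> ?w = \<zero>\<^bsub>k\<^esub>" .
  moreover have \<phi>K: "linear R (free_module R {()}) ?K ?\<phi>"
    by (rule linear_into_submodule[OF \<phi>]) (use e\<phi> linear_closed[OF \<phi>] in auto)
  have "tensor_eval R N k ?\<beta> ?\<phi> ?w = f (?\<phi> (basis_elem R ())) \<otimes>\<^bsub>k\<^esub> g y"
    by (rule tensor_eval_pure[OF bal \<phi>K b y(1)])
  moreover have "f (?\<phi> (basis_elem R ())) \<otimes>\<^bsub>k\<^esub> g y = \<one>\<^bsub>k\<^esub>" unfolding \<phi>b u(3) y(2) by simp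
  ultimately show False using k.one_not_zero by metis
qed

text \<open>An element \<open>x\<close> outside \<open>\<mm>M\<close>, as witnessed by the functional \<open>f\<close>, on which \<open>R\<close> acts through \<open>S\<close>.\<close>

definition detected where
  "detected R S k a p M x f \<longleftrightarrow> functional R (\<lambda>r. p (a r)) k M f \<and> x \<in> carrier M \<and> f x = \<one>\<^bsub>k\<^esub> \<and>
     (\<forall>r\<in>carrier R. a r = \<zero>\<^bsub>S\<^esub> \<longrightarrow> r \<odot>\<^bsub>M\<^esub> x = \<zero>\<^bsub>M\<^esub>)"

lemma detectedD:
  assumes "detected R S k a p M x f"
  shows "functional R (\<lambda>r. p (a r)) k M f" "x \<in> carrier M" "f x = \<one>\<^bsub>k\<^esub>"
    "r \<in> carrier R \<Longrightarrow> a r = \<zero>\<^bsub>S\<^esub> \<Longrightarrow> r \<odot>\<^bsub>M\<^esub> x = \<zero>\<^bsub>M\<^esub>"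
  using assms by (auto simp: detected_def)

abbreviation residue_ideal_module where
  "residue_ideal_module T k b q \<equiv>
     restrict_scalars b ((ring_module T)\<lparr>carrier := {x \<in> carrier T. q x = \<zero>\<^bsub>k\<^esub>}\<rparr>)"

locale pullback = S: residue_field S k p + T: residue_field T k q + R: cring R
  for S :: "'s ring" and T :: "'t ring" and k :: "'k ring" and p q and R :: "'r ring" +
  fixes a :: "'r \<Rightarrow> 's" and b :: "'r \<Rightarrow> 't"
  assumes a_hom: "a \<in> ring_hom R S" and b_hom: "b \<in> ring_hom R T"
    and pa_qb: "r \<in> carrier R \<Longrightarrow> p (a r) = q (b r)"
    and pullback: "s \<in> carrier S \<Longrightarrow> t \<in> carrier T \<Longrightarrow> p s = q t \<Longrightarrow> \<exists>r\<in>carrier R. a r = s \<and> b r = t"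
    and jointly_inj: "r \<in> carrier R \<Longrightarrow> r' \<in> carrier R \<Longrightarrow> a r = a r' \<Longrightarrow> b r = b r' \<Longrightarrow> r = r'"
begin

lemma swap: "pullback T S k q p R b a"
proof (intro pullback.intro pullback_axioms.intro T.residue_field_axioms S.residue_field_axioms
    R.is_cring b_hom a_hom)
  show "q (b r) = p (a r)" if "r \<in> carrier R" for r using pa_qb[OF that] by simp
  show "\<exists>r\<in>carrier R. b r = t \<and> a r = s" if "t \<in> carrier T" "s \<in> carrier S" "q t = p s" for s t
    using pullback[OF that(2,1) that(3)[symmetric]] by blast
  show "r = r'" if "r \<in> carrier R" "r' \<in> carrier R" "b r = b r'" "a r = a r'" for r r'
    by (rule jointly_inj[OF that(1,2,4,3)])
qed

lemma ab_simps [simp]: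
  "r \<in> carrier R \<Longrightarrow> a r \<in> carrier S" "r \<in> carrier R \<Longrightarrow> b r \<in> carrier T"
  "r \<in> carrier R \<Longrightarrow> r' \<in> carrier R \<Longrightarrow> a (r \<oplus>\<^bsub>R\<^esub> r') = a r \<oplus>\<^bsub>S\<^esub> a r'"
  "r \<in> carrier R \<Longrightarrow> r' \<in> carrier R \<Longrightarrow> b (r \<oplus>\<^bsub>R\<^esub> r') = b r \<oplus>\<^bsub>T\<^esub> b r'"
  "r \<in> carrier R \<Longrightarrow> r' \<in> carrier R \<Longrightarrow> a (r \<otimes>\<^bsub>R\<^esub> r') = a r \<otimes>\<^bsub>S\<^esub> a r'"
  "r \<in> carrier R \<Longrightarrow> r' \<in> carrier R \<Longrightarrow> b (r \<otimes>\<^bsub>R\<^esub> r') = b r \<otimes>\<^bsub>T\<^esub> b r'"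
  using ring_hom_closed[OF a_hom] ring_hom_add[OF a_hom] ring_hom_mult[OF a_hom]
    ring_hom_closed[OF b_hom] ring_hom_add[OF b_hom] ring_hom_mult[OF b_hom] by auto

lemma residue_closed: "r \<in> carrier R \<Longrightarrow> p (a r) \<in> carrier k"
  by simp

lemma functional_swap:
  "functional R (\<lambda>r. p (a r)) k M f \<longleftrightarrow> functional R (\<lambda>r. q (b r)) k M f"
  using pa_qb by (auto simp: linear_def additive_def)

text \<open>The element \<open>(0, t)\<close> of the pullback; unspecified unless \<open>q t = 0\<close>.\<close>

definition embed where
  "embed t = (SOME r. r \<in> carrier R \<and> a r = \<zero>\<^bsub>S\<^esub> \<and> b r = t)"

lemma embed:
  assumes "t \<in> carrier T" "q t = \<zero>\<^bsub>k\<^esub>"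
  shows "embed t \<in> carrier R" "a (embed t) = \<zero>\<^bsub>S\<^esub>" "b (embed t) = t"
proof -
  have "\<exists>r. r \<in> carrier R \<and> a r = \<zero>\<^bsub>S\<^esub> \<and> b r = t"
    using pullback[of "\<zero>\<^bsub>S\<^esub>" t] assms by auto
  from someI_ex[OF this] show "embed t \<in> carrier R" "a (embed t) = \<zero>\<^bsub>S\<^esub>" "b (embed t) = t"
    unfolding embed_def by auto
qed

lemma embed_eqI: "r \<in> carrier R \<Longrightarrow> a r = \<zero>\<^bsub>S\<^esub> \<Longrightarrow> q (b r) = \<zero>\<^bsub>k\<^esub> \<Longrightarrow> embed (b r) = r"
  using jointly_inj embed[of "b r"] by simp

abbreviation "TR \<equiv> restrict_scalars b (ring_module T)"
abbreviation "nR \<equiv> residue_ideal_module T k b q"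
abbreviation "kR \<equiv> restrict_scalars (\<lambda>r. p (a r)) (ring_module k)"

lemma TR_module: "module R TR"
  by (rule restrict_scalars_is_module[OF R.is_cring b_hom ring_module_is_module[OF T.S.is_cring]])

lemma nR_module: "module R nR"
  by (rule restrict_scalars_is_module[OF R.is_cring b_hom T.ideal_module_is_module[OF T.residue_ideal]])

lemma kR_module: "module R kR"
proof (rule restrict_scalars_is_module[OF R.is_cring _ ring_module_is_module[OF S.k.is_cring]])
  show "(\<lambda>r. p (a r)) \<in> ring_hom R k"
    using ring_hom_one[OF a_hom] by (intro ring_hom_memI) auto
qed

lemma residue_linear: "linear R TR kR q"
  by (rule linearI) (auto simp: pa_qb)

text \<open>Freeness of \<open>F\<^sub>0\<close> lets a functional on \<open>M\<close> lift to \<open>T\<close>; the lift sends relations into the maximal ideal.\<close>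

lemma lift_functional:
  assumes res: "free_resolution R M B d e" and f: "functional R (\<lambda>r. p (a r)) k M f"
  obtains \<psi> where "linear R (free_module R (B 0)) TR \<psi>"
    "\<forall>x\<in>carrier (free_module R (B 0)). q (\<psi> x) = f (e x)"
proof -
  note r = free_resolutionD[OF res]
  have "f (e x) \<in> q ` carrier TR" if "x \<in> carrier (free_module R (B 0))" for x
    using functionalD(1)[OF f linear_closed[OF r(2) that]] T.surj by simp
  then obtain \<psi> where "linear R (free_module R (B 0)) TR \<psi>"
    "\<And>x. x \<in> carrier (free_module R (B 0)) \<Longrightarrow> q (\<psi> x) = f (e x)"
    using free_module_lift[OF kR_module TR_module linear_compose[OF r(2) f] residue_linear] by metis
  thus thesis using that by blast
qed

lemma lift_functional_kernel:
  assumes res: "free_resolution R M B d e" and f: "functional R (\<lambda>r. p (a r)) k M f"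
    and \<psi>: "linear R (free_module R (B 0)) TR \<psi>"
    "\<And>x. x \<in> carrier (free_module R (B 0)) \<Longrightarrow> q (\<psi> x) = f (e x)"
  shows "linear R (kernel_module (free_module R (B 0)) M e) nR \<psi>"
proof -
  note r = free_resolutionD[OF res]
  have f0: "f \<zero>\<^bsub>M\<^esub> = \<zero>\<^bsub>k\<^esub>" using linear_zero[OF r(1) kR_module f] by simp
  show ?thesis
  proof (rule linearI)
    fix x assume x: "x \<in> carrier (kernel_module (free_module R (B 0)) M e)"
    thus "\<psi> x \<in> carrier nR" using linear_closed[OF \<psi>(1), of x] \<psi>(2)[of x] f0 by simp
  qed (use linear_add[OF \<psi>(1)] linear_smult[OF \<psi>(1)] in auto)
qed

lemma normalized_lift:
  assumes res: "free_resolution R M B d e" and det: "detected R S k a p M x f"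
  obtains u \<psi> where "u \<in> carrier (free_module R (B 0))" "e u = x"
    "linear R (free_module R (B 0)) TR \<psi>" "\<psi> u = \<one>\<^bsub>T\<^esub>"
    "linear R (kernel_module (free_module R (B 0)) M e) nR \<psi>"
proof -
  note r = free_resolutionD[OF res] and D = detectedD[OF det]
  have "x \<in> e ` carrier (free_module R (B 0))" unfolding r(3) by (rule D(2))
  then obtain u where u: "u \<in> carrier (free_module R (B 0))" "e u = x" by blast
  obtain \<psi> where \<psi>: "linear R (free_module R (B 0)) TR \<psi>"
    "\<forall>x\<in>carrier (free_module R (B 0)). q (\<psi> x) = f (e x)"
    by (rule lift_functional[OF res D(1)])
  have \<psi>u: "\<psi> u \<in> carrier T" using linear_closed[OF \<psi>(1) u(1)] by simp
  have "q (\<psi> u) \<noteq> \<zero>\<^bsub>k\<^esub>" using \<psi>(2)[rule_format, OF u(1)] u(2) D(3) S.k.one_not_zero by simp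
  then obtain v where v: "v \<in> carrier T" "v \<otimes>\<^bsub>T\<^esub> \<psi> u = \<one>\<^bsub>T\<^esub>" by (rule T.unit_if_residue_nonzero[OF \<psi>u])
  have "linear R TR TR (\<lambda>z. v \<otimes>\<^bsub>T\<^esub> z)"
    by (rule linearI) (use v(1) in \<open>auto simp: T.S.r_distr T.S.m_lcomm\<close>)
  note lin = linear_compose[OF \<psi>(1) this]
  have "q v = \<one>\<^bsub>k\<^esub>"
  proof -
    have "q (v \<otimes>\<^bsub>T\<^esub> \<psi> u) = q v" using v(1) \<psi>u \<psi>(2)[rule_format, OF u(1)] u(2) D(3) by simp
    thus ?thesis unfolding v(2) by simp
  qed
  hence "q (v \<otimes>\<^bsub>T\<^esub> \<psi> y) = f (e y)" if "y \<in> carrier (free_module R (B 0))" for y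
    using v(1) linear_closed[OF \<psi>(1) that] \<psi>(2)[rule_format, OF that] functionalD(1)[OF D(1) linear_closed[OF r(2) that]] by simp
  from lift_functional_kernel[OF res D(1) lin this] that[OF u lin v(2)] show thesis by simp
qed

lemma embed_smult_kernel:
  assumes res: "free_resolution R M B d e" and det: "detected R S k a p M x f"
    and u: "u \<in> carrier (free_module R (B 0))" "e u = x" and t: "t \<in> carrier T" "q t = \<zero>\<^bsub>k\<^esub>"
  shows "embed t \<odot>\<^bsub>free_module R (B 0)\<^esub> u \<in> carrier (free_module R (B 0))"
    "e (embed t \<odot>\<^bsub>free_module R (B 0)\<^esub> u) = \<zero>\<^bsub>M\<^esub>"
proof -
  note r = free_resolutionD[OF res]
  interpret F: module R "free_module R (B 0)" by (rule free_module_is_module[OF R.is_cring])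
  show "embed t \<odot>\<^bsub>free_module R (B 0)\<^esub> u \<in> carrier (free_module R (B 0))"
    by (rule F.smult_closed[OF embed(1)[OF t] u(1)])
  show "e (embed t \<odot>\<^bsub>free_module R (B 0)\<^esub> u) = \<zero>\<^bsub>M\<^esub>"
    using linear_smult[OF r(2) embed(1)[OF t] u(1)] u(2) detectedD(4)[OF det embed(1)[OF t] embed(2)[OF t]] by simp
qed

text \<open>The maximal ideal of \<open>T\<close> is a direct summand of the first syzygy of \<open>M\<close>.\<close>

lemma tor_vanishes_descend:
  assumes res: "free_resolution R M B d e" and det: "detected R S k a p M x f"
    and C: "free_resolution R nR C c w" and N: "module R N"
    and van: "tor_vanishes R N B d (Suc (Suc n))"
  shows "tor_vanishes R N C c (Suc n)"
proof -
  let ?F = "free_module R (B 0)"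
  let ?K = "kernel_module ?F M e"
  interpret F: module R ?F by (rule free_module_is_module[OF R.is_cring])
  obtain u \<psi> where u: "u \<in> carrier ?F" "e u = x"
    and \<psi>: "linear R ?F TR \<psi>" "\<psi> u = \<one>\<^bsub>T\<^esub>" "linear R ?K nR \<psi>"
    by (rule normalized_lift[OF res det])
  note emb = embed_smult_kernel[OF res det u]
  let ?j = "\<lambda>t. embed t \<odot>\<^bsub>?F\<^esub> u"
  have j: "linear R nR ?K ?j"
  proof (rule linearI)
    fix t assume "t \<in> carrier nR"
    hence t: "t \<in> carrier T" "q t = \<zero>\<^bsub>k\<^esub>" by auto
    show "?j t \<in> carrier ?K" using emb[OF t] by simp
    show "?j (r \<odot>\<^bsub>nR\<^esub> t) = r \<odot>\<^bsub>?K\<^esub> ?j t" if r: "r \<in> carrier R" for r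
    proof -
      have rc: "r \<otimes>\<^bsub>R\<^esub> embed t \<in> carrier R" "a (r \<otimes>\<^bsub>R\<^esub> embed t) = \<zero>\<^bsub>S\<^esub>" "b (r \<otimes>\<^bsub>R\<^esub> embed t) = b r \<otimes>\<^bsub>T\<^esub> t"
        using embed[OF t] r by auto
      have "embed (b r \<otimes>\<^bsub>T\<^esub> t) = r \<otimes>\<^bsub>R\<^esub> embed t"
        using embed_eqI[OF rc(1,2)] rc(3) t r by simp
      thus ?thesis using F.smult_assoc1[OF r embed(1)[OF t] u(1)] by simp
    qed
    fix t' assume "t' \<in> carrier nR"
    hence t': "t' \<in> carrier T" "q t' = \<zero>\<^bsub>k\<^esub>" by auto
    have tc: "embed t \<oplus>\<^bsub>R\<^esub> embed t' \<in> carrier R" "a (embed t \<oplus>\<^bsub>R\<^esub> embed t') = \<zero>\<^bsub>S\<^esub>" "b (embed t \<oplus>\<^bsub>R\<^esub> embed t') = t \<oplus>\<^bsub>T\<^esub> t'"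
      using embed[OF t] embed[OF t'] by auto
    have "embed (t \<oplus>\<^bsub>T\<^esub> t') = embed t \<oplus>\<^bsub>R\<^esub> embed t'"
      using embed_eqI[OF tc(1,2)] tc(3) t t' by simp
    thus "?j (t \<oplus>\<^bsub>nR\<^esub> t') = ?j t \<oplus>\<^bsub>?K\<^esub> ?j t'"
      using F.smult_l_distr[OF embed(1)[OF t] embed(1)[OF t'] u(1)] by simp
  qed
  have \<psi>j: "\<psi> (?j t) = t" if "t \<in> carrier nR" for t
  proof -
    have t: "t \<in> carrier T" "q t = \<zero>\<^bsub>k\<^esub>" using that by auto
    show ?thesis using linear_smult[OF \<psi>(1) embed(1)[OF t] u(1)] \<psi>(2) embed(3)[OF t] t by simp
  qed
  show ?thesis
    by (rule tor_vanishes_retract[OF C free_resolution_shift[OF res] j \<psi>(3) _ N tor_vanishes_shift[OF van]])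
       (rule \<psi>j)
qed

lemma functional_restrict:
  assumes "functional T q k N f"
  shows "functional R (\<lambda>r. p (a r)) k (restrict_scalars b N) f"
proof -
  have "linear R (restrict_scalars b N) (restrict_scalars b (restrict_scalars q (ring_module k))) f"
    by (rule linear_restrict_scalars[OF b_hom assms])
  hence "functional R (\<lambda>r. q (b r)) k (restrict_scalars b N) f" by (simp add: linear_def additive_def)
  thus ?thesis by (simp only: functional_swap)
qed

lemma nR_detected: obtains y g where "detected R T k b q nR y g"
proof -
  obtain g y where g: "functional T q k (T.ideal_module {x \<in> carrier T. q x = \<zero>\<^bsub>k\<^esub>}) g"
    "y \<in> {x \<in> carrier T. q x = \<zero>\<^bsub>k\<^esub>}" "g y = \<one>\<^bsub>k\<^esub>"
    by (rule T.ideal_functional[OF T.residue_ideal T.residue_ideal_nonzero])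
  have "functional R (\<lambda>r. q (b r)) k nR g"
    using functional_restrict[OF g(1)] by (simp only: functional_swap)
  hence "detected R T k b q nR y g" unfolding detected_def using g(2,3) by auto
  thus thesis by (rule that)
qed

lemma fg_detected:
  assumes "fg_module S X" "\<not> zero_module X"
  obtains x f where "detected R S k a p (restrict_scalars a X) x f"
proof -
  interpret X: module S X using assms(1) by (simp add: fg_module_def)
  obtain f x where f: "functional S p k X f" "x \<in> carrier X" "f x = \<one>\<^bsub>k\<^esub>"
    by (rule S.functional_exists[OF assms])
  have "functional R (\<lambda>r. p (a r)) k (restrict_scalars a X) f"
    using pullback.functional_restrict[OF swap f(1)] by (simp only: functional_swap)
  hence "detected R S k a p (restrict_scalars a X) x f" unfolding detected_def using f(2,3) by auto
  thus thesis by (rule that)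
qed

lemma tor_vanishes_1_same:
  assumes res: "free_resolution R M B d e" and det: "detected R S k a p M x f"
    and N: "module R N" and detN: "detected R S k a p N y g"
  shows "\<not> tor_vanishes R N B d (Suc 0)"
proof -
  let ?F = "free_module R (B 0)"
  obtain u \<psi> where u: "u \<in> carrier ?F" "e u = x"
    and \<psi>: "linear R ?F TR \<psi>" "\<psi> u = \<one>\<^bsub>T\<^esub>" "linear R (kernel_module ?F M e) nR \<psi>"
    by (rule normalized_lift[OF res det])
  obtain t h where h: "detected R T k b q nR t h" by (rule nR_detected)
  have hf: "functional R (\<lambda>r. p (a r)) k nR h" using detectedD(1)[OF h] functional_swap by blast
  have t: "t \<in> carrier T" "q t = \<zero>\<^bsub>k\<^esub>" using detectedD(2)[OF h] by auto
  note emb = embed_smult_kernel[OF res det u t]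
  have "\<psi> (embed t \<odot>\<^bsub>?F\<^esub> u) = t"
    using linear_smult[OF \<psi>(1) embed(1)[OF t] u(1)] \<psi>(2) embed(3)[OF t] t by simp
  hence h1: "h (\<psi> (embed t \<odot>\<^bsub>?F\<^esub> u)) = \<one>\<^bsub>k\<^esub>" using detectedD(3)[OF h] by simp
  have "(embed t \<odot>\<^bsub>?F\<^esub> u) c \<odot>\<^bsub>N\<^esub> y = \<zero>\<^bsub>N\<^esub>" for c
    using detectedD(4)[OF detN, of "embed t \<otimes>\<^bsub>R\<^esub> u c"] embed[OF t] free_module_closed[OF u(1)]
    by (simp add: free_module_smult)
  from tor_vanishes_1_obstruction[OF res N S.k.field_axioms linear_compose[OF \<psi>(3) hf] detectedD(1)[OF detN]
      residue_closed emb h1 detectedD(2,3)[OF detN] this]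
  show ?thesis .
qed

section \<open>Freeness\<close>

text \<open>
  If a relation \<open>c\<close> among minimal generators of \<open>W\<close> has \<open>c j \<noteq> 0\<close>, then \<open>\<Sum>\<^sub>i (0, c i) u \<otimes> w\<^sub>i\<close>
  is a cycle; multiplying by the \<open>j\<close>-th coordinate, which is well defined modulo the ideal \<open>I\<close> of
  \<open>j\<close>-th coordinates of relations, detects it in \<open>T/J\<close>, where \<open>\<nn>I \<subseteq> J \<subset> I\<close>.
\<close>

lemma tor_vanishes_1_free:
  fixes W :: "('t, 'w) module"
  assumes res: "free_resolution R M B d e" and det: "detected R S k a p M x f"
    and W: "fg_module T W" and van: "tor_vanishes R (restrict_scalars b W) B d (Suc 0)"
  shows "is_free_module T W"
proof -
  interpret W: module T W using W by (simp add: fg_module_def)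
  note r = free_resolutionD[OF res]
  let ?WR = "restrict_scalars b W"
  have WR: "module R ?WR" by (rule restrict_scalars_is_module[OF R.is_cring b_hom W.module_axioms])
  obtain A where A: "minimal_generators T q k W A" by (rule T.minimal_generators_exist[OF W])
  note A = minimal_generatorsD[OF A]
  let ?G = "free_module T A" and ?l = "linear_ext T W id"
  have id: "id \<in> A \<rightarrow> carrier W" using A(2) by auto
  note l = linear_ext_linear[OF W.module_axioms id]
  have G: "module T ?G" by (rule free_module_is_module[OF T.S.is_cring])
  interpret G: module T ?G by (rule G)
  have "c0 = \<zero>\<^bsub>?G\<^esub>" if c0: "c0 \<in> carrier ?G" "?l c0 = \<zero>\<^bsub>W\<^esub>" for c0
  proof (rule ccontr)
    assume "c0 \<noteq> \<zero>\<^bsub>?G\<^esub>"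
    then obtain j where j: "c0 j \<noteq> \<zero>\<^bsub>T\<^esub>" unfolding free_module_zero by blast
    have jA: "j \<in> A" using free_module_outside[OF c0(1)] j by blast
    let ?K = "{c \<in> carrier ?G. ?l c = \<zero>\<^bsub>W\<^esub>}"
    have K: "submodule ?K T ?G" by (rule kernel_submodule[OF G W.module_axioms l])
    note Ks = G.submoduleE[OF K]
    let ?I = "(\<lambda>c. c j) ` ?K"
    have cT: "c i \<in> carrier T" if "c \<in> carrier ?G" for c i using that by (rule free_module_closed)
    have I: "ideal ?I T"
    proof (rule idealI[OF T.S.ring_axioms])
      show "subgroup ?I (add_monoid T)"
      proof (rule T.S.add.subgroupI)
        show "?I \<subseteq> carrier T" using cT by blast
        show "?I \<noteq> {}" using Ks(2) by blast
        fix y assume "y \<in> ?I"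
        then obtain c where c: "c \<in> ?K" "y = c j" by blast
        have "\<ominus>\<^bsub>T\<^esub> y = (\<ominus>\<^bsub>?G\<^esub> c) j"
          unfolding c(2) using c(1)
          by (intro additive_minus[OF G.abelian_group_axioms T.S.abelian_group_axioms
              free_module_coord_additive[OF T.S.is_cring], symmetric]) simp
        thus "\<ominus>\<^bsub>T\<^esub> y \<in> ?I" using Ks(3)[OF c(1)] by blast
        fix z assume "z \<in> ?I"
        then obtain c' where c': "c' \<in> ?K" "z = c' j" by blast
        have "y \<oplus>\<^bsub>T\<^esub> z = (c \<oplus>\<^bsub>?G\<^esub> c') j" unfolding c(2) c'(2) free_module_add ..
        thus "y \<oplus>\<^bsub>T\<^esub> z \<in> ?I" using Ks(5)[OF c(1) c'(1)] by blast
      qed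
      fix y t assume "y \<in> ?I" and t: "t \<in> carrier T"
      then obtain c where c: "c \<in> ?K" "y = c j" by blast
      have "t \<otimes>\<^bsub>T\<^esub> y = (t \<odot>\<^bsub>?G\<^esub> c) j" unfolding c(2) free_module_smult ..
      thus ty: "t \<otimes>\<^bsub>T\<^esub> y \<in> ?I" using Ks(4)[OF t c(1)] by blast
      have "y \<in> carrier T" using c cT by simp
      thus "y \<otimes>\<^bsub>T\<^esub> t \<in> ?I" using ty T.S.m_comm[OF t] by simp
    qed
    have "c0 j \<in> ?I" using c0 by blast
    hence "?I \<noteq> {\<zero>\<^bsub>T\<^esub>}" using j by blast
    then obtain \<mu> y where \<mu>: "functional T q k (T.ideal_module ?I) \<mu>" "y \<in> ?I" "\<mu> y = \<one>\<^bsub>k\<^esub>"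
      by (rule T.ideal_functional[OF I])
    obtain c where c: "c \<in> carrier ?G" "?l c = \<zero>\<^bsub>W\<^esub>" "y = c j" using \<mu>(2) by blast
    have qc: "q (c i) = \<zero>\<^bsub>k\<^esub>" for i by (rule A(4)[OF c(1,2)])
    interpret I: ideal ?I T by (rule I)
    let ?J = "{z \<in> ?I. \<mu> z = \<zero>\<^bsub>k\<^esub>}"
    let ?RT = "ring_module T"
    have RT: "module T ?RT" by (rule ring_module_is_module[OF T.S.is_cring])
    interpret RT: module T ?RT by (rule RT)
    have kq: "module T (restrict_scalars q (ring_module k))"
      by (rule restrict_scalars_is_module[OF T.S.is_cring T.hom ring_module_is_module[OF S.k.is_cring]])
    note \<mu>D = functionalD[OF \<mu>(1)]
    have Iuminus: "\<ominus>\<^bsub>?RT\<^esub> z \<in> ?I" if "z \<in> ?I" for z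
      using RT.submoduleE(3)[OF T.ideal_submodule[OF I] that] .
    have J: "submodule ?J T ?RT"
    proof (rule RT.submoduleI)
      show "?J \<subseteq> carrier ?RT" using I.a_subset by auto
      have "\<mu> \<zero>\<^bsub>T\<^esub> = \<zero>\<^bsub>k\<^esub>" using linear_zero[OF T.ideal_module_is_module[OF I] kq \<mu>(1)] by simp
      thus "\<zero>\<^bsub>?RT\<^esub> \<in> ?J" using I.zero_closed by simp
      show "z \<oplus>\<^bsub>?RT\<^esub> z' \<in> ?J" if "z \<in> ?J" "z' \<in> ?J" for z z'
        using that I.a_closed[of z z'] \<mu>D(2)[of z z'] by simp
      show Jt: "t \<odot>\<^bsub>?RT\<^esub> z \<in> ?J" if "t \<in> carrier T" "z \<in> ?J" for t z
        using that I.I_l_closed[of z t] \<mu>D(3)[of t z] by simp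
      show "\<ominus>\<^bsub>?RT\<^esub> z \<in> ?J" if z: "z \<in> ?J" for z
      proof -
        have zc: "z \<in> carrier T" using z I.a_subset by blast
        have "\<ominus>\<^bsub>?RT\<^esub> z = \<ominus>\<^bsub>?RT\<^esub> (\<one>\<^bsub>T\<^esub> \<odot>\<^bsub>?RT\<^esub> z)" using zc by simp
        also have "\<dots> = (\<ominus>\<^bsub>T\<^esub> \<one>\<^bsub>T\<^esub>) \<odot>\<^bsub>?RT\<^esub> z" using RT.smult_l_minus[of "\<one>\<^bsub>T\<^esub>" z] zc by simp
        finally show ?thesis using Jt[of "\<ominus>\<^bsub>T\<^esub> \<one>\<^bsub>T\<^esub>", OF _ z] by simp
      qed
    qed
    let ?Q = "quotient_module ?RT ?J"
    let ?\<pi> = "\<lambda>z. ?J +>\<^bsub>?RT\<^esub> z"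
    have Q: "module T ?Q" by (rule quotient_module_is_module[OF RT J])
    interpret Q: module T ?Q by (rule Q)
    note \<pi> = linear_quotient[OF RT J]
    have \<pi>zero: "?\<pi> z = \<zero>\<^bsub>?Q\<^esub> \<longleftrightarrow> z \<in> ?J" if "z \<in> carrier T" for z
      using quotient_eq_zero_iff[OF RT J, of z] that by (simp add: quotient_module_simps)
    define coord where "coord v = (SOME c. c \<in> carrier ?G \<and> ?l c = v)" for v
    have coord: "coord v \<in> carrier ?G" "?l (coord v) = v" if "v \<in> carrier W" for v
    proof -
      have "v \<in> ?l ` carrier ?G" unfolding A(3) by (rule that)
      hence "\<exists>c. c \<in> carrier ?G \<and> ?l c = v" by blast
      from someI_ex[OF this] show "coord v \<in> carrier ?G" "?l (coord v) = v" unfolding coord_def by auto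
    qed
    have coord_eq: "?\<pi> (t \<otimes>\<^bsub>T\<^esub> coord v j) = ?\<pi> (t \<otimes>\<^bsub>T\<^esub> g j)"
      if t: "t \<in> carrier T" "q t = \<zero>\<^bsub>k\<^esub>" and g: "g \<in> carrier ?G" "?l g = v" for t v g
    proof -
      have v: "v \<in> carrier W" using linear_closed[OF l g(1)] g(2) by simp
      note cv = coord[OF v]
      let ?h = "coord v \<ominus>\<^bsub>?G\<^esub> g"
      have h: "?h \<in> carrier ?G" by (rule G.M.minus_closed[OF cv(1) g(1)])
      have "?l ?h = \<zero>\<^bsub>W\<^esub>"
        using linear_minus[OF G W.module_axioms l cv(1) g(1)] cv(2) g(2) v by (simp add: a_minus_def W.M.r_neg)
      hence hI: "?h j \<in> ?I" using h by blast
      have "\<mu> (t \<otimes>\<^bsub>T\<^esub> ?h j) = \<zero>\<^bsub>k\<^esub>" using \<mu>D(3)[of t "?h j"] \<mu>D(1)[of "?h j"] hI t by simp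
      hence tJ: "t \<otimes>\<^bsub>T\<^esub> ?h j \<in> ?J" using I.I_l_closed[OF hI t(1)] by simp
      have "?h \<oplus>\<^bsub>?G\<^esub> g = coord v" using cv(1) g(1) by (simp add: a_minus_def G.M.a_assoc G.M.l_neg)
      hence "coord v j = ?h j \<oplus>\<^bsub>T\<^esub> g j" by (metis free_module_add)
      hence "t \<otimes>\<^bsub>T\<^esub> coord v j = t \<otimes>\<^bsub>T\<^esub> ?h j \<oplus>\<^bsub>T\<^esub> t \<otimes>\<^bsub>T\<^esub> g j"
        using t cT[OF h] cT[OF g(1)] by (simp add: T.S.r_distr)
      hence "?\<pi> (t \<otimes>\<^bsub>T\<^esub> coord v j) = ?\<pi> (t \<otimes>\<^bsub>T\<^esub> ?h j) \<oplus>\<^bsub>?Q\<^esub> ?\<pi> (t \<otimes>\<^bsub>T\<^esub> g j)"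
        using linear_add[OF \<pi>, of "t \<otimes>\<^bsub>T\<^esub> ?h j" "t \<otimes>\<^bsub>T\<^esub> g j"] t cT[OF h] cT[OF g(1)] by simp
      also have "?\<pi> (t \<otimes>\<^bsub>T\<^esub> ?h j) = \<zero>\<^bsub>?Q\<^esub>" using \<pi>zero[of "t \<otimes>\<^bsub>T\<^esub> ?h j"] tJ t(1) cT[OF h] by simp
      also have "\<zero>\<^bsub>?Q\<^esub> \<oplus>\<^bsub>?Q\<^esub> ?\<pi> (t \<otimes>\<^bsub>T\<^esub> g j) = ?\<pi> (t \<otimes>\<^bsub>T\<^esub> g j)"
        using linear_closed[OF \<pi>, of "t \<otimes>\<^bsub>T\<^esub> g j"] t(1) cT[OF g(1)] by simp
      finally show ?thesis .
    qed
    let ?F = "free_module R (B 0)"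
    have F: "module R ?F" by (rule free_module_is_module[OF R.is_cring])
    interpret F: module R ?F by (rule F)
    let ?KF = "kernel_module ?F M e"
    have KF: "module R ?KF" by (rule kernel_module_is_module[OF F r(1,2)])
    obtain u \<psi> where u: "u \<in> carrier ?F" "e u = x"
      and \<psi>: "linear R ?F TR \<psi>" "\<psi> u = \<one>\<^bsub>T\<^esub>" "linear R ?KF nR \<psi>"
      by (rule normalized_lift[OF res det])
    have \<psi>K: "\<psi> z \<in> carrier T" "q (\<psi> z) = \<zero>\<^bsub>k\<^esub>" if "z \<in> carrier ?KF" for z
      using linear_closed[OF \<psi>(3) that] by auto
    let ?\<beta> = "\<lambda>z v. ?\<pi> (\<psi> z \<otimes>\<^bsub>T\<^esub> coord v j)"
    have \<beta>_eq: "?\<beta> z v = ?\<pi> (\<psi> z \<otimes>\<^bsub>T\<^esub> g j)"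
      if "z \<in> carrier ?KF" "g \<in> carrier ?G" "?l g = v" for z v g
      by (rule coord_eq[OF \<psi>K[OF that(1)] that(2,3)])
    have bal: "balanced R ?KF ?WR ?Q ?\<beta>" unfolding balanced_def
    proof (intro conjI ballI additiveI KF WR Q.abelian_group_axioms)
      fix z v assume z: "z \<in> carrier ?KF" and "v \<in> carrier ?WR"
      hence v: "v \<in> carrier W" by simp
      note cv = coord[OF v]
      note zv = \<psi>K(1)[OF z] cT[OF cv(1), of j]
      show "?\<beta> z v \<in> carrier ?Q" using linear_closed[OF \<pi>, of "\<psi> z \<otimes>\<^bsub>T\<^esub> coord v j"] zv by simp
      show "?\<beta> z v \<in> carrier ?Q" using linear_closed[OF \<pi>, of "\<psi> z \<otimes>\<^bsub>T\<^esub> coord v j"] zv by simp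
      show "?\<beta> (z \<oplus>\<^bsub>?KF\<^esub> z') v = ?\<beta> z v \<oplus>\<^bsub>?Q\<^esub> ?\<beta> z' v" if z': "z' \<in> carrier ?KF" for z'
        using linear_add[OF \<psi>(3) z z'] linear_add[OF \<pi>, of "\<psi> z \<otimes>\<^bsub>T\<^esub> coord v j" "\<psi> z' \<otimes>\<^bsub>T\<^esub> coord v j"]
          zv \<psi>K(1)[OF z'] by (simp add: T.S.l_distr)
      show "?\<beta> z (v \<oplus>\<^bsub>?WR\<^esub> v') = ?\<beta> z v \<oplus>\<^bsub>?Q\<^esub> ?\<beta> z v'" if "v' \<in> carrier ?WR" for v'
      proof -
        have v': "v' \<in> carrier W" using that by simp
        note cv' = coord[OF v']
        have "?l (coord v \<oplus>\<^bsub>?G\<^esub> coord v') = v \<oplus>\<^bsub>?WR\<^esub> v'"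
          using linear_add[OF l cv(1) cv'(1)] cv(2) cv'(2) by simp
        from \<beta>_eq[OF z G.M.add.m_closed[OF cv(1) cv'(1)] this]
        show ?thesis using zv cT[OF cv'(1), of j]
            linear_add[OF \<pi>, of "\<psi> z \<otimes>\<^bsub>T\<^esub> coord v j" "\<psi> z \<otimes>\<^bsub>T\<^esub> coord v' j"]
          by (simp add: free_module_add T.S.r_distr)
      qed
      show "?\<beta> (s \<odot>\<^bsub>?KF\<^esub> z) v = ?\<beta> z (s \<odot>\<^bsub>?WR\<^esub> v)" if s: "s \<in> carrier R" for s
      proof -
        have "?l (b s \<odot>\<^bsub>?G\<^esub> coord v) = s \<odot>\<^bsub>?WR\<^esub> v"
          using linear_smult[OF l _ cv(1), of "b s"] cv(2) s by simp
        from \<beta>_eq[OF z G.smult_closed[OF _ cv(1)] this] s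
        have "?\<beta> z (s \<odot>\<^bsub>?WR\<^esub> v) = ?\<pi> (\<psi> z \<otimes>\<^bsub>T\<^esub> (b s \<otimes>\<^bsub>T\<^esub> coord v j))" by (simp add: free_module_smult)
        also have "\<psi> z \<otimes>\<^bsub>T\<^esub> (b s \<otimes>\<^bsub>T\<^esub> coord v j) = \<psi> (s \<odot>\<^bsub>?KF\<^esub> z) \<otimes>\<^bsub>T\<^esub> coord v j"
          using linear_smult[OF \<psi>(3) s z] zv s by (simp add: T.S.m_ac)
        finally show ?thesis by (rule sym)
      qed
    qed
    let ?v = "\<lambda>i. embed (c i) \<odot>\<^bsub>?F\<^esub> u"
    note emb = embed[OF cT[OF c(1)] qc]
    note embK = embed_smult_kernel[OF res det u cT[OF c(1)] qc]
    let ?\<phi> = "linear_ext R ?F ?v"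
    have v: "?v \<in> A \<rightarrow> carrier ?F" using embK(1) by blast
    have \<phi>: "linear R (free_module R A) ?F ?\<phi>" by (rule linear_ext_linear[OF F v])
    have eA: "basis_elem R i \<in> carrier (free_module R A)" if "i \<in> A" for i
      using that by (rule basis_elem_closed[OF R.is_cring])
    have \<phi>b: "?\<phi> (basis_elem R i) = ?v i" if "i \<in> A" for i by (rule linear_ext_basis[OF F that v])
    have zl: "linear R (free_module R A) M (\<lambda>_. \<zero>\<^bsub>M\<^esub>)"
    proof -
      interpret M: module R M by (rule r(1))
      show ?thesis by (rule linearI) auto
    qed
    have e\<phi>: "e (?\<phi> g) = \<zero>\<^bsub>M\<^esub>" if "g \<in> carrier (free_module R A)" for g
      by (rule linear_free_eqI[OF r(1) linear_compose[OF \<phi> r(2)] zl _ that]) (simp add: \<phi>b embK(2))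
    have \<phi>K: "linear R (free_module R A) ?KF ?\<phi>"
      by (rule linear_into_submodule[OF \<phi>]) (use e\<phi> linear_closed[OF \<phi>] in auto)
    let ?w = "\<lambda>i. if i \<in> A then i else \<zero>\<^bsub>W\<^esub>"
    have w: "?w \<in> fin_supp ?WR A"
      by (rule fin_suppI[of _ _ A]) (use A(1,2) in auto)
    have supp: "{i. ?w i \<noteq> \<zero>\<^bsub>?WR\<^esub>} \<subseteq> A" by auto
    have "extend_scalars R ?WR ?\<phi> ?w = (\<lambda>_. \<zero>\<^bsub>?WR\<^esub>)"
    proof
      fix h
      have uh: "u h \<in> carrier R" by (rule free_module_closed[OF u(1)])
      have "extend_scalars R ?WR ?\<phi> ?w h = (\<Oplus>\<^bsub>?WR\<^esub>i\<in>A. ?\<phi> (basis_elem R i) h \<odot>\<^bsub>?WR\<^esub> ?w i)"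
        unfolding extend_scalars_def
        by (rule tensor_eval_superset[OF balanced_smult[OF WR] linear_compose[OF \<phi> linear_coord[OF R.is_cring]]
              w A(1) supp subset_refl])
      also have "\<dots> = (\<Oplus>\<^bsub>?WR\<^esub>i\<in>A. b (u h) \<odot>\<^bsub>W\<^esub> (c i \<odot>\<^bsub>W\<^esub> i))"
      proof (rule abelian_monoid.finsum_cong'[OF abelian_group.axioms(1)[OF module_abelian_group[OF WR]] refl])
        show "(\<lambda>i. b (u h) \<odot>\<^bsub>W\<^esub> (c i \<odot>\<^bsub>W\<^esub> i)) \<in> A \<rightarrow> carrier ?WR"
          using A(2) cT[OF c(1)] uh by auto
        fix i assume i: "i \<in> A"
        have iW: "i \<in> carrier W" using i A(2) by blast
        show "?\<phi> (basis_elem R i) h \<odot>\<^bsub>?WR\<^esub> ?w i = b (u h) \<odot>\<^bsub>W\<^esub> (c i \<odot>\<^bsub>W\<^esub> i)"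
          unfolding \<phi>b[OF i] free_module_smult
          using i iW emb(1,3)[of i] uh cT[OF c(1), of i] T.S.m_comm[of "c i" "b (u h)"]
          by (simp add: W.smult_assoc1)
      qed
      also have "\<dots> = (\<Oplus>\<^bsub>W\<^esub>i\<in>A. b (u h) \<odot>\<^bsub>W\<^esub> (c i \<odot>\<^bsub>W\<^esub> i))"
        by (simp add: finsum_def finprod_def restrict_scalars_def)
      also have "\<dots> = b (u h) \<odot>\<^bsub>W\<^esub> (\<Oplus>\<^bsub>W\<^esub>i\<in>A. c i \<odot>\<^bsub>W\<^esub> i)"
        by (rule W.finsum_smult_ldistr[OF A(1) ab_simps(2)[OF uh], symmetric]) (use A(2) cT[OF c(1)] in auto)
      also have "(\<Oplus>\<^bsub>W\<^esub>i\<in>A. c i \<odot>\<^bsub>W\<^esub> i) = ?l c"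
        using linear_ext_superset[OF W.module_axioms c(1) id A(1) free_module_support[OF c(1)] subset_refl] by simp
      also have "b (u h) \<odot>\<^bsub>W\<^esub> ?l c = \<zero>\<^bsub>?WR\<^esub>" using c(2) uh by simp
      finally show "extend_scalars R ?WR ?\<phi> ?w h = \<zero>\<^bsub>?WR\<^esub>" .
    qed
    from tor_vanishes_1_pairing[OF res van \<phi> e\<phi> w this bal]
    have zero: "tensor_eval R ?WR ?Q ?\<beta> ?\<phi> ?w = \<zero>\<^bsub>?Q\<^esub>" .
    have \<pi>c: "?\<pi> (c i) \<in> carrier ?Q" for i using linear_closed[OF \<pi>, of "c i"] cT[OF c(1)] by simp
    have "tensor_eval R ?WR ?Q ?\<beta> ?\<phi> ?w = (\<Oplus>\<^bsub>?Q\<^esub>i\<in>A. ?\<beta> (?\<phi> (basis_elem R i)) (?w i))"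
      by (rule tensor_eval_superset[OF bal \<phi>K w A(1) supp subset_refl])
    also have "\<dots> = (\<Oplus>\<^bsub>?Q\<^esub>i\<in>A. if j = i then ?\<pi> (c i) else \<zero>\<^bsub>?Q\<^esub>)"
    proof (rule Q.M.finsum_cong'[OF refl])
      show "(\<lambda>i. if j = i then ?\<pi> (c i) else \<zero>\<^bsub>?Q\<^esub>) \<in> A \<rightarrow> carrier ?Q"
      proof
        fix i show "(if j = i then ?\<pi> (c i) else \<zero>\<^bsub>?Q\<^esub>) \<in> carrier ?Q"
          by (split if_split) (intro conjI impI \<pi>c Q.M.zero_closed)
      qed
      fix i assume i: "i \<in> A"
      have vK: "?v i \<in> carrier ?KF" using embK[of i] by simp
      have gi: "basis_elem T i \<in> carrier ?G" by (rule basis_elem_closed[OF T.S.is_cring i])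
      have li: "?l (basis_elem T i) = i" using linear_ext_basis[OF W.module_axioms i id] by simp
      have "\<psi> (?v i) = c i"
        using linear_smult[OF \<psi>(1) emb(1) u(1)] \<psi>(2) emb(3) cT[OF c(1)] by simp
      hence "?\<beta> (?\<phi> (basis_elem R i)) (?w i) = ?\<pi> (c i \<otimes>\<^bsub>T\<^esub> basis_elem T i j)"
        using \<beta>_eq[OF vK gi li] \<phi>b[OF i] i by simp
      also have "\<dots> = (if j = i then ?\<pi> (c i) else \<zero>\<^bsub>?Q\<^esub>)"
        using \<pi>zero[of "\<zero>\<^bsub>T\<^esub>"] RT.submoduleE(1)[OF J] submodule.axioms(1)[OF J] cT[OF c(1), of i]
          linear_zero[OF RT Q \<pi>] by (simp add: basis_elem_def)
      finally show "?\<beta> (?\<phi> (basis_elem R i)) (?w i) = (if j = i then ?\<pi> (c i) else \<zero>\<^bsub>?Q\<^esub>)" .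
    qed
    also have "\<dots> = ?\<pi> (c j)"
      by (rule Q.M.add.finprod_singleton[OF jA A(1)]) (use \<pi>c in blast)
    finally have "c j \<in> ?J" using zero \<pi>zero[of "c j"] cT[OF c(1)] by simp
    thus False using \<mu>(3) c(3) S.k.one_not_zero by simp
  qed
  hence ker: "c0 = \<zero>\<^bsub>?G\<^esub>" if "c0 \<in> carrier ?G" "?l c0 = \<zero>\<^bsub>W\<^esub>" for c0 using that by blast
  have "inj_on ?l (carrier ?G)"
  proof (rule inj_onI)
    fix c c' assume c: "c \<in> carrier ?G" "c' \<in> carrier ?G" "?l c = ?l c'"
    have "?l (c \<ominus>\<^bsub>?G\<^esub> c') = \<zero>\<^bsub>W\<^esub>"
      using linear_minus[OF G W.module_axioms l c(1,2)] c(3) linear_closed[OF l c(2)]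
      by (simp add: a_minus_def W.M.r_neg)
    note zero = ker[OF G.M.minus_closed[OF c(1,2)] this]
    have "c = (c \<ominus>\<^bsub>?G\<^esub> c') \<oplus>\<^bsub>?G\<^esub> c'" using c(1,2) by (simp add: a_minus_def G.M.a_assoc G.M.l_neg)
    also have "\<dots> = c'" unfolding zero using c(2) by simp
    finally show "c = c'" .
  qed
  thus ?thesis unfolding is_free_module_def using W.module_axioms A(2,3) by (auto simp: bij_betw_def)
qed

section \<open>Minimal relations of the maximal ideal\<close>

text \<open>
  If the maximal ideal has two minimal generators \<open>t\<^sub>1\<close> and \<open>t\<^sub>2\<close>, the Koszul relation
  \<open>t\<^sub>2 e\<^sub>1 - t\<^sub>1 e\<^sub>2\<close> is a minimal one, since all coefficients of relations lie in the maximal ideal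
  and \<open>t\<^sub>2\<close> is not in its square.
\<close>

lemma koszul_syzygy:
  assumes res: "free_resolution R nR B d e"
    and A: "minimal_generators T q k (T.ideal_module {x \<in> carrier T. q x = \<zero>\<^bsub>k\<^esub>}) A"
    and t12: "t1 \<in> A" "t2 \<in> A" "t1 \<noteq> t2"
  obtains z g where "functional R (\<lambda>r. p (a r)) k (kernel_module (free_module R (B 0)) nR e) g"
    "z \<in> carrier (free_module R (B 0))" "e z = \<zero>\<^bsub>nR\<^esub>" "g z = \<one>\<^bsub>k\<^esub>" "\<forall>c. a (z c) = \<zero>\<^bsub>S\<^esub>"
proof -
  note r = free_resolutionD[OF res]
  let ?nT = "T.ideal_module {x \<in> carrier T. q x = \<zero>\<^bsub>k\<^esub>}"
  have nT: "module T ?nT" by (rule T.ideal_module_is_module[OF T.residue_ideal])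
  interpret nR: module R nR by (rule nR_module)
  let ?F = "free_module R (B 0)"
  have F: "module R ?F" by (rule free_module_is_module[OF R.is_cring])
  interpret F: module R ?F by (rule F)
  have t: "t1 \<in> carrier T" "q t1 = \<zero>\<^bsub>k\<^esub>" "t2 \<in> carrier T" "q t2 = \<zero>\<^bsub>k\<^esub>"
    using minimal_generatorsD(2)[OF A] t12 by auto
  obtain f1 where f1: "functional T q k ?nT f1" "f1 t1 = \<one>\<^bsub>k\<^esub>" "\<forall>y\<in>A. y \<noteq> t1 \<longrightarrow> f1 y = \<zero>\<^bsub>k\<^esub>"
    by (rule T.dual_functional[OF nT A t12(1)])
  obtain f2 where f2: "functional T q k ?nT f2" "f2 t2 = \<one>\<^bsub>k\<^esub>" "\<forall>y\<in>A. y \<noteq> t2 \<longrightarrow> f2 y = \<zero>\<^bsub>k\<^esub>"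
    by (rule T.dual_functional[OF nT A t12(2)])
  note f1R = functional_restrict[OF f1(1)] and f2R = functional_restrict[OF f2(1)]
  obtain \<psi> where \<psi>: "linear R ?F TR \<psi>" "\<forall>x\<in>carrier ?F. q (\<psi> x) = f1 (e x)"
    by (rule lift_functional[OF res f1R])
  note \<psi>K = lift_functional_kernel[OF res f1R \<psi>(1) \<psi>(2)[rule_format]]
  have "t1 \<in> e ` carrier ?F" unfolding r(3) using t by simp
  then obtain u1 where u1: "u1 \<in> carrier ?F" "e u1 = t1" by blast
  have "t2 \<in> e ` carrier ?F" unfolding r(3) using t by simp
  then obtain u2 where u2: "u2 \<in> carrier ?F" "e u2 = t2" by blast
  note E1 = embed[OF t(1,2)] and E2 = embed[OF t(3,4)]
  let ?z1 = "embed t2 \<odot>\<^bsub>?F\<^esub> u1" and ?z2 = "embed t1 \<odot>\<^bsub>?F\<^esub> u2"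
  have z12: "?z1 \<in> carrier ?F" "?z2 \<in> carrier ?F"
    using F.smult_closed[OF E2(1) u1(1)] F.smult_closed[OF E1(1) u2(1)] by auto
  let ?z = "?z1 \<ominus>\<^bsub>?F\<^esub> ?z2"
  have z: "?z \<in> carrier ?F" by (rule F.M.minus_closed[OF z12])
  have zz: "?z \<oplus>\<^bsub>?F\<^esub> ?z2 = ?z1" using z12 by (simp add: a_minus_def F.M.a_assoc F.M.l_neg)
  have e12: "e ?z1 = t2 \<otimes>\<^bsub>T\<^esub> t1" "e ?z2 = t1 \<otimes>\<^bsub>T\<^esub> t2"
    using linear_smult[OF r(2) E2(1) u1(1)] linear_smult[OF r(2) E1(1) u2(1)] u1(2) u2(2) E1(3) E2(3) by simp_all
  have eq: "e ?z1 = e ?z2" unfolding e12 by (rule T.S.m_comm[OF t(3,1)])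
  have ez: "e ?z = \<zero>\<^bsub>nR\<^esub>"
    using linear_minus[OF F nR_module r(2) z12] linear_closed[OF r(2) z12(2)] eq
    by (simp only: a_minus_def nR.M.r_neg)
  let ?g = "\<lambda>x. f2 (\<psi> x)"
  have g: "functional R (\<lambda>r. p (a r)) k (kernel_module ?F nR e) ?g"
    by (rule linear_compose[OF \<psi>K f2R])
  have \<psi>u: "\<psi> u1 \<in> carrier T" "\<psi> u2 \<in> carrier T"
    using linear_closed[OF \<psi>(1) u1(1)] linear_closed[OF \<psi>(1) u2(1)] by auto
  have \<psi>z: "\<psi> ?z1 = \<psi> u1 \<odot>\<^bsub>?nT\<^esub> t2" "\<psi> ?z2 = \<psi> u2 \<odot>\<^bsub>?nT\<^esub> t1"
    using linear_smult[OF \<psi>(1) E2(1) u1(1)] linear_smult[OF \<psi>(1) E1(1) u2(1)] E1(3) E2(3)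
      T.S.m_comm[OF t(3) \<psi>u(1)] T.S.m_comm[OF t(1) \<psi>u(2)] by simp_all
  have "f2 (\<psi> ?z1) = q (\<psi> u1) \<otimes>\<^bsub>k\<^esub> f2 t2" "f2 (\<psi> ?z2) = q (\<psi> u2) \<otimes>\<^bsub>k\<^esub> f2 t1"
    unfolding \<psi>z using functionalD(3)[OF f2(1) \<psi>u(1), of t2] functionalD(3)[OF f2(1) \<psi>u(2), of t1] t by simp_all
  hence f2z: "f2 (\<psi> ?z1) = \<one>\<^bsub>k\<^esub>" "f2 (\<psi> ?z2) = \<zero>\<^bsub>k\<^esub>"
    using \<psi>(2)[rule_format, OF u1(1)] \<psi>(2)[rule_format, OF u2(1)] u1(2) u2(2) f1(2) f2(2) f2(3) f1(3) t12 by simp_all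
  have \<psi>n: "\<psi> ?z \<in> carrier ?nT" using linear_closed[OF \<psi>K, of ?z] z ez by simp
  have \<psi>n2: "\<psi> ?z2 \<in> carrier ?nT" unfolding \<psi>z(2) using module.smult_closed[OF nT \<psi>u(2), of t1] t by simp
  have "\<psi> ?z1 = \<psi> ?z \<oplus>\<^bsub>?nT\<^esub> \<psi> ?z2" using linear_add[OF \<psi>(1) z z12(2)] zz by simp
  hence "f2 (\<psi> ?z1) = f2 (\<psi> ?z) \<oplus>\<^bsub>k\<^esub> f2 (\<psi> ?z2)" using functionalD(2)[OF f2(1) \<psi>n \<psi>n2] by simp
  hence g1: "?g ?z = \<one>\<^bsub>k\<^esub>" unfolding f2z using functionalD(1)[OF f2(1) \<psi>n] by simp
  have "a (?z c) = \<zero>\<^bsub>S\<^esub>" for c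
  proof -
    have c: "u1 c \<in> carrier R" "u2 c \<in> carrier R" "?z c \<in> carrier R"
      using free_module_closed[OF u1(1)] free_module_closed[OF u2(1)] free_module_closed[OF z] by auto
    have "?z c \<oplus>\<^bsub>R\<^esub> embed t1 \<otimes>\<^bsub>R\<^esub> u2 c = embed t2 \<otimes>\<^bsub>R\<^esub> u1 c"
      using fun_cong[OF zz, of c] by (simp only: free_module_add free_module_smult)
    hence "a (?z c \<oplus>\<^bsub>R\<^esub> embed t1 \<otimes>\<^bsub>R\<^esub> u2 c) = a (embed t2 \<otimes>\<^bsub>R\<^esub> u1 c)" by simp
    thus ?thesis using c E1(1,2) E2(1,2) by simp
  qed
  hence "\<forall>c. a (?z c) = \<zero>\<^bsub>S\<^esub>" ..
  with g z ez g1 show thesis by (rule that)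
qed

lemma principal_syzygy:
  assumes res: "free_resolution R nR B d e" and ndvr: "\<not> discrete_valuation_domain T"
    and t: "t \<in> carrier T" "q t = \<zero>\<^bsub>k\<^esub>"
    and gen: "\<And>x. x \<in> carrier T \<Longrightarrow> q x = \<zero>\<^bsub>k\<^esub> \<Longrightarrow> \<exists>y\<in>carrier T. x = y \<otimes>\<^bsub>T\<^esub> t"
  obtains z g where "functional R (\<lambda>r. p (a r)) k (kernel_module (free_module R (B 0)) nR e) g"
    "z \<in> carrier (free_module R (B 0))" "e z = \<zero>\<^bsub>nR\<^esub>" "g z = \<one>\<^bsub>k\<^esub>" "\<forall>c. a (z c) = \<zero>\<^bsub>S\<^esub>"
proof -
  note r = free_resolutionD[OF res]
  let ?F = "free_module R (B 0)"
  have F: "module R ?F" by (rule free_module_is_module[OF R.is_cring])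
  interpret F: module R ?F by (rule F)
  let ?I = "{x \<in> carrier T. x \<otimes>\<^bsub>T\<^esub> t = \<zero>\<^bsub>T\<^esub>}"
  have I: "ideal ?I T"
  proof (rule idealI[OF T.S.ring_axioms])
    have "\<zero>\<^bsub>T\<^esub> \<otimes>\<^bsub>T\<^esub> t = \<zero>\<^bsub>T\<^esub>" using t by simp
    thus "subgroup ?I (add_monoid T)"
      by (intro T.S.add.subgroupI) (use t in \<open>auto simp: T.S.l_minus T.S.l_distr\<close>)
    fix x s assume x: "x \<in> ?I" and s: "s \<in> carrier T"
    show sx: "s \<otimes>\<^bsub>T\<^esub> x \<in> ?I" using x s t by (simp add: T.S.m_assoc)
    show "x \<otimes>\<^bsub>T\<^esub> s \<in> ?I" using sx x s T.S.m_comm[of x s] by simp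
  qed
  have t0: "t \<noteq> \<zero>\<^bsub>T\<^esub>"
  proof
    assume t0: "t = \<zero>\<^bsub>T\<^esub>"
    have "x = \<zero>\<^bsub>T\<^esub>" if "x \<in> carrier T" "q x = \<zero>\<^bsub>k\<^esub>" for x using gen[OF that] t0 by auto
    hence "{x \<in> carrier T. q x = \<zero>\<^bsub>k\<^esub>} = {\<zero>\<^bsub>T\<^esub>}" by auto
    thus False using T.residue_ideal_nonzero by simp
  qed
  have I0: "?I \<noteq> {\<zero>\<^bsub>T\<^esub>}"
  proof
    assume I0: "?I = {\<zero>\<^bsub>T\<^esub>}"
    have "discrete_valuation_domain T"
    proof (rule T.discrete_valuation_domainI[OF t(1)])
      show "q x = \<zero>\<^bsub>k\<^esub> \<longleftrightarrow> (\<exists>y\<in>carrier T. x = y \<otimes>\<^bsub>T\<^esub> t)" if "x \<in> carrier T" for x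
        using gen[OF that] t by auto
      show "x = \<zero>\<^bsub>T\<^esub>" if "x \<in> carrier T" "x \<otimes>\<^bsub>T\<^esub> t = \<zero>\<^bsub>T\<^esub>" for x using I0 that by blast
    qed
    thus False using ndvr by simp
  qed
  have qI: "q x = \<zero>\<^bsub>k\<^esub>" if x: "x \<in> ?I" for x
  proof (rule ccontr)
    assume nz: "q x \<noteq> \<zero>\<^bsub>k\<^esub>"
    have xc: "x \<in> carrier T" using x by simp
    obtain v where v: "v \<in> carrier T" "v \<otimes>\<^bsub>T\<^esub> x = \<one>\<^bsub>T\<^esub>" by (rule T.unit_if_residue_nonzero[OF xc nz])
    have "t = (v \<otimes>\<^bsub>T\<^esub> x) \<otimes>\<^bsub>T\<^esub> t" unfolding v(2) using t by simp
    also have "\<dots> = v \<otimes>\<^bsub>T\<^esub> (x \<otimes>\<^bsub>T\<^esub> t)" by (rule T.S.m_assoc[OF v(1) xc t(1)])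
    also have "\<dots> = \<zero>\<^bsub>T\<^esub>" using x v(1) by simp
    finally show False using t0 by simp
  qed
  obtain \<mu> y where \<mu>: "functional T q k (T.ideal_module ?I) \<mu>" "y \<in> ?I" "\<mu> y = \<one>\<^bsub>k\<^esub>"
    by (rule T.ideal_functional[OF I I0])
  have y: "y \<in> carrier T" "q y = \<zero>\<^bsub>k\<^esub>" "y \<otimes>\<^bsub>T\<^esub> t = \<zero>\<^bsub>T\<^esub>" using \<mu>(2) qI by auto
  note Ey = embed[OF y(1,2)]
  have m: "linear R TR nR (\<lambda>x. x \<otimes>\<^bsub>T\<^esub> t)"
    by (rule linearI) (use t in \<open>auto simp: T.S.l_distr T.S.m_assoc\<close>)
  have im: "e x \<in> (\<lambda>x. x \<otimes>\<^bsub>T\<^esub> t) ` carrier TR" if "x \<in> carrier ?F" for x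
    using gen[of "e x"] linear_closed[OF r(2) that] by auto
  obtain \<phi> where \<phi>: "linear R ?F TR \<phi>" "\<And>x. x \<in> carrier ?F \<Longrightarrow> \<phi> x \<otimes>\<^bsub>T\<^esub> t = e x"
    using free_module_lift[OF nR_module TR_module r(2) m im] by metis
  let ?K = "kernel_module ?F nR e"
  let ?IR = "restrict_scalars b (T.ideal_module ?I)"
  have \<phi>K: "linear R ?K ?IR \<phi>"
  proof (rule linearI)
    fix x assume x: "x \<in> carrier ?K"
    hence xF: "x \<in> carrier ?F" by simp
    have "\<phi> x \<otimes>\<^bsub>T\<^esub> t = \<zero>\<^bsub>T\<^esub>" unfolding \<phi>(2)[OF xF] using x by simp
    thus "\<phi> x \<in> carrier ?IR" using linear_closed[OF \<phi>(1) xF] by simp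
  qed (use linear_add[OF \<phi>(1)] linear_smult[OF \<phi>(1)] in auto)
  have g: "functional R (\<lambda>r. p (a r)) k ?K (\<lambda>x. \<mu> (\<phi> x))"
    by (rule linear_compose[OF \<phi>K functional_restrict[OF \<mu>(1)]])
  have "t \<in> e ` carrier ?F" unfolding r(3) using t by simp
  then obtain u where u: "u \<in> carrier ?F" "e u = t" by blast
  have \<phi>u: "\<phi> u \<in> carrier T" using linear_closed[OF \<phi>(1) u(1)] by simp
  have "(\<phi> u \<ominus>\<^bsub>T\<^esub> \<one>\<^bsub>T\<^esub>) \<otimes>\<^bsub>T\<^esub> t = \<phi> u \<otimes>\<^bsub>T\<^esub> t \<ominus>\<^bsub>T\<^esub> t"
    using \<phi>u t(1) by (simp add: a_minus_def T.S.l_distr T.S.l_minus)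
  also have "\<dots> = \<zero>\<^bsub>T\<^esub>" unfolding \<phi>(2)[OF u(1)] u(2) using t(1) by (simp add: a_minus_def T.S.r_neg)
  finally have "\<phi> u \<ominus>\<^bsub>T\<^esub> \<one>\<^bsub>T\<^esub> \<in> ?I" using \<phi>u by simp
  hence "q (\<phi> u \<ominus>\<^bsub>T\<^esub> \<one>\<^bsub>T\<^esub>) = \<zero>\<^bsub>k\<^esub>" by (rule qI)
  moreover have "(\<phi> u \<ominus>\<^bsub>T\<^esub> \<one>\<^bsub>T\<^esub>) \<oplus>\<^bsub>T\<^esub> \<one>\<^bsub>T\<^esub> = \<phi> u" using \<phi>u by (simp add: a_minus_def T.S.a_assoc T.S.l_neg)
  hence "q (\<phi> u) = q (\<phi> u \<ominus>\<^bsub>T\<^esub> \<one>\<^bsub>T\<^esub>) \<oplus>\<^bsub>k\<^esub> \<one>\<^bsub>k\<^esub>"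
    using T.p_simps(2)[of "\<phi> u \<ominus>\<^bsub>T\<^esub> \<one>\<^bsub>T\<^esub>" "\<one>\<^bsub>T\<^esub>"] \<phi>u by simp
  ultimately have q1: "q (\<phi> u) = \<one>\<^bsub>k\<^esub>" by simp
  let ?z = "embed y \<odot>\<^bsub>?F\<^esub> u"
  have z: "?z \<in> carrier ?F" by (rule F.smult_closed[OF Ey(1) u(1)])
  have ez: "e ?z = \<zero>\<^bsub>nR\<^esub>" using linear_smult[OF r(2) Ey(1) u(1)] u(2) Ey(3) y(3) by simp
  have "\<phi> ?z = \<phi> u \<odot>\<^bsub>T.ideal_module ?I\<^esub> y"
    using linear_smult[OF \<phi>(1) Ey(1) u(1)] Ey(3) T.S.m_comm[OF y(1) \<phi>u] by simp
  hence "\<mu> (\<phi> ?z) = \<one>\<^bsub>k\<^esub>" using functionalD(3)[OF \<mu>(1) \<phi>u, of y] \<mu>(2,3) q1 by simp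
  moreover have "\<forall>c. a (?z c) = \<zero>\<^bsub>S\<^esub>"
    using free_module_closed[OF u(1)] Ey(1,2) by (simp add: free_module_smult)
  ultimately show thesis by (intro that[OF g z ez])
qed

lemma non_dvr_syzygy:
  assumes res: "free_resolution R nR B d e" and ndvr: "\<not> discrete_valuation_domain T"
  obtains z g where "functional R (\<lambda>r. p (a r)) k (kernel_module (free_module R (B 0)) nR e) g"
    "z \<in> carrier (free_module R (B 0))" "e z = \<zero>\<^bsub>nR\<^esub>" "g z = \<one>\<^bsub>k\<^esub>" "\<forall>c. a (z c) = \<zero>\<^bsub>S\<^esub>"
proof -
  let ?nT = "T.ideal_module {x \<in> carrier T. q x = \<zero>\<^bsub>k\<^esub>}"
  have nT: "module T ?nT" by (rule T.ideal_module_is_module[OF T.residue_ideal])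
  obtain A where A: "minimal_generators T q k ?nT A"
    by (rule T.minimal_generators_exist[OF T.fg_ideal[OF T.residue_ideal]])
  note AD = minimal_generatorsD[OF A]
  have "A \<noteq> {}"
  proof
    assume "A = {}"
    with A have "minimal_generators T q k ?nT {}" by simp
    from T.minimal_generators_empty[OF nT this] T.residue_ideal_nonzero show False by (simp add: zero_module_def)
  qed
  then obtain t where t: "t \<in> A" by blast
  show thesis
  proof (cases "\<exists>t'\<in>A. t \<noteq> t'")
    case True
    then obtain t' where "t' \<in> A" "t \<noteq> t'" by blast
    thus thesis by (rule koszul_syzygy[OF res A t]) (rule that)
  next
    case False
    have At: "A = {t}"
    proof (rule equalityI)
      show "A \<subseteq> {t}"
      proof
        fix t' assume "t' \<in> A"
        hence "\<not> t \<noteq> t'" using False by blast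
        thus "t' \<in> {t}" by simp
      qed
      show "{t} \<subseteq> A" using t by simp
    qed
    have tT: "t \<in> carrier T" "q t = \<zero>\<^bsub>k\<^esub>" using AD(2) t by auto
    have gen: "\<exists>y\<in>carrier T. x = y \<otimes>\<^bsub>T\<^esub> t" if x: "x \<in> carrier T" "q x = \<zero>\<^bsub>k\<^esub>" for x
    proof -
      have "x \<in> linear_ext T ?nT id ` carrier (free_module T A)" unfolding AD(3) using x by simp
      then obtain c where c: "c \<in> carrier (free_module T A)" "x = linear_ext T ?nT id c" by blast
      have id: "id \<in> A \<rightarrow> carrier ?nT" using AD(2) by auto
      have "x = (\<Oplus>\<^bsub>?nT\<^esub>i\<in>A. c i \<odot>\<^bsub>?nT\<^esub> id i)" unfolding c(2)
        by (rule linear_ext_superset[OF nT c(1) id AD(1) free_module_support[OF c(1)] subset_refl])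
      also have "\<dots> = c t \<otimes>\<^bsub>T\<^esub> t"
      proof -
        interpret nT: module T ?nT by (rule nT)
        have "c t \<odot>\<^bsub>?nT\<^esub> t \<in> carrier ?nT" using nT.smult_closed[OF free_module_closed[OF c(1)], of t] tT by simp
        thus ?thesis unfolding At by (simp add: nT.M.finsum_insert)
      qed
      finally show ?thesis using free_module_closed[OF c(1)] by blast
    qed
    show thesis by (rule principal_syzygy[OF res ndvr tT gen]) (assumption, assumption, rule that)
  qed
qed

section \<open>Descent\<close>

abbreviation "mR \<equiv> residue_ideal_module S k a p"

lemma mR_detected: obtains y g where "detected R S k a p mR y g"
  by (rule pullback.nR_detected[OF swap])

lemma mR_resolution: "free_resolution R mR (res_gens R mR) (res_diff R mR) (res_aug R mR)"
  by (rule free_resolution_std[OF pullback.nR_module[OF swap]])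

lemma nR_resolution: "free_resolution R nR (res_gens R nR) (res_diff R nR) (res_aug R nR)"
  by (rule free_resolution_std[OF nR_module])

lemma tor_vanishes_nR:
  assumes "free_resolution R M B d e" "detected R S k a p M x f" "module R N"
    "tor_vanishes R N B d (Suc (Suc n))"
  shows "tor_vanishes R N (res_gens R nR) (res_diff R nR) (Suc n)"
  by (rule tor_vanishes_descend[OF assms(1,2) nR_resolution assms(3,4)])

lemma tor_vanishes_mR:
  assumes "free_resolution R M B d e" "detected R T k b q M x f" "module R N"
    "tor_vanishes R N B d (Suc (Suc n))"
  shows "tor_vanishes R N (res_gens R mR) (res_diff R mR) (Suc n)"
  by (rule pullback.tor_vanishes_nR[OF swap assms])

lemma tor_vanishes_two_steps:
  assumes res: "free_resolution R M B d e" and det: "detected R S k a p M x f" and N: "module R N"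
    and van: "tor_vanishes R N B d (Suc (Suc (Suc n)))"
  shows "tor_vanishes R N (res_gens R mR) (res_diff R mR) (Suc n)"
proof -
  obtain y g where "detected R T k b q nR y g" by (rule nR_detected)
  from tor_vanishes_mR[OF nR_resolution this N tor_vanishes_nR[OF res det N van]] show ?thesis .
qed

lemma tor_vanishes_odd:
  assumes res: "free_resolution R M B d e" and det: "detected R S k a p M x f" and N: "module R N"
    and van: "tor_vanishes R N B d (Suc (2 * m))"
  shows "m = 0 \<or> tor_vanishes R N (res_gens R mR) (res_diff R mR) (Suc 0)"
proof (cases m)
  case (Suc n)
  obtain y g where y: "detected R S k a p mR y g" by (rule mR_detected)
  have "tor_vanishes R N (res_gens R mR) (res_diff R mR) (Suc 0)"
    if "tor_vanishes R N (res_gens R mR) (res_diff R mR) (Suc (2 * n))" for n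
    using that
  proof (induction n)
    case (Suc n)
    from tor_vanishes_two_steps[OF mR_resolution y N, of "2 * n"] Suc show ?case by simp
  qed simp
  moreover have "tor_vanishes R N (res_gens R mR) (res_diff R mR) (Suc (2 * n))"
    using tor_vanishes_two_steps[OF res det N, of "2 * n"] van Suc by simp
  ultimately show ?thesis by blast
qed simp

lemma tor_vanishes_odd_same:
  assumes res: "free_resolution R M B d e" and det: "detected R S k a p M x f"
    and N: "module R N" and detN: "detected R S k a p N y g"
  shows "\<not> tor_vanishes R N B d (Suc (2 * m))"
proof
  assume van: "tor_vanishes R N B d (Suc (2 * m))"
  obtain z h where z: "detected R S k a p mR z h" by (rule mR_detected)
  show False
    using tor_vanishes_odd[OF res det N van] van tor_vanishes_1_same[OF res det N detN]
      tor_vanishes_1_same[OF mR_resolution z N detN] by auto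
qed

lemma tor_vanishes_odd_free:
  fixes W :: "('t, 'w) module"
  assumes res: "free_resolution R M B d e" and det: "detected R S k a p M x f"
    and W: "fg_module T W" and van: "tor_vanishes R (restrict_scalars b W) B d (Suc (2 * m))"
  shows "is_free_module T W"
proof -
  have "module T W" using W by (simp add: fg_module_def)
  hence WR: "module R (restrict_scalars b W)" by (rule restrict_scalars_is_module[OF R.is_cring b_hom])
  obtain z h where z: "detected R S k a p mR z h" by (rule mR_detected)
  show ?thesis
    using tor_vanishes_odd[OF res det WR van] van tor_vanishes_1_free[OF res det W]
      tor_vanishes_1_free[OF mR_resolution z W] by auto
qed

lemma tor_vanishes_nR_non_dvr:
  assumes N: "module R N" and detN: "detected R S k a p N y g" and ndvr: "\<not> discrete_valuation_domain T"
  shows "\<not> tor_vanishes R N (res_gens R nR) (res_diff R nR) (Suc (2 * n))"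
proof
  assume van: "tor_vanishes R N (res_gens R nR) (res_diff R nR) (Suc (2 * n))"
  let ?F = "free_module R (res_gens R nR 0)"
  let ?K = "kernel_module ?F nR (res_aug R nR)"
  obtain z g' where g': "functional R (\<lambda>r. p (a r)) k ?K g'"
    and z: "z \<in> carrier ?F" "res_aug R nR z = \<zero>\<^bsub>nR\<^esub>" "g' z = \<one>\<^bsub>k\<^esub>" "\<forall>c. a (z c) = \<zero>\<^bsub>S\<^esub>"
    by (rule non_dvr_syzygy[OF nR_resolution ndvr])
  have zR: "z c \<in> carrier R" for c by (rule free_module_closed[OF z(1)])
  show False
  proof (cases n)
    case 0
    have "z c \<odot>\<^bsub>N\<^esub> y = \<zero>\<^bsub>N\<^esub>" for c by (rule detectedD(4)[OF detN zR]) (use z(4) in blast)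
    from tor_vanishes_1_obstruction[OF nR_resolution N S.k.field_axioms g' detectedD(1)[OF detN] residue_closed
        z(1-3) detectedD(2,3)[OF detN] this] van 0 show False by simp
  next
    case (Suc n')
    have "detected R T k b q ?K z g'" unfolding detected_def
    proof (intro conjI ballI impI)
      show "functional R (\<lambda>r. q (b r)) k ?K g'" using g' by (simp only: functional_swap)
      show "z \<in> carrier ?K" using z(1,2) by simp
      show "g' z = \<one>\<^bsub>k\<^esub>" by (rule z(3))
      fix r assume r: "r \<in> carrier R" "b r = \<zero>\<^bsub>T\<^esub>"
      have "r \<otimes>\<^bsub>R\<^esub> z c = \<zero>\<^bsub>R\<^esub>" for c
      proof (rule jointly_inj)
        have zero: "a \<zero>\<^bsub>R\<^esub> = \<zero>\<^bsub>S\<^esub>" "b \<zero>\<^bsub>R\<^esub> = \<zero>\<^bsub>T\<^esub>"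
          using ring_hom_zero[OF a_hom R.ring_axioms S.S.ring_axioms] ring_hom_zero[OF b_hom R.ring_axioms T.S.ring_axioms] .
        show "a (r \<otimes>\<^bsub>R\<^esub> z c) = a \<zero>\<^bsub>R\<^esub>" using r(1) zR[of c] z(4) zero by simp
        show "b (r \<otimes>\<^bsub>R\<^esub> z c) = b \<zero>\<^bsub>R\<^esub>" using r zR[of c] zero by simp
      qed (use r zR in auto)
      thus "r \<odot>\<^bsub>?K\<^esub> z = \<zero>\<^bsub>?K\<^esub>" by (simp add: free_module_def)
    qed
    note K = this
    have "tor_vanishes R N (\<lambda>i. res_gens R nR (Suc i)) (\<lambda>i. res_diff R nR (Suc i)) (Suc (Suc (2 * n')))"
      by (rule tor_vanishes_shift) (use van Suc in simp)
    from tor_vanishes_mR[OF free_resolution_shift[OF nR_resolution] K N this]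
    have "tor_vanishes R N (res_gens R mR) (res_diff R mR) (Suc (2 * n'))" .
    moreover obtain w h where w: "detected R S k a p mR w h" by (rule mR_detected)
    ultimately show False using tor_vanishes_odd_same[OF mR_resolution w N detN] by blast
  qed
qed

lemma tor_vanishes_even_non_dvr:
  assumes res: "free_resolution R M B d e" and det: "detected R S k a p M x f"
    and N: "module R N" and detN: "detected R S k a p N y g" and ndvr: "\<not> discrete_valuation_domain T"
  shows "\<not> tor_vanishes R N B d (2 * m)"
proof (cases m)
  case 0
  thus ?thesis
    using tor_vanishes_0_obstruction[OF res N S.k.field_axioms detectedD(1)[OF det] detectedD(1)[OF detN]
        residue_closed detectedD(2,3)[OF det] detectedD(2,3)[OF detN]] by simp
next
  case (Suc n)
  thus ?thesis using tor_vanishes_nR_non_dvr[OF N detN ndvr, of n] tor_vanishes_nR[OF res det N, of "2 * n"] by auto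
qed

lemma zero_module_free:
  assumes M: "module S M" and "zero_module M" shows "is_free_module S M"
proof -
  have c: "carrier (free_module S {}) = {\<zero>\<^bsub>free_module S {}\<^esub>}" by (auto simp: free_module_def)
  have "linear_ext S M id \<zero>\<^bsub>free_module S {}\<^esub> = \<zero>\<^bsub>M\<^esub>" by (rule linear_ext_zero[OF M])
  hence "bij_betw (linear_ext S M id) (carrier (free_module S {})) (carrier M)"
    using assms(2) unfolding c zero_module_def by (simp add: bij_betw_def)
  thus ?thesis unfolding is_free_module_def using M by blast
qed

lemma same_side:
  fixes X :: "('s, 'x) module" and Y :: "('s, 'y) module"
  assumes X: "fg_module S X" and Y: "fg_module S Y"
  shows "zero_module (Tor R (2 * m + 1) (restrict_scalars a X) (restrict_scalars a Y)) \<Longrightarrow>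
      zero_module X \<or> zero_module Y"
    and "zero_module (Tor R (2 * m) (restrict_scalars a X) (restrict_scalars a Y)) \<Longrightarrow>
      \<not> zero_module X \<Longrightarrow> is_free_module S Y"
    and "\<not> discrete_valuation_domain T \<Longrightarrow>
      zero_module (Tor R (2 * m) (restrict_scalars a X) (restrict_scalars a Y)) \<Longrightarrow>
      zero_module X \<or> zero_module Y"
proof -
  let ?X = "restrict_scalars a X" and ?Y = "restrict_scalars a Y"
  have XS: "module S X" and YS: "module S Y" using X Y by (simp_all add: fg_module_def)
  have XR: "module R ?X" and YR: "module R ?Y"
    using restrict_scalars_is_module[OF R.is_cring a_hom] XS YS by auto
  note res = free_resolution_std[OF XR]
  note van = zero_Tor_tor_vanishes[OF XR YR]
  show "zero_module X \<or> zero_module Y" if "zero_module (Tor R (2 * m + 1) ?X ?Y)"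
  proof (rule ccontr)
    assume nz: "\<not> (zero_module X \<or> zero_module Y)"
    hence nzX: "\<not> zero_module X" and nzY: "\<not> zero_module Y" by auto
    obtain x f where x: "detected R S k a p ?X x f" by (rule fg_detected[OF X nzX])
    obtain y g where y: "detected R S k a p ?Y y g" by (rule fg_detected[OF Y nzY])
    show False using tor_vanishes_odd_same[OF res x YR y, of m] van[OF that] by simp
  qed
  show "zero_module X \<or> zero_module Y"
    if ndvr: "\<not> discrete_valuation_domain T" and "zero_module (Tor R (2 * m) ?X ?Y)"
  proof (rule ccontr)
    assume nz: "\<not> (zero_module X \<or> zero_module Y)"
    hence nzX: "\<not> zero_module X" and nzY: "\<not> zero_module Y" by auto
    obtain x f where x: "detected R S k a p ?X x f" by (rule fg_detected[OF X nzX])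
    obtain y g where y: "detected R S k a p ?Y y g" by (rule fg_detected[OF Y nzY])
    show False using tor_vanishes_even_non_dvr[OF res x YR y ndvr, of m] van[OF that(2)] by simp
  qed
  show "is_free_module S Y" if zero: "zero_module (Tor R (2 * m) ?X ?Y)" and nzX: "\<not> zero_module X"
  proof (cases "zero_module Y")
    case True
    then show ?thesis by (rule zero_module_free[OF YS])
  next
    case False
    obtain x f where x: "detected R S k a p ?X x f" by (rule fg_detected[OF X nzX])
    obtain y g where y: "detected R S k a p ?Y y g" by (rule fg_detected[OF Y False])
    obtain z h where z: "detected R T k b q nR z h" by (rule nR_detected)
    show ?thesis
    proof (cases m)
      case 0
      thus ?thesis using van[OF zero]
          tor_vanishes_0_obstruction[OF res YR S.k.field_axioms detectedD(1)[OF x] detectedD(1)[OF y]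
            residue_closed detectedD(2,3)[OF x] detectedD(2,3)[OF y]] by simp
    next
      case (Suc n)
      have "tor_vanishes R ?Y (res_gens R nR) (res_diff R nR) (Suc (2 * n))"
        by (rule tor_vanishes_nR[OF res x YR]) (use van[OF zero] Suc in simp)
      from pullback.tor_vanishes_odd_free[OF swap nR_resolution z Y this] show ?thesis .
    qed
  qed
qed

lemma opposite_sides:
  fixes Y :: "('s, 'y) module" and Z :: "('t, 'z) module"
  assumes Y: "fg_module S Y" and Z: "fg_module T Z"
  shows "zero_module (Tor R (2 * m) (restrict_scalars a Y) (restrict_scalars b Z)) \<Longrightarrow>
      zero_module Y \<or> zero_module Z"
    and "zero_module (Tor R (2 * m + 1) (restrict_scalars a Y) (restrict_scalars b Z)) \<Longrightarrow>
      \<not> zero_module Y \<Longrightarrow> is_free_module T Z"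
    and "\<not> discrete_valuation_domain S \<Longrightarrow> m > 0 \<Longrightarrow>
      zero_module (Tor R (2 * m + 1) (restrict_scalars a Y) (restrict_scalars b Z)) \<Longrightarrow>
      zero_module Y \<or> zero_module Z"
proof -
  let ?Y = "restrict_scalars a Y" and ?Z = "restrict_scalars b Z"
  have YS: "module S Y" and ZT: "module T Z" using Y Z by (simp_all add: fg_module_def)
  have YR: "module R ?Y" by (rule restrict_scalars_is_module[OF R.is_cring a_hom YS])
  have ZR: "module R ?Z" by (rule restrict_scalars_is_module[OF R.is_cring b_hom ZT])
  note res = free_resolution_std[OF YR]
  note van = zero_Tor_tor_vanishes[OF YR ZR]
  obtain w h where w: "detected R T k b q nR w h" by (rule nR_detected)
  show "zero_module Y \<or> zero_module Z" if "zero_module (Tor R (2 * m) ?Y ?Z)"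
  proof (rule ccontr)
    assume nz: "\<not> (zero_module Y \<or> zero_module Z)"
    hence nzY: "\<not> zero_module Y" and nzZ: "\<not> zero_module Z" by auto
    obtain y f where y: "detected R S k a p ?Y y f" by (rule fg_detected[OF Y nzY])
    obtain z g where z: "detected R T k b q ?Z z g" by (rule pullback.fg_detected[OF swap Z nzZ])
    have g: "functional R (\<lambda>r. p (a r)) k ?Z g" using detectedD(1)[OF z] by (simp only: functional_swap)
    show False
    proof (cases m)
      case 0
      thus ?thesis using van[OF that]
          tor_vanishes_0_obstruction[OF res ZR S.k.field_axioms detectedD(1)[OF y] g
            residue_closed detectedD(2,3)[OF y] detectedD(2,3)[OF z]] by simp
    next
      case (Suc n)
      have "tor_vanishes R ?Z (res_gens R nR) (res_diff R nR) (Suc (2 * n))"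
        by (rule tor_vanishes_nR[OF res y ZR]) (use van[OF that] Suc in simp)
      thus False using pullback.tor_vanishes_odd_same[OF swap nR_resolution w ZR z] by blast
    qed
  qed
  show "is_free_module T Z" if zero: "zero_module (Tor R (2 * m + 1) ?Y ?Z)" and nzY: "\<not> zero_module Y"
  proof -
    obtain y f where y: "detected R S k a p ?Y y f" by (rule fg_detected[OF Y nzY])
    show ?thesis by (rule tor_vanishes_odd_free[OF res y Z, of m]) (use van[OF zero] in simp)
  qed
  show "zero_module Y \<or> zero_module Z"
    if ndvr: "\<not> discrete_valuation_domain S" and m: "m > 0" and zero: "zero_module (Tor R (2 * m + 1) ?Y ?Z)"
  proof (rule ccontr)
    assume nz: "\<not> (zero_module Y \<or> zero_module Z)"
    hence nzY: "\<not> zero_module Y" and nzZ: "\<not> zero_module Z" by auto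
    obtain y f where y: "detected R S k a p ?Y y f" by (rule fg_detected[OF Y nzY])
    obtain z g where z: "detected R T k b q ?Z z g" by (rule pullback.fg_detected[OF swap Z nzZ])
    obtain n where n: "m = Suc n" using m by (cases m) auto
    have "tor_vanishes R ?Z (res_gens R nR) (res_diff R nR) (Suc (Suc (2 * n)))"
      by (rule tor_vanishes_nR[OF res y ZR]) (use van[OF zero] n in simp)
    moreover have "\<not> tor_vanishes R ?Z (res_gens R nR) (res_diff R nR) (2 * Suc n)"
      by (rule pullback.tor_vanishes_even_non_dvr[OF swap nR_resolution w ZR z ndvr])
    ultimately show False by simp
  qed
qed

end

lemma fiber_product_simps:
  "carrier (fiber_product S T p q) = {(s, t). s \<in> carrier S \<and> t \<in> carrier T \<and> p s = q t}"
  "x \<otimes>\<^bsub>fiber_product S T p q\<^esub> y = (fst x \<otimes>\<^bsub>S\<^esub> fst y, snd x \<otimes>\<^bsub>T\<^esub> snd y)"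
  "x \<oplus>\<^bsub>fiber_product S T p q\<^esub> y = (fst x \<oplus>\<^bsub>S\<^esub> fst y, snd x \<oplus>\<^bsub>T\<^esub> snd y)"
  "\<one>\<^bsub>fiber_product S T p q\<^esub> = (\<one>\<^bsub>S\<^esub>, \<one>\<^bsub>T\<^esub>)"
  "\<zero>\<^bsub>fiber_product S T p q\<^esub> = (\<zero>\<^bsub>S\<^esub>, \<zero>\<^bsub>T\<^esub>)"
  by (simp_all add: fiber_product_def RDirProd_def DirProd_def monoid.defs split: prod.split)

lemma fiber_product_pullback:
  fixes S :: "'s ring" and T :: "'t ring" and k :: "'k ring"
  assumes S: "residue_field S k p" and T: "residue_field T k q"
  shows "pullback S T k p q (fiber_product S T p q) fst snd"
proof -
  interpret S: residue_field S k p by (rule S)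
  interpret T: residue_field T k q by (rule T)
  let ?R = "fiber_product S T p q"
  have "cring ?R"
  proof (rule cringI)
    show "abelian_group ?R"
    proof (rule abelian_groupI)
      fix x assume x: "x \<in> carrier ?R"
      show "\<exists>y\<in>carrier ?R. y \<oplus>\<^bsub>?R\<^esub> x = \<zero>\<^bsub>?R\<^esub>"
        by (rule bexI[of _ "(\<ominus>\<^bsub>S\<^esub> fst x, \<ominus>\<^bsub>T\<^esub> snd x)"])
           (use x in \<open>auto simp: fiber_product_simps S.S.l_neg T.S.l_neg\<close>)
    qed (auto simp: fiber_product_simps S.S.a_ac T.S.a_ac)
    show "comm_monoid ?R"
      by (rule comm_monoidI) (auto simp: fiber_product_simps S.S.m_ac T.S.m_ac)
  qed (auto simp: fiber_product_simps S.S.l_distr T.S.l_distr)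
  thus ?thesis
  proof (intro pullback.intro pullback_axioms.intro S T)
    show "fst \<in> ring_hom ?R S" "snd \<in> ring_hom ?R T"
      by (auto intro!: ring_hom_memI simp: fiber_product_simps)
  qed (auto simp: fiber_product_simps)
qed

theorem theorem1p7:
  fixes S :: "'s ring" and T :: "'t ring" and k :: "'k ring" and R :: "('s \<times> 't) ring"
    and pS :: "'s \<Rightarrow> 'k" and pT :: "'t \<Rightarrow> 'k"
    and X :: "('s, 'x) module" and Y :: "('s, 'y) module" and Z :: "('t, 'z) module"
    and X' :: "('t, 'u) module" and Y' :: "('t, 'v) module" and Z' :: "('s, 'w) module"
    and m :: nat
  assumes "local_ring S" and "local_ring T" and "field k"
    and "pS \<in> ring_hom S k" and "pS ` carrier S = carrier k" and "pS \<notin> ring_iso S k"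
    and "pT \<in> ring_hom T k" and "pT ` carrier T = carrier k" and "pT \<notin> ring_iso T k"
    and "R = fiber_product S T pS pT"
  shows
    "(fg_module S X \<and> fg_module S Y \<and> fg_module T Z \<longrightarrow>
       (zero_module (Tor R (2 * m + 1) (restrict_scalars fst X) (restrict_scalars fst Y)) \<longrightarrow>
          zero_module X \<or> zero_module Y) \<and>
       (zero_module (Tor R (2 * m) (restrict_scalars fst Y) (restrict_scalars snd Z)) \<longrightarrow>
          zero_module Y \<or> zero_module Z) \<and>
       (zero_module (Tor R (2 * m) (restrict_scalars fst X) (restrict_scalars fst Y)) \<and>
          \<not> zero_module X \<longrightarrow> is_free_module S Y) \<and>
       (\<not> discrete_valuation_domain T \<and>
          zero_module (Tor R (2 * m) (restrict_scalars fst X) (restrict_scalars fst Y)) \<longrightarrow>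
          zero_module X \<or> zero_module Y) \<and>
       (zero_module (Tor R (2 * m + 1) (restrict_scalars fst Y) (restrict_scalars snd Z)) \<and>
          \<not> zero_module Y \<longrightarrow> is_free_module T Z) \<and>
       (\<not> discrete_valuation_domain S \<and> m > 0 \<and>
          zero_module (Tor R (2 * m + 1) (restrict_scalars fst Y) (restrict_scalars snd Z)) \<longrightarrow>
          zero_module Y \<or> zero_module Z)) \<and>
     (fg_module T X' \<and> fg_module T Y' \<and> fg_module S Z' \<longrightarrow>
       (zero_module (Tor R (2 * m + 1) (restrict_scalars snd X') (restrict_scalars snd Y')) \<longrightarrow>
          zero_module X' \<or> zero_module Y') \<and>
       (zero_module (Tor R (2 * m) (restrict_scalars snd Y') (restrict_scalars fst Z')) \<longrightarrow>
          zero_module Y' \<or> zero_module Z') \<and>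
       (zero_module (Tor R (2 * m) (restrict_scalars snd X') (restrict_scalars snd Y')) \<and>
          \<not> zero_module X' \<longrightarrow> is_free_module T Y') \<and>
       (\<not> discrete_valuation_domain S \<and>
          zero_module (Tor R (2 * m) (restrict_scalars snd X') (restrict_scalars snd Y')) \<longrightarrow>
          zero_module X' \<or> zero_module Y') \<and>
       (zero_module (Tor R (2 * m + 1) (restrict_scalars snd Y') (restrict_scalars fst Z')) \<and>
          \<not> zero_module Y' \<longrightarrow> is_free_module S Z') \<and>
       (\<not> discrete_valuation_domain T \<and> m > 0 \<and>
          zero_module (Tor R (2 * m + 1) (restrict_scalars snd Y') (restrict_scalars fst Z')) \<longrightarrow>
          zero_module Y' \<or> zero_module Z'))"
proof -
  have "residue_field S k pS" "residue_field T k pT"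
    using assms by (simp_all add: residue_field_def residue_field_axioms_def)
  from fiber_product_pullback[OF this] interpret P: pullback S T k pS pT R fst snd
    unfolding assms(10) .
  interpret Q: pullback T S k pT pS R snd fst by (rule P.swap)
  show ?thesis
    by (intro conjI impI; (elim conjE)?;
        rule P.same_side P.opposite_sides Q.same_side Q.opposite_sides; assumption)
qed

end
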